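(* Let $\{u_j\}_{j=1}^N\subset H^1(T\mathbb{S}^2)$ be a family of tangent vector fields on $\mathbb{S}^2$ that is orthonormal in $L^2(T\mathbb{S}^2)$, and let $\rho(s)=\sum_{j=1}^N|u_j(s)|^2$. Then $$\int_{\mathbb{S}^2}\rho(s)^2\,dS\le \frac{3\pi}{16}\sum_{j=1}^N\left(\|\mathrm{rot}\, u_j\|^2+\|\mathrm{div}\, u_j\|^2\right).$$ If, in addition, $\mathrm{div}\, u_j=0$ for all $j=1,\dots,N$, then $$\int_{\mathbb{S}^2}\rho(s)^2\,dS\le\frac{3\pi}{32}\sum_{j=1}^N\|\mathrm{rot}\, u_j\|^2,$$ and if, in addition, $\mathrm{rot}\, u_j=0$ for all $j=1,\dots,N$, then $$\int_{\mathbb{S}^2}\rho(s)^2\,dS\le\frac{3\pi}{32}\sum_{j=1}^N\|\mathrm{div}\, u_j\|^2.$$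
   Context: $\mathbb{S}^2$ is the unit sphere in $\mathbb{R}^3$ with its standard round metric and surface measure $dS$. $T\mathbb{S}^2$ is its tangent bundle; $L^2(T\mathbb{S}^2)$ and $H^1(T\mathbb{S}^2)$ are the $L^2$ and Sobolev $H^1$ spaces of (real) tangent vector fields, with inner product $(u,v)=\int_{\mathbb{S}^2}\langle u(s),v(s)\rangle\,dS$, and $|u(s)|$ is the Euclidean length of $u(s)\in T_s\mathbb{S}^2$. $\mathrm{div}$ is the Riemannian divergence. For a vector field $u$, $\mathrm{rot}\,u$ is the scalar function $\mathrm{rot}\,u:=\mathrm{div}(u^\perp)$, where in a local oriented orthonormal frame $u^\perp=(u_2,-u_1)$ (pointwise rotation by $90^\circ$). $\|\cdot\|$ is the $L^2$ norm. *)

theory Defs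
  imports "HOL-Analysis.Analysis"
begin

unbundle cross3_syntax

abbreviation S2 :: "(real^3) set" where
  "S2 \<equiv> sphere 0 1"

(* Surface measure dS: dS(A) is three times the volume of the solid cone {r x | x in A, 0 < r <= 1},
   since in polar coordinates dx = r^2 dr dS.  In particular the total mass is 4 pi. *)
definition surface_measure :: "(real^3) measure" where
  "surface_measure =
     scale_measure 3
       (distr (restrict_space lborel (cball 0 1 - {0})) (restrict_space borel S2) (\<lambda>x. x /\<^sub>R norm x))"

definition square_integrable :: "(real^3 \<Rightarrow> 'a::euclidean_space) \<Rightarrow> bool" where
  "square_integrable f \<longleftrightarrow>
     f \<in> borel_measurable surface_measure \<and> integrable surface_measure (\<lambda>s. (norm (f s))\<^sup>2)"

definition L2_norm_S2 :: "(real^3 \<Rightarrow> 'a::euclidean_space) \<Rightarrow> real" where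
  "L2_norm_S2 f = sqrt (\<integral>s. (norm (f s))\<^sup>2 \<partial>surface_measure)"

definition L2_inner_S2 :: "(real^3 \<Rightarrow> 'a::euclidean_space) \<Rightarrow> (real^3 \<Rightarrow> 'a) \<Rightarrow> real" where
  "L2_inner_S2 f g = (\<integral>s. f s \<bullet> g s \<partial>surface_measure)"

(* The tangent space at s is the orthogonal complement of s.  Only the values of a field on the
   sphere matter. *)
definition tangent_field :: "(real^3 \<Rightarrow> real^3) \<Rightarrow> bool" where
  "tangent_field u \<longleftrightarrow> (\<forall>s\<in>S2. u s \<bullet> s = 0)"

primrec C_k :: "nat \<Rightarrow> ('a::euclidean_space \<Rightarrow> 'b::real_normed_vector) \<Rightarrow> bool" where
  "C_k 0 f \<longleftrightarrow> continuous_on UNIV f"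
| "C_k (Suc k) f \<longleftrightarrow>
     f differentiable_on UNIV \<and> (\<forall>v. C_k k (\<lambda>x. frechet_derivative f (at x) v))"

definition smooth :: "('a::euclidean_space \<Rightarrow> 'b::real_normed_vector) \<Rightarrow> bool" where
  "smooth f \<longleftrightarrow> (\<forall>k. C_k k f)"

(* As the sphere is a closed submanifold of R^3, its smooth vector fields are exactly the
   restrictions of the smooth maps from R^3 to R^3 that are tangent along the sphere. *)
definition smooth_tangent_field :: "(real^3 \<Rightarrow> real^3) \<Rightarrow> bool" where
  "smooth_tangent_field \<phi> \<longleftrightarrow> smooth \<phi> \<and> tangent_field \<phi>"

definition tangent_proj :: "real^3 \<Rightarrow> real^3 \<Rightarrow> real^3" where
  "tangent_proj s v = v - (v \<bullet> s) *\<^sub>R s"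

(* The Levi-Civita covariant derivative of an embedded surface is the tangential part of the
   ambient derivative.  The endomorphism v |-> nabla_v phi of the tangent space at s is extended by
   0 to the normal direction, so that its trace and its Hilbert-Schmidt norm (which is the norm of
   the type real^3^3) are those of the endomorphism of the tangent space.  On the sphere the value
   depends only on the restriction of phi to the sphere. *)
definition cov_deriv :: "(real^3 \<Rightarrow> real^3) \<Rightarrow> real^3 \<Rightarrow> real^3^3" where
  "cov_deriv \<phi> s =
     matrix (\<lambda>v. tangent_proj s (frechet_derivative \<phi> (at s) (tangent_proj s v)))"

(* The H^1 space of tangent fields is the completion of the smooth tangent fields in the norm
   (|| u ||^2 + || nabla u ||^2)^(1/2), realised inside L^2: T is the covariant derivative of the
   L^2 field u if (u, T) is the L^2 limit of (phi n, nabla (phi n)) with smooth phi n. *)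
definition has_cov_deriv :: "(real^3 \<Rightarrow> real^3) \<Rightarrow> (real^3 \<Rightarrow> real^3^3) \<Rightarrow> bool" where
  "has_cov_deriv u T \<longleftrightarrow>
     square_integrable u \<and> tangent_field u \<and> square_integrable T \<and>
     (\<exists>\<phi>. (\<forall>n::nat. smooth_tangent_field (\<phi> n)) \<and>
          (\<lambda>n. L2_norm_S2 (\<lambda>s. \<phi> n s - u s)) \<longlonglongrightarrow> 0 \<and>
          (\<lambda>n. L2_norm_S2 (\<lambda>s. cov_deriv (\<phi> n) s - T s)) \<longlonglongrightarrow> 0)"

definition H1_TS2 :: "(real^3 \<Rightarrow> real^3) set" where
  "H1_TS2 = {u. \<exists>T. has_cov_deriv u T}"

(* T is determined by u up to a null set. *)
definition H1_cov_deriv :: "(real^3 \<Rightarrow> real^3) \<Rightarrow> real^3 \<Rightarrow> real^3^3" where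
  "H1_cov_deriv u = (SOME T. has_cov_deriv u T)"

definition div_S2 :: "(real^3 \<Rightarrow> real^3) \<Rightarrow> real^3 \<Rightarrow> real" where
  "div_S2 u s = trace (H1_cov_deriv u s)"

(* If (e1, e2) is an orthonormal frame with e1 \<times> e2 = s (outward orientation), then
   e1 \<times> s = - e2 and e2 \<times> s = e1, so u \<times> s = u2 e1 - u1 e2, that is (u2, -u1). *)
definition perp :: "(real^3 \<Rightarrow> real^3) \<Rightarrow> real^3 \<Rightarrow> real^3" where
  "perp u s = u s \<times> s"

definition rot_S2 :: "(real^3 \<Rightarrow> real^3) \<Rightarrow> real^3 \<Rightarrow> real" where
  "rot_S2 u = div_S2 (perp u)"

definition L2_orthonormal :: "nat \<Rightarrow> (nat \<Rightarrow> real^3 \<Rightarrow> real^3) \<Rightarrow> bool" where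
  "L2_orthonormal N u \<longleftrightarrow>
     (\<forall>i\<in>{1..N}. \<forall>j\<in>{1..N}. L2_inner_S2 (u i) (u j) = (if i = j then 1 else 0))"

definition rho :: "nat \<Rightarrow> (nat \<Rightarrow> real^3 \<Rightarrow> real^3) \<Rightarrow> real^3 \<Rightarrow> real" where
  "rho N u s = (\<Sum>j=1..N. (norm (u j s))\<^sup>2)"

end

theory Submission
  imports Defs
begin

text \<open>The proof is Rumin's spectral argument, carried out with vector spherical harmonics.

Let \<open>Y\<close> run through orthonormal bases of the spherical harmonics of degree \<open>n \<ge> 1\<close>, and put
\<open>\<lambda> = n (n + 1)\<close>. The fields \<open>s \<times> \<nabla>Y / \<surd>\<lambda>\<close> and their rotations by a right angle, which are
\<open>\<nabla>Y / \<surd>\<lambda>\<close>, form a complete orthonormal system \<open>e\<^sub>k\<close> of tangent fields (\<open>orthonormal_vharm\<close>,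
\<open>parseval_H1\<close>). Integration by parts turns \<open>\<lambda> (u, e\<^sub>k)\<^sup>2\<close> into \<open>(div u, Y)\<^sup>2\<close> for the gradient modes and into
\<open>(rot u, Y)\<^sup>2\<close> for the others, so Bessel's inequality bounds the energy \<open>\<Sum> \<lambda>\<^sub>k (u, e\<^sub>k)\<^sup>2\<close> by
\<open>\<parallel>div u\<parallel>\<^sup>2 + \<parallel>rot u\<parallel>\<^sup>2\<close>, mode type by mode type (\<open>energy_bound\<close>).

For a spectral parameter \<open>t\<close> let \<open>f\<^sub>\<lambda>(t) = 1 / (1 + (\<pi> t / 4 \<lambda>)\<^sup>2)\<close>, which satisfies \<open>\<integral>\<^sub>0\<^sup>\<infinity> f\<^sub>\<lambda>(t)\<^sup>2 dt = \<lambda>\<close>.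
Split \<open>u\<^sub>j = v\<^sub>j + w\<^sub>j\<close> with \<open>w\<^sub>j = \<Sum> (1 - f) (u\<^sub>j, e\<^sub>k) e\<^sub>k\<close>. As the \<open>u\<^sub>j\<close> are orthonormal, Bessel's inequality,
applied this time to the family \<open>u\<^sub>j\<close> and the kernel of the smoothing operator, gives
\<open>\<Sum>\<^sub>j |w\<^sub>j(s)|\<^sup>2 \<le> \<Sum>\<^sub>k (1 - f)\<^sup>2 |e\<^sub>k(s)|\<^sup>2\<close>. By the addition theorem the modes of one type and degree contribute at
most \<open>(2 n + 1) / 4 \<pi>\<close> to \<open>\<Sum> |e\<^sub>k(s)|\<^sup>2\<close>, and the elementary inequality \<open>degree_sum_bound\<close> bounds the sum by
\<open>A t\<close>, where \<open>A = \<pi> / 64\<close> for each type of mode (\<open>kernel_bound\<close>). The triangle inequality yields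
\<open>\<Sum>\<^sub>j |v\<^sub>j(s)|\<^sup>2 \<ge> (\<surd>\<rho>(s) - \<surd>(A t))\<^sub>+\<^sup>2\<close>. Integrated over \<open>t\<close> and \<open>s\<close>, the right-hand side becomes
\<open>\<integral> \<rho>\<^sup>2 / (6 A)\<close> and the left-hand side becomes the energy (\<open>rumin_bound\<close>). With both types of modes the constant
is \<open>6 \<cdot> 2 \<cdot> \<pi> / 64 = 3 \<pi> / 16\<close>; if all divergences or all rotations vanish, only one type occurs and the constant is
halved.

The spherical harmonics are handled as restrictions of homogeneous harmonic polynomials on space. All
integrations by parts come from the rotation invariance of the surface measure: the angular momentum operators \<open>L\<^sub>i\<close>, the derivatives along the rotations about the axes, have mean value zero
(\<open>integral_rotation_derivative\<close>) and satisfy \<open>\<Sum> L\<^sub>i L\<^sub>i = - n (n + 1)\<close> on harmonics of degree \<open>n\<close>. The addition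
theorem holds because the \<open>L\<^sub>i\<close> act on the harmonics of degree \<open>n\<close> by antisymmetric matrices (\<open>sum_sphharm_squares\<close>).
Completeness holds because multiplication by a coordinate keeps the span of the harmonics
(\<open>harm_coord\<close>), and because the tangential part of \<open>h e\<^sub>i\<close>, with \<open>h\<close> harmonic, is an explicit combination of
gradient and curl fields (\<open>vspan_tangent_proj_harm\<close>).\<close>

section \<open>The surface measure\<close>

abbreviation (input) dS :: "(real^3) measure" where
  "dS \<equiv> surface_measure"

lemma space_surface_measure [simp]: "space dS = S2"
  by (simp add: surface_measure_def space_scale_measure space_restrict_space)

lemma sets_surface_measure [measurable_cong]:
  "sets dS = sets (restrict_space borel S2)"
  by (simp add: surface_measure_def)

lemma radial_projection_measurable:
  "(\<lambda>x. x /\<^sub>R norm x) \<in> restrict_space lborel (cball 0 1 - {0}) \<rightarrow>\<^sub>M restrict_space borel S2"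
proof (rule measurable_restrict_space2)
  show "(\<lambda>x. x /\<^sub>R norm x) \<in> space (restrict_space lborel (cball 0 1 - {0::real^3})) \<rightarrow> S2"
    by (auto simp: space_restrict_space)
  have "(\<lambda>x::real^3. x /\<^sub>R norm x) \<in> borel_measurable lborel"
    by measurable
  then show "(\<lambda>x. x /\<^sub>R norm x) \<in> borel_measurable (restrict_space lborel (cball 0 1 - {0::real^3}))"
    by (rule measurable_restrict_space1)
qed

text \<open>The measure of a set is read off from the cone over it; all properties of the surface measure are
drawn from Lebesgue measure through this formula.\<close>

lemma emeasure_surface_measure:
  assumes "A \<in> sets dS"
  shows "emeasure dS A = 3 * emeasure lborel {x \<in> cball 0 1 - {0}. x /\<^sub>R norm x \<in> A}"
proof -
  have A: "A \<in> sets (restrict_space borel S2)" using assms by (simp add: sets_surface_measure)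
  have "emeasure dS A = 3 * emeasure (distr (restrict_space lborel (cball 0 1 - {0})) (restrict_space borel S2) (\<lambda>x. x /\<^sub>R norm x)) A"
    by (simp add: surface_measure_def emeasure_scale_measure)
  also have "\<dots> = 3 * emeasure (restrict_space lborel (cball 0 1 - {0::real^3})) ((\<lambda>x. x /\<^sub>R norm x) -` A \<inter> (cball 0 1 - {0}))"
    by (subst emeasure_distr[OF radial_projection_measurable A]) (simp add: space_restrict_space)
  also have "\<dots> = 3 * emeasure lborel ((\<lambda>x. x /\<^sub>R norm x) -` A \<inter> (cball 0 1 - {0}))"
    by (subst emeasure_restrict_space) auto
  also have "(\<lambda>x. x /\<^sub>R norm x) -` A \<inter> (cball 0 1 - {0}) = {x \<in> cball 0 1 - {0}. x /\<^sub>R norm x \<in> A}" by auto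
  finally show ?thesis .
qed

lemma emeasure_S2: "emeasure dS S2 = ennreal (4 * pi)"
proof -
  have S: "S2 \<in> sets dS" using sets.top[of dS] by simp
  have "{x \<in> cball 0 1 - {0::real^3}. x /\<^sub>R norm x \<in> S2} = cball 0 1 - {0}" by auto
  then have "emeasure dS S2 = 3 * emeasure lborel (cball 0 1 - {0::real^3})"
    by (simp add: emeasure_surface_measure[OF S])
  also have "emeasure lborel (cball 0 1 - {0::real^3}) = emeasure lborel (cball (0::real^3) 1)"
    by (rule emeasure_Diff_null_set) auto
  also have "\<dots> = ennreal (unit_ball_vol 3)"
    by (simp add: emeasure_cball)
  finally have "emeasure dS S2 = ennreal 3 * ennreal (4 / 3 * pi)"
    by (simp add: unit_ball_vol_3)
  also have "\<dots> = ennreal (3 * (4 / 3 * pi))"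
    by (rule ennreal_mult[symmetric]) auto
  finally show ?thesis by simp
qed

interpretation surface: finite_measure dS
  by standard (simp add: emeasure_S2)

lemma measure_S2: "measure dS S2 = 4 * pi"
  by (simp add: measure_def emeasure_S2)

lemma continuous_on_S2_measurable:
  fixes f :: "real^3 \<Rightarrow> 'a::euclidean_space"
  assumes "continuous_on S2 f"
  shows "f \<in> borel_measurable dS"
proof -
  have "f \<in> borel_measurable (restrict_space borel S2)"
    by (rule borel_measurable_continuous_on_restrict[OF assms])
  then show ?thesis
    using measurable_cong_sets[OF sets_surface_measure refl] by blast
qed

lemma continuous_on_S2_integrable:
  fixes f :: "real^3 \<Rightarrow> 'a::euclidean_space"
  assumes "continuous_on S2 f"
  shows "integrable dS f"
proof -
  have "compact (f ` S2)" using assms by (intro compact_continuous_image) auto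
  then obtain B where B: "\<And>x. x \<in> S2 \<Longrightarrow> norm (f x) \<le> B"
    by (meson bounded_iff compact_imp_bounded image_eqI)
  show ?thesis
    by (rule surface.integrable_const_bound[where B=B])
       (auto intro!: AE_I2 B continuous_on_S2_measurable assms)
qed

text \<open>It suffices to compare the two measures on boxes, and the preimage of a box under an orthogonal map is
the image of the box under the inverse map.\<close>

lemma lborel_orthogonal_invariant:
  fixes R :: "real^3 \<Rightarrow> real^3"
  assumes "orthogonal_transformation R"
  shows "distr lborel borel R = lborel"
proof (rule lborel_eqI[symmetric])
  have lin: "linear R" using assms by (rule orthogonal_transformation_linear)
  have contR: "continuous_on UNIV R" using lin by (simp add: linear_continuous_on linear_linear)
  then have m: "R \<in> borel_measurable lborel"
    by (simp add: borel_measurable_continuous_onI)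
  show "sets (distr lborel borel R) = sets borel" by simp
  fix l u :: "real^3"
  assume lu: "\<And>b. b \<in> Basis \<Longrightarrow> l \<bullet> b \<le> u \<bullet> b"
  have inv: "orthogonal_transformation (inv R)" using assms by (rule orthogonal_transformation_inv)
  have "bij R" using assms by (rule orthogonal_transformation_bij)
  then have eq: "R -` box l u = inv R ` box l u"
    by (simp add: bij_vimage_eq_inv_image)
  have lm: "inv R ` box l u \<in> lmeasurable"
    using inv by (intro measurable_orthogonal_image) auto
  have "emeasure (distr lborel borel R) (box l u) = emeasure lborel (R -` box l u)"
    using m by (subst emeasure_distr) auto
  also have "\<dots> = emeasure lebesgue (R -` box l u)"
  proof -
    have "R -` box l u \<in> sets lborel"
      using measurable_sets[OF m box_borel] by simp
    then show ?thesis
      by (simp add: emeasure_completion main_part_sets)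
  qed
  also have "\<dots> = emeasure lebesgue (inv R ` box l u)" by (simp only: eq)
  also have "\<dots> = ennreal (measure lebesgue (inv R ` box l u))"
    using lm by (simp add: emeasure_eq_measure2)
  also have "\<dots> = ennreal (measure lebesgue (box l u))"
    using inv by (simp add: measure_orthogonal_image)
  also have "\<dots> = emeasure lborel (box l u)"
    by (simp add: emeasure_lborel_box_eq measure_lborel_box_eq)
  also have "\<dots> = (\<Prod>b\<in>Basis. (u - l) \<bullet> b)"
    using lu by (simp add: emeasure_lborel_box_eq)
  finally show "emeasure (distr lborel borel R) (box l u) = ennreal (\<Prod>b\<in>Basis. (u - l) \<bullet> b)" .
qed


lemma orthogonal_measurable:
  assumes R: "orthogonal_transformation R"
  shows "R \<in> borel_measurable borel" "R \<in> dS \<rightarrow>\<^sub>M dS"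
proof -
  have "linear R" using R by (rule orthogonal_transformation_linear)
  then have "continuous_on UNIV R" by (simp add: linear_continuous_on linear_linear)
  then show mR: "R \<in> borel_measurable borel" by (rule borel_measurable_continuous_onI)
  have "R \<in> restrict_space borel S2 \<rightarrow>\<^sub>M restrict_space borel S2"
    using measurable_restrict_space1[OF mR]
    by (intro measurable_restrict_space2) (auto simp: space_restrict_space orthogonal_transformation_norm[OF R])
  then show "R \<in> dS \<rightarrow>\<^sub>M dS"
    using measurable_cong_sets[OF sets_surface_measure sets_surface_measure] by blast
qed

text \<open>Radial projection commutes with an orthogonal map, so the cone over the preimage of a set is the preimage of
its cone.\<close>

lemma surface_measure_orthogonal_invariant:
  assumes R: "orthogonal_transformation R"
  shows "distr dS dS R = dS"
proof (rule measure_eqI)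
  have lin: "linear R" using R by (rule orthogonal_transformation_linear)
  note mR = orthogonal_measurable(1)[OF R] and m = orthogonal_measurable(2)[OF R]
  have nR: "norm (R x) = norm x" for x using R by (rule orthogonal_transformation_norm)
  show "sets (distr dS dS R) = sets dS" by simp
  fix A assume "A \<in> sets (distr dS dS R)"
  then have A: "A \<in> sets dS" by simp
  have A': "R -` A \<inter> S2 \<in> sets dS"
    using measurable_sets[OF m A] by simp
  let ?B = "{x \<in> cball 0 1 - {0}. x /\<^sub>R norm x \<in> A}"
  have "?B = (\<lambda>x. x /\<^sub>R norm x) -` A \<inter> space (restrict_space lborel (cball 0 1 - {0}))"
    by (auto simp: space_restrict_space)
  also have "\<dots> \<in> sets (restrict_space lborel (cball 0 1 - {0}))"
    using A by (intro measurable_sets[OF radial_projection_measurable]) (simp add: sets_surface_measure)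
  finally have B: "?B \<in> sets lborel"
    by (subst (asm) sets_restrict_space_iff) auto
  have Rx0: "R x = 0 \<longleftrightarrow> x = 0" for x by (metis nR norm_eq_zero)
  have eq: "{x \<in> cball 0 1 - {0}. x /\<^sub>R norm x \<in> R -` A \<inter> S2} = R -` ?B"
    by (auto simp: nR Rx0 linear_scale[OF lin])
  have "emeasure (distr dS dS R) A = emeasure dS (R -` A \<inter> S2)"
    using emeasure_distr[OF m A] by simp
  also have "\<dots> = 3 * emeasure lborel (R -` ?B)"
    unfolding emeasure_surface_measure[OF A'] eq ..
  also have "emeasure lborel (R -` ?B) = emeasure (distr lborel borel R) ?B"
    using B mR by (subst emeasure_distr) auto
  also have "\<dots> = emeasure lborel ?B"
    by (simp add: lborel_orthogonal_invariant[OF R])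
  finally show "emeasure (distr dS dS R) A = emeasure dS A"
    by (simp add: emeasure_surface_measure[OF A])
qed

lemma integral_orthogonal_invariant:
  fixes f :: "real^3 \<Rightarrow> real"
  assumes R: "orthogonal_transformation R" and f: "f \<in> borel_measurable dS"
  shows "(\<integral>s. f (R s) \<partial>dS) = (\<integral>s. f s \<partial>dS)"
proof -
  have "(\<integral>s. f (R s) \<partial>dS) = (\<integral>s. f s \<partial>distr dS dS R)"
    by (rule integral_distr[symmetric, OF orthogonal_measurable(2)[OF R] f])
  then show ?thesis by (simp add: surface_measure_orthogonal_invariant[OF R])
qed

text \<open>The surface measure charges every nonempty open subset of the sphere, because the cone over such a set
contains a nonempty open subset of the ball.\<close>

lemma continuous_nonneg_integral_eq_0:
  fixes f :: "real^3 \<Rightarrow> real"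
  assumes c: "continuous_on S2 f" and nn: "\<And>s. s \<in> S2 \<Longrightarrow> 0 \<le> f s"
    and z: "(\<integral>s. f s \<partial>dS) = 0" and s: "s \<in> S2"
  shows "f s = 0"
proof (rule ccontr)
  assume "f s \<noteq> 0"
  then have pos: "f s > 0" using nn[OF s] by simp
  have "AE x in dS. f x = 0"
    using z by (subst (asm) integral_nonneg_eq_0_iff_AE)
      (auto intro!: continuous_on_S2_integrable c AE_I2 nn)
  then obtain N where N: "{x \<in> space dS. f x \<noteq> 0} \<subseteq> N" "N \<in> null_sets dS"
    by (auto elim!: AE_E2 simp: eventually_ae_filter)
  let ?U = "{x \<in> ball 0 1 - {0::real^3}. f (x /\<^sub>R norm x) > 0}"
  have g: "continuous_on (ball 0 1 - {0::real^3}) (\<lambda>x. f (x /\<^sub>R norm x))"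
  proof (rule continuous_on_compose2[OF c])
    show "continuous_on (ball 0 1 - {0::real^3}) (\<lambda>x. x /\<^sub>R norm x)"
      by (auto intro!: continuous_intros)
    show "(\<lambda>x. x /\<^sub>R norm x) ` (ball 0 1 - {0::real^3}) \<subseteq> S2"
      by (rule image_subsetI) simp
  qed
  have "open ?U"
  proof -
    have "?U = (ball 0 1 - {0::real^3}) \<inter> (\<lambda>x. f (x /\<^sub>R norm x)) -` {0<..}" by auto
    moreover have "open \<dots>"
      by (rule continuous_open_preimage[OF g]) auto
    ultimately show ?thesis by simp
  qed
  moreover have "(1/2) *\<^sub>R s \<in> ?U" using s pos by auto
  ultimately have "?U \<noteq> {}" "open ?U" by blast+
  then have U: "emeasure lborel ?U > 0"
  proof (intro zero_less_iff_neq_zero[THEN iffD2] notI)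
    assume "emeasure lborel ?U = 0"
    then have "?U \<in> null_sets lborel" using \<open>open ?U\<close> by (intro null_setsI) auto
    then have "negligible ?U" by (simp add: negligible_iff_null_sets null_sets_completionI)
    then show False using open_not_negligible \<open>open ?U\<close> \<open>?U \<noteq> {}\<close> by blast
  qed
  have "emeasure lborel ?U \<le> emeasure lborel {x \<in> cball 0 1 - {0}. x /\<^sub>R norm x \<in> N}"
  proof (rule emeasure_mono)
    show "?U \<subseteq> {x \<in> cball 0 1 - {0}. x /\<^sub>R norm x \<in> N}" using N(1) by auto
    have "{x \<in> cball 0 1 - {0}. x /\<^sub>R norm x \<in> N} = (\<lambda>x. x /\<^sub>R norm x) -` N \<inter> space (restrict_space lborel (cball 0 1 - {0}))"
      by (auto simp: space_restrict_space)
    also have "\<dots> \<in> sets (restrict_space lborel (cball 0 1 - {0}))"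
      using N(2) by (intro measurable_sets[OF radial_projection_measurable]) (auto simp: sets_surface_measure)
    finally show "{x \<in> cball 0 1 - {0}. x /\<^sub>R norm x \<in> N} \<in> sets lborel"
      by (subst (asm) sets_restrict_space_iff) auto
  qed
  moreover have "3 * emeasure lborel {x \<in> cball 0 1 - {0}. x /\<^sub>R norm x \<in> N} = 0"
    using emeasure_surface_measure[of N] null_setsD1[OF N(2)] null_setsD2[OF N(2)] by metis
  ultimately show False using U by auto
qed

section \<open>Square-integrable functions on the sphere\<close>

lemma square_integrable_measurable: "square_integrable f \<Longrightarrow> f \<in> borel_measurable dS"
  by (simp add: square_integrable_def)

lemma square_integrable_inner:
  fixes f g :: "real^3 \<Rightarrow> 'a::euclidean_space"
  assumes "square_integrable f" "square_integrable g"
  shows "integrable dS (\<lambda>s. f s \<bullet> g s)"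
proof (rule Bochner_Integration.integrable_bound)
  show "integrable dS (\<lambda>s. (norm (f s))\<^sup>2 + (norm (g s))\<^sup>2)"
    using assms by (intro Bochner_Integration.integrable_add) (simp_all add: square_integrable_def)
  have [measurable]: "f \<in> borel_measurable dS" "g \<in> borel_measurable dS"
    using assms by (simp_all add: square_integrable_def)
  show "(\<lambda>s. f s \<bullet> g s) \<in> borel_measurable dS" by measurable
  show "AE s in dS. norm (f s \<bullet> g s) \<le> norm ((norm (f s))\<^sup>2 + (norm (g s))\<^sup>2)"
  proof (rule AE_I2)
    fix s
    have "norm (f s \<bullet> g s) \<le> norm (f s) * norm (g s)" by (simp add: Cauchy_Schwarz_ineq2)
    also have "\<dots> \<le> (norm (f s))\<^sup>2 + (norm (g s))\<^sup>2"
      using sum_squares_bound[of "norm (f s)" "norm (g s)"]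
      using mult_nonneg_nonneg[OF norm_ge_zero norm_ge_zero, of "f s" "g s"] by linarith
    finally show "norm (f s \<bullet> g s) \<le> norm ((norm (f s))\<^sup>2 + (norm (g s))\<^sup>2)" by simp
  qed
qed

lemma square_integrable_scale:
  "square_integrable f \<Longrightarrow> square_integrable (\<lambda>s. c *\<^sub>R f s)"
  by (auto simp: square_integrable_def power_mult_distrib)

lemma square_integrable_add:
  fixes f g :: "real^3 \<Rightarrow> 'a::euclidean_space"
  assumes "square_integrable f" "square_integrable g"
  shows "square_integrable (\<lambda>s. f s + g s)"
proof -
  have "integrable dS (\<lambda>s. (norm (f s))\<^sup>2 + (norm (g s))\<^sup>2 + 2 * (f s \<bullet> g s))"
    using assms square_integrable_inner[OF assms]
    by (intro Bochner_Integration.integrable_add integrable_mult_right) (simp_all add: square_integrable_def)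
  moreover have "(norm (f s))\<^sup>2 + (norm (g s))\<^sup>2 + 2 * (f s \<bullet> g s) = (norm (f s + g s))\<^sup>2" for s
    by (simp add: power2_norm_eq_inner inner_add_left inner_add_right inner_commute)
  moreover have "(\<lambda>s. f s + g s) \<in> borel_measurable dS"
    using assms unfolding square_integrable_def by (intro borel_measurable_add) auto
  ultimately show ?thesis by (simp add: square_integrable_def)
qed

lemma square_integrable_0 [simp]: "square_integrable (\<lambda>s. 0)"
  by (simp add: square_integrable_def)

lemma square_integrable_diff:
  fixes f g :: "real^3 \<Rightarrow> 'a::euclidean_space"
  assumes "square_integrable f" "square_integrable g"
  shows "square_integrable (\<lambda>s. f s - g s)"
  using square_integrable_add[OF assms(1) square_integrable_scale[OF assms(2), of "-1"]] by simp

lemma square_integrable_sum: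
  fixes f :: "'k \<Rightarrow> real^3 \<Rightarrow> 'a::euclidean_space"
  assumes "\<And>k. k \<in> K \<Longrightarrow> square_integrable (f k)"
  shows "square_integrable (\<lambda>s. \<Sum>k\<in>K. f k s)"
  using assms
proof (induction K rule: infinite_finite_induct)
  case (insert k K)
  have "square_integrable (\<lambda>s. f k s + (\<Sum>k\<in>K. f k s))"
    by (rule square_integrable_add) (simp_all add: insert)
  then show ?case using insert by simp
qed simp_all

lemma L2_inner_commute: "L2_inner_S2 f g = L2_inner_S2 g f"
  by (simp add: L2_inner_S2_def inner_commute)

lemma L2_inner_sum_right:
  fixes f :: "real^3 \<Rightarrow> 'a::euclidean_space"
  assumes "square_integrable f" "\<And>k. k \<in> K \<Longrightarrow> square_integrable (g k)"
  shows "L2_inner_S2 f (\<lambda>s. \<Sum>k\<in>K. a k *\<^sub>R g k s) = (\<Sum>k\<in>K. a k * L2_inner_S2 f (g k))"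
proof -
  have "L2_inner_S2 f (\<lambda>s. \<Sum>k\<in>K. a k *\<^sub>R g k s) = (\<integral>s. (\<Sum>k\<in>K. a k * (f s \<bullet> g k s)) \<partial>dS)"
    by (simp add: L2_inner_S2_def inner_sum_right)
  also have "\<dots> = (\<Sum>k\<in>K. a k * L2_inner_S2 f (g k))"
    using assms by (subst Bochner_Integration.integral_sum) (auto simp: L2_inner_S2_def intro!: square_integrable_inner)
  finally show ?thesis .
qed

lemma L2_inner_sum_left:
  fixes f :: "real^3 \<Rightarrow> 'a::euclidean_space"
  assumes "square_integrable f" "\<And>k. k \<in> K \<Longrightarrow> square_integrable (g k)"
  shows "L2_inner_S2 (\<lambda>s. \<Sum>k\<in>K. a k *\<^sub>R g k s) f = (\<Sum>k\<in>K. a k * L2_inner_S2 (g k) f)"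
  using L2_inner_sum_right[OF assms] by (simp add: L2_inner_commute)

lemma L2_inner_diff:
  fixes f g :: "real^3 \<Rightarrow> 'a::euclidean_space"
  assumes "square_integrable f" "square_integrable g"
  shows "L2_inner_S2 (\<lambda>s. f s - g s) (\<lambda>s. f s - g s)
     = L2_inner_S2 f f - 2 * L2_inner_S2 f g + L2_inner_S2 g g"
proof -
  have "L2_inner_S2 (\<lambda>s. f s - g s) (\<lambda>s. f s - g s)
    = (\<integral>s. f s \<bullet> f s - 2 * (f s \<bullet> g s) + g s \<bullet> g s \<partial>dS)"
    by (simp add: L2_inner_S2_def inner_diff_left inner_diff_right inner_commute algebra_simps)
  then show ?thesis
    using assms by (simp add: L2_inner_S2_def square_integrable_inner)
qed

lemma L2_inner_nonneg: "0 \<le> L2_inner_S2 f f"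
  by (simp add: L2_inner_S2_def integral_nonneg_AE)

lemma L2_norm_sq: "(L2_norm_S2 f)\<^sup>2 = L2_inner_S2 f f"
  unfolding L2_norm_S2_def L2_inner_S2_def
  by (simp add: power2_norm_eq_inner integral_nonneg_AE)

lemma L2_norm_eq_sqrt: "L2_norm_S2 f = sqrt (L2_inner_S2 f f)"
  unfolding L2_norm_S2_def L2_inner_S2_def by (simp add: power2_norm_eq_inner)

text \<open>Orthonormality of an indexed family also records that its members are square-integrable: the Bochner integral
is 0 on functions that are not integrable, so the inner products alone would not show it.\<close>

definition orthonormal_on :: "'k set \<Rightarrow> ('k \<Rightarrow> real^3 \<Rightarrow> 'a::euclidean_space) \<Rightarrow> bool" where
  "orthonormal_on K e \<longleftrightarrow> (\<forall>k\<in>K. square_integrable (e k)) \<and>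
     (\<forall>k\<in>K. \<forall>l\<in>K. L2_inner_S2 (e k) (e l) = (if k = l then 1 else 0))"

lemma L2_inner_orthonormal_sum:
  assumes "finite K" "orthonormal_on K e"
  shows "L2_inner_S2 (\<lambda>s. \<Sum>k\<in>K. a k *\<^sub>R e k s) (\<lambda>s. \<Sum>k\<in>K. a k *\<^sub>R e k s) = (\<Sum>k\<in>K. (a k)\<^sup>2)"
proof -
  have sq: "\<And>k. k \<in> K \<Longrightarrow> square_integrable (e k)" using assms by (simp add: orthonormal_on_def)
  have "L2_inner_S2 (\<lambda>s. \<Sum>k\<in>K. a k *\<^sub>R e k s) (\<lambda>s. \<Sum>k\<in>K. a k *\<^sub>R e k s)
      = (\<Sum>k\<in>K. a k * L2_inner_S2 (\<lambda>s. \<Sum>l\<in>K. a l *\<^sub>R e l s) (e k))"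
    by (intro L2_inner_sum_right square_integrable_sum square_integrable_scale sq)
  also have "\<dots> = (\<Sum>k\<in>K. a k * (\<Sum>l\<in>K. a l * L2_inner_S2 (e l) (e k)))"
    by (intro sum.cong refl arg_cong2[where f="(*)"] L2_inner_sum_left sq)
  also have "\<dots> = (\<Sum>k\<in>K. a k * (\<Sum>l\<in>K. a l * (if l = k then 1 else 0)))"
    using assms(2) by (intro sum.cong refl arg_cong2[where f="(*)"]) (auto simp: orthonormal_on_def)
  also have "\<dots> = (\<Sum>k\<in>K. (a k)\<^sup>2)"
    using assms(1) by (intro sum.cong refl) (simp add: power2_eq_square if_distrib cong: if_cong)
  finally show ?thesis .
qed

text \<open>Completing the square in the coefficients. Bessel's inequality and the best approximation property of
the Fourier coefficients are both read off from this identity.\<close>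

lemma L2_inner_diff_orthonormal_sum:
  assumes "finite K" "orthonormal_on K e" "square_integrable f"
  shows "L2_inner_S2 (\<lambda>s. f s - (\<Sum>k\<in>K. a k *\<^sub>R e k s)) (\<lambda>s. f s - (\<Sum>k\<in>K. a k *\<^sub>R e k s))
    = L2_inner_S2 f f - (\<Sum>k\<in>K. (L2_inner_S2 f (e k))\<^sup>2) + (\<Sum>k\<in>K. (L2_inner_S2 f (e k) - a k)\<^sup>2)"
proof -
  have sq: "\<And>k. k \<in> K \<Longrightarrow> square_integrable (e k)" using assms by (simp add: orthonormal_on_def)
  have "L2_inner_S2 (\<lambda>s. f s - (\<Sum>k\<in>K. a k *\<^sub>R e k s)) (\<lambda>s. f s - (\<Sum>k\<in>K. a k *\<^sub>R e k s))
    = L2_inner_S2 f f - 2 * (\<Sum>k\<in>K. a k * L2_inner_S2 f (e k)) + (\<Sum>k\<in>K. (a k)\<^sup>2)"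
  proof -
    have "square_integrable (\<lambda>s. \<Sum>k\<in>K. a k *\<^sub>R e k s)"
      by (rule square_integrable_sum, rule square_integrable_scale, rule sq)
    from L2_inner_diff[OF assms(3) this] show ?thesis
      by (simp only: L2_inner_orthonormal_sum[OF assms(1,2)] L2_inner_sum_right[OF assms(3) sq])
  qed
  also have "\<dots> = L2_inner_S2 f f - (\<Sum>k\<in>K. (L2_inner_S2 f (e k))\<^sup>2) + (\<Sum>k\<in>K. (L2_inner_S2 f (e k) - a k)\<^sup>2)"
  proof -
    have "(\<Sum>k\<in>K. (L2_inner_S2 f (e k) - a k)\<^sup>2)
        = (\<Sum>k\<in>K. (L2_inner_S2 f (e k))\<^sup>2 - 2 * (a k * L2_inner_S2 f (e k)) + (a k)\<^sup>2)"
      by (intro sum.cong refl) (simp add: power2_diff)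
    then show ?thesis by (simp add: sum.distrib sum_subtractf sum_distrib_left)
  qed
  finally show ?thesis .
qed

lemma bessel_inequality:
  assumes "finite K" "orthonormal_on K e" "square_integrable f"
  shows "(\<Sum>k\<in>K. (L2_inner_S2 f (e k))\<^sup>2) \<le> L2_inner_S2 f f"
  using L2_inner_diff_orthonormal_sum[OF assms, of "\<lambda>k. L2_inner_S2 f (e k)"]
    L2_inner_nonneg[of "\<lambda>s. f s - (\<Sum>k\<in>K. L2_inner_S2 f (e k) *\<^sub>R e k s)"]
  by simp

lemma best_approximation:
  assumes "finite K" "orthonormal_on K e" "square_integrable f"
  shows "L2_inner_S2 f f - (\<Sum>k\<in>K. (L2_inner_S2 f (e k))\<^sup>2)
     \<le> L2_inner_S2 (\<lambda>s. f s - (\<Sum>k\<in>K. a k *\<^sub>R e k s)) (\<lambda>s. f s - (\<Sum>k\<in>K. a k *\<^sub>R e k s))"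
  unfolding L2_inner_diff_orthonormal_sum[OF assms] by (simp add: sum_nonneg)

lemma L2_inner_scale: "L2_inner_S2 (\<lambda>s. a *\<^sub>R f s) (\<lambda>s. b *\<^sub>R g s) = a * b * L2_inner_S2 f g"
  by (simp add: L2_inner_S2_def mult.assoc)

lemma L2_Cauchy_Schwarz:
  fixes f g :: "real^3 \<Rightarrow> 'a::euclidean_space"
  assumes f: "square_integrable f" and g: "square_integrable g"
  shows "(L2_inner_S2 f g)\<^sup>2 \<le> L2_inner_S2 f f * L2_inner_S2 g g"
proof -
  let ?a = "L2_inner_S2 f f" and ?b = "L2_inner_S2 g g" and ?c = "L2_inner_S2 f g"
  have q: "0 \<le> ?a - 2 * x * ?c + x\<^sup>2 * ?b" for x
  proof -
    have pos: "0 \<le> L2_inner_S2 f f - 2 * L2_inner_S2 f (\<lambda>s. x *\<^sub>R g s) + L2_inner_S2 (\<lambda>s. x *\<^sub>R g s) (\<lambda>s. x *\<^sub>R g s)"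
      using L2_inner_nonneg[of "\<lambda>s. f s - x *\<^sub>R g s"]
      unfolding L2_inner_diff[OF f square_integrable_scale[OF g]] .
    show ?thesis
    proof -
      have "L2_inner_S2 f (\<lambda>s. x *\<^sub>R g s) = x * ?c"
        by (simp add: L2_inner_S2_def)
      moreover have "L2_inner_S2 (\<lambda>s. x *\<^sub>R g s) (\<lambda>s. x *\<^sub>R g s) = x\<^sup>2 * ?b"
        by (simp only: L2_inner_scale power2_eq_square)
      ultimately show ?thesis using pos by simp
    qed
  qed
  show ?thesis
  proof (cases "?b = 0")
    case True
    have "?c = 0"
    proof (rule ccontr)
      assume "?c \<noteq> 0"
      then show False using q[of "(?a + 1) / (2 * ?c)"] True by simp
    qed
    then show ?thesis using True by simp
  next
    case False
    then have "?b > 0" using L2_inner_nonneg[of g] by simp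
    moreover have "2 * (?c / ?b) * ?c = 2 * (?c\<^sup>2 / ?b)" "(?c / ?b)\<^sup>2 * ?b = ?c\<^sup>2 / ?b"
      using False by (simp_all add: power2_eq_square)
    ultimately have "?c\<^sup>2 / ?b \<le> ?a" using q[of "?c / ?b"] by linarith
    then show ?thesis using \<open>?b > 0\<close> by (simp add: pos_divide_le_eq)
  qed
qed

lemma L2_norm_triangle:
  fixes f g :: "real^3 \<Rightarrow> 'a::euclidean_space"
  assumes f: "square_integrable f" and g: "square_integrable g"
  shows "L2_norm_S2 (\<lambda>s. f s - g s) \<le> L2_norm_S2 f + L2_norm_S2 g"
proof -
  have nn: "L2_norm_S2 f \<ge> 0" "L2_norm_S2 g \<ge> 0" by (simp_all add: L2_norm_eq_sqrt L2_inner_nonneg)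
  have "(L2_inner_S2 f g)\<^sup>2 \<le> (L2_norm_S2 f * L2_norm_S2 g)\<^sup>2"
    using L2_Cauchy_Schwarz[OF f g] by (simp add: power_mult_distrib L2_norm_sq)
  then have "\<bar>L2_inner_S2 f g\<bar>\<^sup>2 \<le> (L2_norm_S2 f * L2_norm_S2 g)\<^sup>2" by simp
  then have "\<bar>L2_inner_S2 f g\<bar> \<le> L2_norm_S2 f * L2_norm_S2 g"
    by (rule power2_le_imp_le) (simp add: nn)
  then have "(L2_norm_S2 (\<lambda>s. f s - g s))\<^sup>2 \<le> (L2_norm_S2 f + L2_norm_S2 g)\<^sup>2"
    unfolding L2_norm_sq[of "\<lambda>s. f s - g s"] L2_inner_diff[OF f g] L2_norm_sq[symmetric]
    unfolding power2_sum by linarith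
  then show ?thesis by (rule power2_le_imp_le) (simp add: nn)
qed

section \<open>Differential operators on polynomials\<close>

text \<open>The direction is the first argument, so that the operators \<open>dird v\<close> can be composed.\<close>

definition dird :: "real^3 \<Rightarrow> (real^3 \<Rightarrow> real) \<Rightarrow> real^3 \<Rightarrow> real" where
  "dird v f x = frechet_derivative f (at x) v"

abbreviation pd :: "3 \<Rightarrow> (real^3 \<Rightarrow> real) \<Rightarrow> real^3 \<Rightarrow> real" where
  "pd i \<equiv> dird (axis i 1)"

abbreviation poly3 :: "(real^3 \<Rightarrow> real) \<Rightarrow> bool" where
  "poly3 \<equiv> real_polynomial_function"

lemma poly3_coord [simp]: "poly3 (\<lambda>x. x $ i)"
  by (rule real_polynomial_function.intros(1), rule bounded_linear_vec_nth)

lemma poly3_simps [simp]: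
  "poly3 (\<lambda>x. c)"
  "poly3 f \<Longrightarrow> poly3 g \<Longrightarrow> poly3 (\<lambda>x. f x + g x)"
  "poly3 f \<Longrightarrow> poly3 g \<Longrightarrow> poly3 (\<lambda>x. f x * g x)"
  "poly3 f \<Longrightarrow> poly3 g \<Longrightarrow> poly3 (\<lambda>x. f x - g x)"
  "poly3 f \<Longrightarrow> poly3 (\<lambda>x. - f x)"
  "poly3 f \<Longrightarrow> poly3 (\<lambda>x. f x / c)"
  "poly3 f \<Longrightarrow> poly3 (\<lambda>x. f x ^ k)"
  by auto

lemma poly3_sum [simp]: "(\<And>i. i \<in> I \<Longrightarrow> poly3 (f i)) \<Longrightarrow> poly3 (\<lambda>x. \<Sum>i\<in>I. f i x)"
  by (cases "finite I") auto

lemma poly3_has_derivative: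
  assumes "poly3 f" shows "(f has_derivative (\<lambda>v. dird v f x)) (at x)"
  using differentiable_at_real_polynomial_function[OF assms, of x]
  by (simp add: dird_def[abs_def] frechet_derivative_works[symmetric])

lemma dird_eqI: "(f has_derivative f') (at x) \<Longrightarrow> dird v f x = f' v"
  unfolding dird_def by (metis frechet_derivative_at)

lemma dird_const [simp]: "dird v (\<lambda>x. c) = (\<lambda>x. 0)"
  by (rule ext, rule dird_eqI[where f'="\<lambda>_. 0"]) simp

lemma dird_bounded_linear: "bounded_linear f \<Longrightarrow> dird v f = (\<lambda>x. f v)"
  by (rule ext, rule dird_eqI) (rule bounded_linear_imp_has_derivative)

lemma dird_coord [simp]: "dird v (\<lambda>x. x $ i) = (\<lambda>x. v $ i)"
  by (rule dird_bounded_linear) (rule bounded_linear_vec_nth)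

lemma dird_add [simp]: "poly3 f \<Longrightarrow> poly3 g \<Longrightarrow> dird v (\<lambda>x. f x + g x) = (\<lambda>x. dird v f x + dird v g x)"
  by (rule ext, rule dird_eqI) (intro has_derivative_add poly3_has_derivative)

lemma dird_diff [simp]: "poly3 f \<Longrightarrow> poly3 g \<Longrightarrow> dird v (\<lambda>x. f x - g x) = (\<lambda>x. dird v f x - dird v g x)"
  by (rule ext, rule dird_eqI) (intro has_derivative_diff poly3_has_derivative)

lemma dird_mult [simp]: "poly3 f \<Longrightarrow> poly3 g \<Longrightarrow> dird v (\<lambda>x. f x * g x) = (\<lambda>x. f x * dird v g x + dird v f x * g x)"
  by (rule ext, rule dird_eqI) (intro has_derivative_mult poly3_has_derivative)

lemma dird_divide [simp]: "poly3 f \<Longrightarrow> dird v (\<lambda>x. f x / c) = (\<lambda>x. dird v f x / c)"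
  using dird_mult[of f "\<lambda>_. inverse c" v] by (simp add: divide_inverse)

lemma dird_sum [simp]:
  assumes "\<And>i. i \<in> I \<Longrightarrow> poly3 (f i)"
  shows "dird v (\<lambda>x. \<Sum>i\<in>I. f i x) = (\<lambda>x. \<Sum>i\<in>I. dird v (f i) x)"
  by (rule ext, rule dird_eqI) (intro has_derivative_sum poly3_has_derivative assms)

lemma poly3_dird [simp]: "poly3 f \<Longrightarrow> poly3 (dird v f)"
  by (induction rule: real_polynomial_function.induct) (simp_all add: dird_bounded_linear)

text \<open>By induction over the polynomial: this avoids the symmetry of second derivatives of general functions.\<close>

lemma dird_commute:
  "poly3 f \<Longrightarrow> dird v (dird w f) = dird w (dird v f)"
proof (induction rule: real_polynomial_function.induct)
  case (mult f g)
  then show ?case by (simp add: algebra_simps)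
qed (simp_all add: dird_bounded_linear)

lemma poly3_dird_linear:
  assumes "poly3 f"
  shows "dird v f x = v$1 * pd 1 f x + v$2 * pd 2 f x + v$3 * pd 3 f x"
proof -
  have lin: "linear (\<lambda>v. dird v f x)"
    using poly3_has_derivative[OF assms] has_derivative_linear by blast
  have v: "v = v$1 *\<^sub>R axis 1 1 + v$2 *\<^sub>R axis 2 1 + v$3 *\<^sub>R axis 3 1"
    by (simp add: vec_eq_iff forall_3 axis_def)
  show ?thesis
    by (subst v) (simp only: linear_add[OF lin] linear_scale[OF lin] real_scaleR_def)
qed

lemma poly3_continuous: "poly3 f \<Longrightarrow> continuous_on S f"
  using continuous_on_polymonial_function real_polynomial_function_eq by blast

definition homog :: "nat \<Rightarrow> (real^3 \<Rightarrow> real) \<Rightarrow> bool" where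
  "homog n f \<longleftrightarrow> (\<forall>c x. f (c *\<^sub>R x) = c ^ n * f x)"

lemma euler_homog:
  assumes "poly3 f" "homog n f"
  shows "x$1 * pd 1 f x + x$2 * pd 2 f x + x$3 * pd 3 f x = n * f x"
proof -
  have "((\<lambda>c. f (c *\<^sub>R x)) has_derivative (\<lambda>h. dird (h *\<^sub>R x) f (1 *\<^sub>R x))) (at 1)"
    by (rule has_derivative_compose[where g=f and f="\<lambda>c. c *\<^sub>R x"])
       (auto intro!: derivative_eq_intros poly3_has_derivative assms)
  moreover have "((\<lambda>c. c ^ n * f x) has_derivative (\<lambda>h. real n * h * f x)) (at 1)"
    by (auto intro!: derivative_eq_intros)
  moreover have "(\<lambda>c. f (c *\<^sub>R x)) = (\<lambda>c. c ^ n * f x)"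
    using assms(2) by (simp add: homog_def)
  ultimately have "(\<lambda>h. dird (h *\<^sub>R x) f (1 *\<^sub>R x)) = (\<lambda>h. real n * h * f x)"
    by (simp only:) (rule has_derivative_unique)
  from fun_cong[OF this, of 1] have "dird x f x = n * f x" by simp
  then show ?thesis using poly3_dird_linear[OF assms(1), of x x] by simp
qed

text \<open>For \<open>c = 0\<close> the chain rule gives nothing; that case follows from the others by continuity in \<open>c\<close>.\<close>

lemma homog_dird:
  assumes f: "poly3 f" "homog (Suc n) f"
  shows "homog n (dird v f)"
  unfolding homog_def
proof (intro allI)
  fix c x
  have *: "dird v f (c *\<^sub>R x) = c ^ n * dird v f x" if "c \<noteq> 0" for c
  proof -
    have "((\<lambda>y. f (c *\<^sub>R y)) has_derivative (\<lambda>h. dird (c *\<^sub>R h) f (c *\<^sub>R x))) (at x)"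
      by (rule has_derivative_compose[where g=f and f="\<lambda>y. c *\<^sub>R y"])
         (auto intro!: derivative_eq_intros poly3_has_derivative f)
    moreover have "((\<lambda>y. c ^ Suc n * f y) has_derivative (\<lambda>h. c ^ Suc n * dird h f x)) (at x)"
      by (auto intro!: derivative_eq_intros poly3_has_derivative f)
    moreover have "(\<lambda>y. f (c *\<^sub>R y)) = (\<lambda>y. c ^ Suc n * f y)"
      using f(2) by (simp add: homog_def)
    ultimately have "(\<lambda>h. dird (c *\<^sub>R h) f (c *\<^sub>R x)) = (\<lambda>h. c ^ Suc n * dird h f x)"
      by (simp only:) (rule has_derivative_unique)
    from fun_cong[OF this, of v] have "dird (c *\<^sub>R v) f (c *\<^sub>R x) = c ^ Suc n * dird v f x" .
    moreover have "dird (c *\<^sub>R v) f (c *\<^sub>R x) = c * dird v f (c *\<^sub>R x)"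
      unfolding poly3_dird_linear[OF f(1), of "c *\<^sub>R v"] poly3_dird_linear[OF f(1), of v] by (simp add: algebra_simps)
    ultimately show ?thesis using that by simp
  qed
  show "dird v f (c *\<^sub>R x) = c ^ n * dird v f x"
  proof (cases "c = 0")
    case True
    have c1: "((\<lambda>c. dird v f (c *\<^sub>R x)) \<longlongrightarrow> dird v f (0 *\<^sub>R x)) (at 0)"
    proof -
      have "continuous_on UNIV (\<lambda>c. dird v f (c *\<^sub>R x))"
        by (rule continuous_on_compose2[where t=UNIV, OF poly3_continuous]) (auto intro!: continuous_intros simp: f)
      then show ?thesis
        unfolding continuous_on_eq_continuous_at[OF open_UNIV] continuous_at by blast
    qed
    have c2: "((\<lambda>c. c ^ n * dird v f x) \<longlongrightarrow> 0 ^ n * dird v f x) (at 0)"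
      by (intro tendsto_intros)
    have "((\<lambda>c. dird v f (c *\<^sub>R x)) \<longlongrightarrow> 0 ^ n * dird v f x) (at 0)"
      by (rule Lim_transform_eventually[OF c2]) (auto simp: eventually_at_filter *)
    then show ?thesis using tendsto_unique[OF _ c1] True by simp
  qed (rule *)
qed

definition lap :: "(real^3 \<Rightarrow> real) \<Rightarrow> real^3 \<Rightarrow> real" where
  "lap f x = pd 1 (pd 1 f) x + pd 2 (pd 2 f) x + pd 3 (pd 3 f) x"

text \<open>The angular momentum operators: \<open>axis i 1 \<times> x\<close> is the velocity of \<open>x\<close> under the rotation about the
\<open>i\<close>-th axis.\<close>

definition Lop :: "3 \<Rightarrow> (real^3 \<Rightarrow> real) \<Rightarrow> real^3 \<Rightarrow> real" where
  "Lop i f x = dird (axis i 1 \<times> x) f x"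

lemma Lop_eq:
  assumes "poly3 f"
  shows "Lop 1 f = (\<lambda>x. x$2 * pd 3 f x - x$3 * pd 2 f x)"
    "Lop 2 f = (\<lambda>x. x$3 * pd 1 f x - x$1 * pd 3 f x)"
    "Lop 3 f = (\<lambda>x. x$1 * pd 2 f x - x$2 * pd 1 f x)"
  by (auto simp: fun_eq_iff Lop_def poly3_dird_linear[OF assms, of "_ \<times> _"] cross_components axis_def)

lemma poly3_Lop [simp]: "poly3 f \<Longrightarrow> poly3 (Lop i f)"
  using exhaust_3[of i] by (auto simp: Lop_eq)

lemma axis1_nth: "(axis i (1::real) :: real^3) $ j = (if j = i then 1 else 0)"
  by (auto simp: axis_def)

text \<open>The operator \<open>\<Sum> L\<^sub>i L\<^sub>i\<close> is the Laplace--Beltrami operator. Expanded in partial derivatives it is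
\<open>|x|\<^sup>2 \<Delta> - E (E + 1)\<close> with the Euler operator \<open>E = x \<bullet> \<nabla>\<close>, and \<open>E\<close> acts as \<open>n\<close> on homogeneous functions
of degree \<open>n\<close>.\<close>

lemma sum_Lop_Lop:
  assumes f: "poly3 f" "homog n f"
  shows "Lop 1 (Lop 1 f) x + Lop 2 (Lop 2 f) x + Lop 3 (Lop 3 f) x
       = (x$1^2 + x$2^2 + x$3^2) * lap f x - n * (n + 1) * f x"
proof -
  note c = dird_commute[OF f(1), of "axis 2 1" "axis 1 1"] dird_commute[OF f(1), of "axis 3 1" "axis 1 1"]
    dird_commute[OF f(1), of "axis 3 1" "axis 2 1"]
  have e: "x$1 * pd 1 f x + x$2 * pd 2 f x + x$3 * pd 3 f x = n * f x" for x
    by (rule euler_homog[OF f])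
  have "pd i (\<lambda>x. x$1 * pd 1 f x + x$2 * pd 2 f x + x$3 * pd 3 f x) x = n * pd i f x" for i
    unfolding e using f by simp
  from this[of 1] this[of 2] this[of 3]
  have e1: "x$1 * pd 1 (pd 1 f) x + x$2 * pd 1 (pd 2 f) x + x$3 * pd 1 (pd 3 f) x + pd 1 f x = n * pd 1 f x"
    and e2: "x$1 * pd 1 (pd 2 f) x + x$2 * pd 2 (pd 2 f) x + x$3 * pd 2 (pd 3 f) x + pd 2 f x = n * pd 2 f x"
    and e3: "x$1 * pd 1 (pd 3 f) x + x$2 * pd 2 (pd 3 f) x + x$3 * pd 3 (pd 3 f) x + pd 3 f x = n * pd 3 f x"
    using f by (simp_all add: axis1_nth c algebra_simps)
  show ?thesis
    using e[of x] e1 e2 e3 f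
    apply (simp add: Lop_eq axis1_nth lap_def c)
    by algebra
qed

section \<open>Rotation invariance and integration by parts\<close>

text \<open>Rodrigues' formula for the rotation by the angle \<open>t\<close> about the unit vector \<open>a\<close>.\<close>

definition rotation_about :: "real^3 \<Rightarrow> real \<Rightarrow> real^3 \<Rightarrow> real^3" where
  "rotation_about a t s = cos t *\<^sub>R s + ((1 - cos t) * (a \<bullet> s)) *\<^sub>R a + sin t *\<^sub>R (a \<times> s)"

lemma rotation_about_orthogonal:
  assumes "norm a = 1"
  shows "orthogonal_transformation (rotation_about a t)"
  unfolding orthogonal_transformation
proof (intro conjI allI)
  show "linear (rotation_about a t)"
    by (rule linearI)
       (simp_all add: rotation_about_def cross_add_right cross_mult_right inner_add_right algebra_simps)
  fix s
  have aa: "a \<bullet> a = 1" using assms by (simp add: norm_eq_1)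
  have c: "(a \<times> s) \<bullet> (a \<times> s) = s \<bullet> s - (a \<bullet> s)\<^sup>2"
    using norm_cross_dot[of a s] assms by (simp add: power2_norm_eq_inner power_mult_distrib)
  have o: "a \<bullet> (a \<times> s) = 0" "s \<bullet> (a \<times> s) = 0" "(a \<times> s) \<bullet> a = 0" "(a \<times> s) \<bullet> s = 0"
    by (simp_all add: dot_cross_self inner_commute)
  have "rotation_about a t s \<bullet> rotation_about a t s
     = (cos t)\<^sup>2 * (s \<bullet> s) + (1 - cos t)\<^sup>2 * (a \<bullet> s)\<^sup>2 + 2 * cos t * (1 - cos t) * (a \<bullet> s)\<^sup>2
       + (sin t)\<^sup>2 * (s \<bullet> s - (a \<bullet> s)\<^sup>2)"
    unfolding rotation_about_def
    by (simp add: inner_add_left inner_add_right o c aa inner_commute[of s a] power2_eq_square) (simp add: algebra_simps)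
  also have "\<dots> = s \<bullet> s"
    unfolding sin_squared_eq by (simp add: algebra_simps power2_eq_square)
  finally show "norm (rotation_about a t s) = norm s" by (simp add: norm_eq_sqrt_inner)
qed

lemma rotation_about_derivative:
  assumes "norm a = 1"
  shows "((\<lambda>t. rotation_about a t s) has_vector_derivative a \<times> rotation_about a t s) (at t)"
proof -
  have aa: "a \<bullet> a = 1" using assms by (simp add: norm_eq_1)
  have "((\<lambda>t. rotation_about a t s) has_vector_derivative
      (- sin t) *\<^sub>R s + (sin t * (a \<bullet> s)) *\<^sub>R a + cos t *\<^sub>R (a \<times> s)) (at t)"
    unfolding rotation_about_def
    by (auto intro!: derivative_eq_intros)
  moreover have "(- sin t) *\<^sub>R s + (sin t * (a \<bullet> s)) *\<^sub>R a + cos t *\<^sub>R (a \<times> s) = a \<times> rotation_about a t s"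
    unfolding rotation_about_def
    by (simp only: cross_add_right cross_mult_right cross_refl Lagrange aa scaleR_zero_right)
       (simp add: algebra_simps)
  ultimately show ?thesis by simp
qed

lemma linear_expand_3:
  fixes F :: "real^3 \<Rightarrow> 'a::real_vector"
  assumes "linear F"
  shows "F v = v$1 *\<^sub>R F (axis 1 1) + v$2 *\<^sub>R F (axis 2 1) + v$3 *\<^sub>R F (axis 3 1)"
proof -
  have v: "v = v$1 *\<^sub>R axis 1 1 + v$2 *\<^sub>R axis 2 1 + v$3 *\<^sub>R axis 3 1"
    by (simp add: vec_eq_iff forall_3 axis_def)
  show ?thesis
    by (subst v) (simp only: linear_add[OF assms] linear_scale[OF assms])
qed

text \<open>The mean value of \<open>g\<close> over the sphere does not change when \<open>g\<close> is rotated, so its derivative with respect to the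
angle vanishes. The derivative may be taken under the integral because the derivative of \<open>g\<close> along the rotation is
bounded on the sphere.\<close>

lemma integral_rotation_derivative:
  fixes g :: "real^3 \<Rightarrow> real"
  assumes d: "\<And>x. (g has_derivative g' x) (at x)"
    and c: "\<And>v. continuous_on UNIV (\<lambda>x. g' x v)"
    and a: "norm a = 1"
  shows "(\<integral>s. g' s (a \<times> s) \<partial>dS) = 0"
proof -
  define G where "G x = g' x (a \<times> x)" for x
  have lin: "linear (g' x)" for x using d has_derivative_linear by blast
  have Gc: "continuous_on S G" for S
  proof -
    have "continuous_on UNIV (\<lambda>x. (a \<times> x)$1 *\<^sub>R g' x (axis 1 1) + (a \<times> x)$2 *\<^sub>R g' x (axis 2 1) + (a \<times> x)$3 *\<^sub>R g' x (axis 3 1))"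
      by (intro continuous_intros c continuous_on_cross)
    then show ?thesis
      unfolding G_def linear_expand_3[OF lin, of _ "a \<times> _"] by (rule continuous_on_subset) simp
  qed
  have gc: "continuous_on S g" for S
    by (rule continuous_at_imp_continuous_on) (auto intro: has_derivative_continuous d)
  have "compact (G ` S2)" by (intro compact_continuous_image Gc) auto
  then obtain B where B: "\<And>x. x \<in> S2 \<Longrightarrow> norm (G x) \<le> B"
    by (meson bounded_iff compact_imp_bounded image_eqI)
  have nR: "norm (rotation_about a t s) = norm s" for t s
    using rotation_about_orthogonal[OF a] by (rule orthogonal_transformation_norm)
  have R0: "rotation_about a 0 s = s" for s by (simp add: rotation_about_def)
  have der: "((\<lambda>t. g (rotation_about a t s)) has_real_derivative G (rotation_about a t s)) (at t)" for s t
  proof -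
    have "((\<lambda>t. g (rotation_about a t s)) has_derivative (\<lambda>h. g' (rotation_about a t s) (h *\<^sub>R (a \<times> rotation_about a t s)))) (at t)"
      by (rule has_derivative_compose[OF _ d])
         (use rotation_about_derivative[OF a] in \<open>simp add: has_vector_derivative_def\<close>)
    moreover have "(\<lambda>h. g' (rotation_about a t s) (h *\<^sub>R (a \<times> rotation_about a t s))) = (*) (G (rotation_about a t s))"
      by (simp add: fun_eq_iff G_def linear_scale[OF lin])
    ultimately show ?thesis by (simp add: has_field_derivative_def)
  qed
  \<comment> \<open>Difference quotients along the rotation by the angle \<open>1 / (n + 1)\<close>; each has integral zero.\<close>
  define q where "q n s = (g (rotation_about a (1 / Suc n) s) - g s) * Suc n" for n :: nat and s
  have cR: "continuous_on S (rotation_about a t)" for S t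
    using rotation_about_orthogonal[OF a, of t] by (simp add: linear_continuous_on linear_linear orthogonal_transformation_linear)
  have cgR: "continuous_on S2 (\<lambda>s. g (rotation_about a t s))" for t
    by (rule continuous_on_compose2[OF gc[of UNIV] cR]) simp
  have qint: "(\<integral>s. q n s \<partial>dS) = 0" for n
  proof -
    have "(\<integral>s. q n s \<partial>dS)
        = ((\<integral>s. g (rotation_about a (1 / Suc n) s) \<partial>dS) - (\<integral>s. g s \<partial>dS)) * Suc n"
      unfolding q_def
      by (simp only: integral_mult_left_zero Bochner_Integration.integral_diff[OF continuous_on_S2_integrable[OF cgR] continuous_on_S2_integrable[OF gc]])
    then show ?thesis
      by (simp add: integral_orthogonal_invariant[OF rotation_about_orthogonal[OF a] continuous_on_S2_measurable[OF gc]])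
  qed
  have "(\<lambda>n. \<integral>s. q n s \<partial>dS) \<longlonglongrightarrow> (\<integral>s. G s \<partial>dS)"
  proof (rule integral_dominated_convergence[where w="\<lambda>_. B"])
    show "G \<in> borel_measurable dS" by (rule continuous_on_S2_measurable[OF Gc])
    show "q n \<in> borel_measurable dS" for n
      unfolding q_def by (intro continuous_on_S2_measurable continuous_intros cgR gc)
    show "integrable dS (\<lambda>_. B)" by simp
    show "AE s in dS. (\<lambda>n. q n s) \<longlonglongrightarrow> G s"
    proof (rule AE_I2)
      fix s
      have "((\<lambda>h. (g (rotation_about a (0 + h) s) - g (rotation_about a 0 s)) / h) \<longlongrightarrow> G s) (at 0)"
        using der[of s 0] by (simp add: DERIV_def R0)
      moreover have "filterlim (\<lambda>n. 1 / real (Suc n)) (at 0) sequentially"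
        by (rule filterlim_atI) (use LIMSEQ_inverse_real_of_nat in \<open>auto simp: inverse_eq_divide simp del: of_nat_Suc\<close>)
      ultimately have "(\<lambda>n. (g (rotation_about a (0 + 1 / real (Suc n)) s) - g (rotation_about a 0 s)) / (1 / real (Suc n))) \<longlonglongrightarrow> G s"
        by (rule filterlim_compose)
      then show "(\<lambda>n. q n s) \<longlonglongrightarrow> G s" by (simp add: q_def R0)
    qed
    show "AE s in dS. norm (q n s) \<le> B" for n
    proof (rule AE_I2)
      fix s assume "s \<in> space dS"
      then have s: "s \<in> S2" by simp
      let ?t = "1 / real (Suc n)"
      obtain z where z: "g (rotation_about a ?t s) - g (rotation_about a 0 s) = (?t - 0) * G (rotation_about a z s)"
        using MVT2[of 0 ?t "\<lambda>t. g (rotation_about a t s)" "\<lambda>t. G (rotation_about a t s)"] der by auto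
      then have "q n s = G (rotation_about a z s)" by (simp add: q_def R0 field_simps)
      then show "norm (q n s) \<le> B" using B[of "rotation_about a z s"] s by (simp add: nR)
    qed
  qed
  then have "(\<integral>s. G s \<partial>dS) = 0" unfolding qint by (simp add: LIMSEQ_const_iff)
  then show ?thesis by (simp add: G_def)
qed

lemma integral_Lop_eq_0:
  assumes "poly3 f" shows "(\<integral>s. Lop i f s \<partial>dS) = 0"
  unfolding Lop_def
  by (rule integral_rotation_derivative[OF poly3_has_derivative[OF assms] poly3_continuous[OF poly3_dird[OF assms]]]) simp

lemma Lop_mult: "poly3 f \<Longrightarrow> poly3 g \<Longrightarrow> Lop i (\<lambda>x. f x * g x) = (\<lambda>x. f x * Lop i g x + Lop i f x * g x)"
  by (simp add: Lop_def[abs_def])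

lemma poly3_integrable: "poly3 f \<Longrightarrow> integrable dS f"
  by (rule continuous_on_S2_integrable, rule poly3_continuous)

lemma integral_Lop_by_parts:
  assumes f: "poly3 f" and g: "poly3 g"
  shows "(\<integral>s. f s * Lop i g s \<partial>dS) = - (\<integral>s. Lop i f s * g s \<partial>dS)"
proof -
  have "(\<integral>s. f s * Lop i g s + Lop i f s * g s \<partial>dS) = 0"
    using integral_Lop_eq_0[of "\<lambda>x. f x * g x" i] f g by (simp add: Lop_mult)
  then show ?thesis
    by (subst (asm) Bochner_Integration.integral_add) (simp_all add: poly3_integrable f g)
qed

definition gradient :: "(real^3 \<Rightarrow> real) \<Rightarrow> real^3 \<Rightarrow> real^3" where
  "gradient f x = (\<chi> i. pd i f x)"

text \<open>A tangent field is \<open>\<phi> = \<Sum> \<psi>\<^sub>i X\<^sub>i\<close> with the coefficients \<open>\<psi> = s \<times> \<phi>\<close> and the divergence-free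
rotation fields \<open>X\<^sub>i(s) = axis i 1 \<times> s\<close>. Hence its divergence is \<open>\<Sum> X\<^sub>i \<psi>\<^sub>i\<close>, a sum of derivatives along rotations,
and the divergence theorem reduces to \<open>integral_rotation_derivative\<close>.\<close>

lemma trace_cov_deriv:
  assumes d: "(\<phi> has_derivative F) (at s)" and s: "s \<in> S2" and t: "\<phi> s \<bullet> s = 0"
  shows "trace (cov_deriv \<phi> s) = (\<Sum>i\<in>UNIV. ((axis i 1 \<times> s) \<times> \<phi> s + s \<times> F (axis i 1 \<times> s)) $ i)"
proof -
  have F: "frechet_derivative \<phi> (at s) = F" using d by (metis frechet_derivative_at)
  have lin: "linear F" using d has_derivative_linear by blast
  have s1: "s$1 * s$1 + s$2 * s$2 + s$3 * s$3 = 1"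
    using s by (simp add: norm_eq_1 inner_vec_def sum_3)
  have t': "\<phi> s$1 * s$1 + \<phi> s$2 * s$2 + \<phi> s$3 * s$3 = 0"
    using t by (simp add: inner_vec_def sum_3)
  define f1 f2 f3 where "f1 = F (axis 1 1)" and "f2 = F (axis 2 1)" and "f3 = F (axis 3 1)"
  have Fv: "F v = v$1 *\<^sub>R f1 + v$2 *\<^sub>R f2 + v$3 *\<^sub>R f3" for v
    unfolding f1_def f2_def f3_def by (rule linear_expand_3[OF lin])
  \<comment> \<open>Both sides are polynomials in the entries of \<open>F\<close>, \<open>s\<close> and \<open>\<phi> s\<close>; in terms of the trace \<open>T\<close> and \<open>N = s \<bullet> F s\<close> they agree once \<open>|s| = 1\<close> and \<open>\<phi> s \<bullet> s = 0\<close> are used.\<close>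
  define T N q p where "T = f1$1 + f2$2 + f3$3"
    and "N = s$1 * (s$1 * f1$1 + s$2 * f2$1 + s$3 * f3$1) + s$2 * (s$1 * f1$2 + s$2 * f2$2 + s$3 * f3$2)
      + s$3 * (s$1 * f1$3 + s$2 * f2$3 + s$3 * f3$3)"
    and "q = s$1 * s$1 + s$2 * s$2 + s$3 * s$3"
    and "p = \<phi> s$1 * s$1 + \<phi> s$2 * s$2 + \<phi> s$3 * s$3"
  have "trace (cov_deriv \<phi> s) = T - 2 * N + q * N"
    by (simp add: trace_def cov_deriv_def F matrix_def tangent_proj_def Fv sum_3 axis1_nth inner_vec_def T_def N_def q_def)
       (simp add: algebra_simps)
  moreover have "(\<Sum>i\<in>UNIV. ((axis i 1 \<times> s) \<times> \<phi> s + s \<times> F (axis i 1 \<times> s)) $ i) = - 2 * p + q * T - N"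
    by (simp add: Fv sum_3 cross_components axis1_nth T_def N_def q_def p_def)
       (simp add: algebra_simps)
  moreover have "q = 1" "p = 0" using s1 t' by (simp_all add: q_def p_def)
  ultimately show ?thesis by simp
qed

section \<open>Spherical harmonics\<close>

text \<open>Solid harmonics: spherical harmonics of degree \<open>n\<close> are their restrictions to the sphere. Working with the
extensions makes the partial derivatives available as operators.\<close>

definition harm :: "nat \<Rightarrow> (real^3 \<Rightarrow> real) \<Rightarrow> bool" where
  "harm n f \<longleftrightarrow> poly3 f \<and> homog n f \<and> (\<forall>x. lap f x = 0)"

lemma harm_poly3: "harm n f \<Longrightarrow> poly3 f"
  by (simp add: harm_def)

lemma harm_0: "harm n (\<lambda>x. 0)"
  by (simp add: harm_def homog_def lap_def)

lemma lap_add: "poly3 f \<Longrightarrow> poly3 g \<Longrightarrow> lap (\<lambda>x. f x + g x) x = lap f x + lap g x"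
  by (simp add: lap_def)

lemma lap_cmult: "poly3 f \<Longrightarrow> lap (\<lambda>x. c * f x) x = c * lap f x"
  by (simp add: lap_def distrib_left)

lemma harm_add: "harm n f \<Longrightarrow> harm n g \<Longrightarrow> harm n (\<lambda>x. f x + g x)"
  by (simp add: harm_def homog_def lap_add distrib_left)

lemma harm_scale: "harm n f \<Longrightarrow> harm n (\<lambda>x. c * f x)"
  by (simp add: harm_def homog_def lap_cmult)

lemma harm_sum: "(\<And>i. i \<in> I \<Longrightarrow> harm n (f i)) \<Longrightarrow> harm n (\<lambda>x. \<Sum>i\<in>I. f i x)"
proof (induction I rule: infinite_finite_induct)
  case (insert i I)
  have "harm n (\<lambda>x. f i x + (\<Sum>i\<in>I. f i x))"
    by (rule harm_add) (use insert in auto)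
  then show ?case using insert by simp
qed (simp_all add: harm_0)

lemma harm_diff: "harm n f \<Longrightarrow> harm n g \<Longrightarrow> harm n (\<lambda>x. f x - g x)"
  using harm_add[of n f "\<lambda>x. (-1) * g x"] harm_scale[of n g "-1"] by simp

lemma homog_0_const: "homog 0 f \<Longrightarrow> f = (\<lambda>x. f 0)"
proof
  fix x assume "homog 0 f"
  then have "f (0 *\<^sub>R x) = 0 ^ 0 * f x" unfolding homog_def by blast
  then show "f x = f 0" by simp
qed

lemma harm_dird:
  assumes "harm (Suc n) f" shows "harm n (dird v f)"
proof -
  have f: "poly3 f" using assms by (simp add: harm_def)
  have "pd i (pd i (dird v f)) = dird v (pd i (pd i f))" for i
    using f by (simp add: dird_commute[of _ "axis i 1" v])
  then have "lap (dird v f) x = dird v (\<lambda>x. pd 1 (pd 1 f) x + pd 2 (pd 2 f) x + pd 3 (pd 3 f) x) x" for x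
    using f by (simp add: lap_def)
  moreover have "(\<lambda>x. pd 1 (pd 1 f) x + pd 2 (pd 2 f) x + pd 3 (pd 3 f) x) = (\<lambda>x. 0)"
    using assms by (simp add: harm_def lap_def[abs_def])
  ultimately have "lap (dird v f) x = 0" for x by simp
  then show ?thesis using assms homog_dird[of f n v] by (simp add: harm_def)
qed

lemma homog_coord_mult: "homog n f \<Longrightarrow> homog (Suc n) (\<lambda>x. x$i * f x)"
  by (simp add: homog_def)

lemma homog_diff: "homog n f \<Longrightarrow> homog n g \<Longrightarrow> homog n (\<lambda>x. f x - g x)"
  by (simp add: homog_def algebra_simps)

lemma homog_0: "homog n (\<lambda>x. 0)"
  by (simp add: homog_def)

lemma homog_0_dird: "homog 0 f \<Longrightarrow> dird v f = (\<lambda>x. 0)"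
  by (subst homog_0_const) auto

lemma homog_coord_mult_pd:
  assumes "poly3 f" "homog n f" shows "homog n (\<lambda>x. x$i * dird v f x)"
proof (cases n)
  case 0 then show ?thesis using assms by (simp add: homog_0_dird homog_0)
next
  case (Suc m)
  then show ?thesis using assms homog_coord_mult[OF homog_dird[of f m v]] by simp
qed

lemma lap_coord_mult:
  assumes "poly3 g"
  shows "lap (\<lambda>x. x$i * g x) x = 2 * pd i g x + x$i * lap g x"
  using exhaust_3[of i] assms by (elim disjE) (simp_all add: lap_def axis1_nth algebra_simps)

lemma lap_diff: "poly3 f \<Longrightarrow> poly3 g \<Longrightarrow> lap (\<lambda>x. f x - g x) x = lap f x - lap g x"
  by (simp add: lap_def)

text \<open>The commutator of the Laplacian with \<open>x\<^sub>i \<partial>\<^sub>j - x\<^sub>j \<partial>\<^sub>i\<close> is \<open>2 \<partial>\<^sub>i \<partial>\<^sub>j - 2 \<partial>\<^sub>j \<partial>\<^sub>i = 0\<close>.\<close>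

lemma harm_Lop:
  assumes "harm n f" shows "harm n (Lop i f)"
proof -
  have f: "poly3 f" "homog n f" and l: "lap f x = 0" for x using assms by (simp_all add: harm_def)
  have "homog n (Lop i f)"
    using exhaust_3[of i] by (auto simp: Lop_eq[OF f(1)] intro!: homog_diff homog_coord_mult_pd f)
  moreover have "lap (dird v f) x = 0" for v x
  proof (cases n)
    case 0 then show ?thesis using f by (simp add: homog_0_dird lap_def)
  next
    case (Suc m) then show ?thesis using harm_dird[of m f v] assms by (simp add: harm_def)
  qed
  note l3 = this[of "axis 1 1"] this[of "axis 2 1"] this[of "axis 3 1"]
  note c = dird_commute[OF f(1), of "axis 2 1" "axis 1 1"] dird_commute[OF f(1), of "axis 3 1" "axis 1 1"]
    dird_commute[OF f(1), of "axis 3 1" "axis 2 1"]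
  have "lap (Lop i f) x = 0" for x
    using exhaust_3[of i] l3[of x] f
    by (elim disjE) (simp_all add: Lop_eq lap_diff lap_coord_mult c)
  ultimately show ?thesis using f by (simp add: harm_def)
qed

abbreviation rsq :: "real^3 \<Rightarrow> real" where
  "rsq x \<equiv> x$1 * x$1 + x$2 * x$2 + x$3 * x$3"

lemma rsq_S2: "x \<in> S2 \<Longrightarrow> rsq x = 1"
  by (simp add: norm_eq_1 inner_vec_def sum_3)

lemma lap_rsq_mult:
  assumes "poly3 g"
  shows "lap (\<lambda>x. rsq x * g x) x = 6 * g x + 4 * (x$1 * pd 1 g x + x$2 * pd 2 g x + x$3 * pd 3 g x) + rsq x * lap g x"
  using assms by (simp add: lap_def axis1_nth) (simp add: algebra_simps)

text \<open>The harmonic part of \<open>x\<^sub>i h\<close>: on the sphere, the product with a coordinate is a sum of a harmonic of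
degree \<open>n + 1\<close> and one of degree \<open>n - 1\<close>. For \<open>n = 0\<close> the derivative is zero and \<open>x\<^sub>i h\<close> is harmonic itself.\<close>

lemma harm_coord:
  assumes "harm n h"
  shows "harm (Suc n) (\<lambda>x. x$i * h x - rsq x * (pd i h x / (2 * n + 1)))"
proof (cases n)
  case 0
  then have "pd i h = (\<lambda>x. 0)" using assms by (simp add: harm_def homog_0_dird)
  then have "harm (Suc n) (\<lambda>x. x$i * h x)"
    using assms lap_coord_mult[of h i] by (simp add: harm_def homog_coord_mult)
  then show ?thesis using \<open>pd i h = (\<lambda>x. 0)\<close> by simp
next
  case (Suc m)
  have h: "poly3 h" "homog n h" "lap h x = 0" for x using assms by (simp_all add: harm_def)
  have p: "harm m (pd i h)" using assms Suc by (intro harm_dird) simp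
  define g where "g x = pd i h x / (2 * n + 1)" for x
  have g: "harm m g" using harm_scale[OF p, of "1 / (2 * n + 1)"] by (simp add: g_def[abs_def])
  have gp: "poly3 g" "homog m g" "lap g x = 0" for x using g by (simp_all add: harm_def)
  have "homog (Suc n) (\<lambda>x. x$i * h x - rsq x * g x)"
    using h(2) gp(2) Suc by (simp add: homog_def power2_eq_square algebra_simps)
  moreover have "lap (\<lambda>x. x$i * h x - rsq x * g x) x = 0" for x
  proof -
    have "lap (\<lambda>x. x$i * h x - rsq x * g x) x = 2 * pd i h x - (6 * g x + 4 * (real m * g x))"
      using h gp by (subst lap_diff) (simp_all add: lap_rsq_mult lap_coord_mult euler_homog)
    also have "\<dots> = 2 * pd i h x - (2 * (2 * n + 1)) * g x" using Suc by (simp add: algebra_simps)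
    also have "\<dots> = 0"
    proof -
      have "0 < 1 + 2 * real n" by simp
      then show ?thesis by (simp add: g_def field_simps)
    qed
    finally show ?thesis .
  qed
  ultimately have "harm (Suc n) (\<lambda>x. x$i * h x - rsq x * g x)" using h gp by (simp add: harm_def)
  then show ?thesis by (simp add: g_def)
qed

lemma poly3_funpow [simp]: "poly3 f \<Longrightarrow> poly3 ((dird v ^^ k) f)"
  by (induction k) auto

lemma funpow_dird_commute: "poly3 f \<Longrightarrow> (dird v ^^ k) (dird w f) = dird w ((dird v ^^ k) f)"
  by (induction k) (auto simp: dird_commute)

lemma funpow_dird_0: "(dird v ^^ k) (\<lambda>x. 0) = (\<lambda>x. 0)"
  by (induction k) auto

lemma funpow_dird_sum:
  assumes "\<And>a. a \<in> I \<Longrightarrow> poly3 (f a)"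
  shows "(dird v ^^ k) (\<lambda>x. \<Sum>a\<in>I. c a * f a x) = (\<lambda>x. \<Sum>a\<in>I. c a * (dird v ^^ k) (f a) x)"
  by (induction k) (use assms in auto)

text \<open>A harmonic polynomial is determined by its derivatives of top order (which are constants) that involve the third
variable at most once, because the Laplace equation trades two derivatives in the third variable for derivatives in the
others. There are \<open>(n + 1) + n\<close> of them, so the space of harmonics of degree \<open>n\<close> has dimension at most
\<open>2 n + 1\<close>.\<close>

lemma harm_eq_0_if_jet_0:
  assumes "harm n h"
    and "\<And>i j. i + j = n \<Longrightarrow> (pd 1 ^^ i) ((pd 2 ^^ j) h) 0 = 0"
    and "\<And>i j. Suc (i + j) = n \<Longrightarrow> (pd 1 ^^ i) ((pd 2 ^^ j) (pd 3 h)) 0 = 0"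
  shows "h = (\<lambda>x. 0)"
  using assms
proof (induction n arbitrary: h)
  case 0
  then show ?case using homog_0_const[of h] by (auto simp: harm_def)
next
  case (Suc n)
  have p: "poly3 h" and l: "lap h x = 0" for x using Suc.prems by (simp_all add: harm_def)
  have z1: "pd 1 h = (\<lambda>x. 0)"
  proof (rule Suc.IH)
    show "harm n (pd 1 h)" using Suc.prems by (intro harm_dird)
    show "(pd 1 ^^ i) ((pd 2 ^^ j) (pd 1 h)) 0 = 0" if "i + j = n" for i j
      using Suc.prems(2)[of "Suc i" j] that p by (simp add: funpow_dird_commute)
    show "(pd 1 ^^ i) ((pd 2 ^^ j) (pd 3 (pd 1 h))) 0 = 0" if "Suc (i + j) = n" for i j
      using Suc.prems(3)[of "Suc i" j] that p
      by (simp add: funpow_dird_commute dird_commute[of h "axis 3 1" "axis 1 1"])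
  qed
  have z2: "pd 2 h = (\<lambda>x. 0)"
  proof (rule Suc.IH)
    show "harm n (pd 2 h)" using Suc.prems by (intro harm_dird)
    show "(pd 1 ^^ i) ((pd 2 ^^ j) (pd 2 h)) 0 = 0" if "i + j = n" for i j
      using Suc.prems(2)[of i "Suc j"] that p by (simp add: funpow_dird_commute)
    show "(pd 1 ^^ i) ((pd 2 ^^ j) (pd 3 (pd 2 h))) 0 = 0" if "Suc (i + j) = n" for i j
      using Suc.prems(3)[of i "Suc j"] that p
      by (simp add: funpow_dird_commute[where v="axis 2 1" and w="axis 2 1"] dird_commute[of h "axis 3 1" "axis 2 1"])
  qed
  have z33: "pd 3 (pd 3 h) = (\<lambda>x. 0)" using l z1 z2 by (simp add: lap_def fun_eq_iff)
  have z3: "pd 3 h = (\<lambda>x. 0)"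
  proof (rule Suc.IH)
    show "harm n (pd 3 h)" using Suc.prems by (intro harm_dird)
    show "(pd 1 ^^ i) ((pd 2 ^^ j) (pd 3 h)) 0 = 0" if "i + j = n" for i j
      using Suc.prems(3)[of i j] that by simp
    show "(pd 1 ^^ i) ((pd 2 ^^ j) (pd 3 (pd 3 h))) 0 = 0" for i j
      by (simp add: z33 funpow_dird_0)
  qed
  have "real (Suc n) * h x = 0" for x
    using euler_homog[of h "Suc n" x] Suc.prems(1) by (simp add: harm_def z1 z2 z3)
  then show ?case by auto
qed

text \<open>By elimination of one unknown per equation.\<close>

lemma homogeneous_system_nontrivial:
  fixes l :: "'p \<Rightarrow> 'a \<Rightarrow> real"
  assumes "finite P" "finite A" "card P < card A"
  shows "\<exists>c. (\<exists>a\<in>A. c a \<noteq> 0) \<and> (\<forall>p\<in>P. (\<Sum>a\<in>A. c a * l p a) = 0)"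
  using assms
proof (induction P arbitrary: A l rule: finite_induct)
  case empty
  then obtain a where "a \<in> A" by fastforce
  then show ?case by (intro exI[of _ "\<lambda>_. 1"]) auto
next
  case (insert p P)
  show ?case
  proof (cases "\<forall>a\<in>A. l p a = 0")
    case True
    then show ?thesis using insert.IH[OF insert.prems(1), of l] insert.prems insert.hyps by auto
  next
    case False
    then obtain b where b: "b \<in> A" "l p b \<noteq> 0" by blast
    \<comment> \<open>Eliminate the unknown \<open>b\<close> with the help of equation \<open>p\<close>.\<close>
    define l' where "l' q a = l q a - l p a / l p b * l q b" for q a
    have "card P < card (A - {b})" using insert b by simp
    then obtain c where c: "\<exists>a\<in>A - {b}. c a \<noteq> 0" "\<forall>q\<in>P. (\<Sum>a\<in>A - {b}. c a * l' q a) = 0"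
      using insert.IH[of "A - {b}" l'] insert.prems(1) by auto
    define s where "s = (\<Sum>a\<in>A - {b}. c a * l p a)"
    define c' where "c' a = (if a = b then - s / l p b else c a)" for a
    have split: "(\<Sum>a\<in>A. c' a * l q a) = - s / l p b * l q b + (\<Sum>a\<in>A - {b}. c a * l q a)" for q
      using insert.prems(1) b(1) by (subst sum.remove[of _ b]) (auto simp: c'_def intro!: sum.cong)
    have "(\<Sum>a\<in>A. c' a * l q a) = 0" if "q \<in> insert p P" for q
    proof (cases "q = p")
      case True
      then show ?thesis unfolding split using b by (simp add: s_def)
    next
      case False
      then have "(\<Sum>a\<in>A - {b}. c a * l' q a) = 0" using c(2) that by auto
      moreover have "(\<Sum>a\<in>A - {b}. c a * l' q a) = (\<Sum>a\<in>A - {b}. c a * l q a) - s / l p b * l q b"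
      proof -
        have "(\<Sum>a\<in>A - {b}. c a * l' q a) = (\<Sum>a\<in>A - {b}. c a * l q a - c a * l p a * (l q b / l p b))"
          by (rule sum.cong) (simp_all add: l'_def right_diff_distrib)
        also have "\<dots> = (\<Sum>a\<in>A - {b}. c a * l q a) - (\<Sum>a\<in>A - {b}. c a * l p a) * (l q b / l p b)"
          by (simp only: sum_subtractf sum_distrib_right)
        finally show ?thesis by (simp add: s_def)
      qed
      ultimately show ?thesis unfolding split by simp
    qed
    moreover have "\<exists>a\<in>A. c' a \<noteq> 0" using c(1) by (auto simp: c'_def)
    ultimately show ?thesis by blast
  qed
qed

lemma poly3_square_integrable:
  assumes "poly3 f" shows "square_integrable f"
  unfolding square_integrable_def
  using poly3_integrable[of "\<lambda>x. f x * f x"] assms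
  by (auto simp: power2_eq_square intro!: continuous_on_S2_measurable poly3_continuous)

lemma harm_orthonormal_card:
  assumes I: "finite I" "orthonormal_on I Y" "\<And>i. i \<in> I \<Longrightarrow> harm n (Y i)"
  shows "card I \<le> 2 * n + 1"
proof (rule ccontr)
  assume "\<not> card I \<le> 2 * n + 1"
  define P :: "(nat + nat) set" where "P = {..n} <+> {..<n}"
  \<comment> \<open>The two summands of the index type are the derivatives without and with a derivative in the third variable.\<close>
  define l where "l p i = (case p of Inl j \<Rightarrow> (pd 1 ^^ (n - j)) ((pd 2 ^^ j) (Y i)) 0
     | Inr j \<Rightarrow> (pd 1 ^^ (n - 1 - j)) ((pd 2 ^^ j) (pd 3 (Y i))) 0)" for p i
  have P: "finite P" "card P = 2 * n + 1" by (simp_all add: P_def card_Plus)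
  obtain c where c: "\<exists>i\<in>I. c i \<noteq> 0" "\<forall>p\<in>P. (\<Sum>i\<in>I. c i * l p i) = 0"
    using homogeneous_system_nontrivial[OF P(1) I(1), of l] P(2) \<open>\<not> card I \<le> 2 * n + 1\<close> by auto
  define h where "h x = (\<Sum>i\<in>I. c i * Y i x)" for x
  have Yp: "poly3 (Y i)" if "i \<in> I" for i using I(3)[OF that] by (rule harm_poly3)
  have "h = (\<lambda>x. 0)"
  proof (rule harm_eq_0_if_jet_0)
    show "harm n h" unfolding h_def by (intro harm_sum harm_scale I(3))
    show "(pd 1 ^^ i) ((pd 2 ^^ j) h) 0 = 0" if "i + j = n" for i j
    proof -
      have "Inl j \<in> P" "n - j = i" using that by (auto simp: P_def)
      then show ?thesis using c(2) Yp by (force simp: l_def h_def[abs_def] funpow_dird_sum)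
    qed
    show "(pd 1 ^^ i) ((pd 2 ^^ j) (pd 3 h)) 0 = 0" if "Suc (i + j) = n" for i j
    proof -
      have "Inr j \<in> P" "n - 1 - j = i" using that by (auto simp: P_def)
      moreover have "pd 3 h = (\<lambda>x. \<Sum>a\<in>I. c a * pd 3 (Y a) x)"
        using Yp funpow_dird_sum[where v="axis 3 1" and k=1 and I=I and f=Y and c=c] by (simp add: h_def[abs_def])
      ultimately show ?thesis using c(2) Yp by (force simp: l_def funpow_dird_sum)
    qed
  qed
  then have "(\<Sum>i\<in>I. (c i)\<^sup>2) = 0"
    using L2_inner_orthonormal_sum[OF I(1,2), of c] by (simp add: h_def[symmetric] L2_inner_S2_def)
  then show False using c(1) I(1) by (simp add: sum_nonneg_eq_0_iff)
qed


text \<open>Continuity gives \<open>h = 0\<close> on the sphere, homogeneity everywhere.\<close>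

lemma harm_L2_eq_0:
  assumes h: "harm n h" and z: "L2_inner_S2 h h = 0"
  shows "h = (\<lambda>x. 0)"
proof
  fix x
  have p: "poly3 h" "homog n h" using h by (simp_all add: harm_def)
  have S: "h s * h s = 0" if "s \<in> S2" for s
    by (rule continuous_nonneg_integral_eq_0[where f="\<lambda>s. h s * h s"])
       (use z that in \<open>auto simp: L2_inner_S2_def intro!: poly3_continuous continuous_intros p\<close>)
  show "h x = 0"
  proof (cases "x = 0")
    case True
    have "h (0 *\<^sub>R axis 1 1) = 0 ^ n * h (axis 1 1)" using p(2) unfolding homog_def by blast
    moreover have "h (axis 1 1) = 0" using S[of "axis 1 1"] by simp
    ultimately show ?thesis using True by simp
  next
    case False
    have "h (norm x *\<^sub>R (x /\<^sub>R norm x)) = norm x ^ n * h (x /\<^sub>R norm x)" using p(2) unfolding homog_def by blast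
    moreover have "h (x /\<^sub>R norm x) = 0" using S[of "x /\<^sub>R norm x"] False by simp
    ultimately show ?thesis using False by simp
  qed
qed

definition harm_basis :: "nat \<Rightarrow> nat \<Rightarrow> (nat \<Rightarrow> real^3 \<Rightarrow> real) \<Rightarrow> bool" where
  "harm_basis n d Y \<longleftrightarrow> d \<le> 2 * n + 1 \<and> (\<forall>i<d. harm n (Y i)) \<and> orthonormal_on {..<d} Y \<and>
     (\<forall>h. harm n h \<longrightarrow> h = (\<lambda>x. \<Sum>i<d. L2_inner_S2 h (Y i) * Y i x))"

text \<open>An orthonormal family of harmonics of degree \<open>n\<close> has at most \<open>2 n + 1\<close> members, so there is a maximal
one. It spans: otherwise the normalised remainder of the expansion of some \<open>h\<close> could be added to it.\<close>

lemma harm_basis_exists: "\<exists>d Y. harm_basis n d Y"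
proof -
  define Q where "Q d \<longleftrightarrow> (\<exists>Y. (\<forall>i<d. harm n (Y i)) \<and> orthonormal_on {..<d::nat} Y)" for d
  have bound: "d \<le> 2 * n + 1" if Qd: "Q d" for d
  proof -
    obtain Y where "\<forall>i<d. harm n (Y i)" "orthonormal_on {..<d} Y" using Qd by (auto simp: Q_def)
    then show ?thesis using harm_orthonormal_card[of "{..<d}" Y n] by simp
  qed
  have "Q 0" by (simp add: Q_def orthonormal_on_def)
  then obtain d where d: "Q d" and dmax: "\<And>d'. Q d' \<Longrightarrow> d' \<le> d"
    using ex_has_greatest_nat[of Q 0 "\<lambda>d. d" "Suc (2 * n + 1)"] bound le_imp_less_Suc by blast
  obtain Y where Y: "\<forall>i<d. harm n (Y i)" and ON: "orthonormal_on {..<d} Y" using d by (auto simp: Q_def)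
  have "h = (\<lambda>x. \<Sum>i<d. L2_inner_S2 h (Y i) * Y i x)" if h: "harm n h" for h
  proof -
    define g where "g x = h x - (\<Sum>i<d. L2_inner_S2 h (Y i) * Y i x)" for x
    have g: "harm n g" unfolding g_def using Y by (intro harm_diff harm_sum harm_scale h) auto
    have sq: "square_integrable f" if "harm n f" for f using that by (intro poly3_square_integrable harm_poly3)
    have gY: "L2_inner_S2 g (Y i) = 0" if "i < d" for i
    proof -
      have "L2_inner_S2 g (Y i) = L2_inner_S2 h (Y i) - L2_inner_S2 (\<lambda>x. \<Sum>k<d. L2_inner_S2 h (Y k) *\<^sub>R Y k x) (Y i)"
      proof -
        have "integrable dS (\<lambda>s. h s * Y i s)" "integrable dS (\<lambda>s. (\<Sum>k<d. L2_inner_S2 h (Y k) * Y k s) * Y i s)"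
          using Y that h by (auto intro!: poly3_integrable poly3_simps(3) poly3_sum poly3_simps(1) intro: harm_poly3)
        then show ?thesis unfolding L2_inner_S2_def g_def by (simp add: left_diff_distrib)
      qed
      also have "L2_inner_S2 (\<lambda>x. \<Sum>k<d. L2_inner_S2 h (Y k) *\<^sub>R Y k x) (Y i) = (\<Sum>k<d. L2_inner_S2 h (Y k) * L2_inner_S2 (Y k) (Y i))"
        using Y that by (intro L2_inner_sum_left sq) auto
      also have "\<dots> = (\<Sum>k<d. L2_inner_S2 h (Y k) * (if k = i then 1 else 0))"
        using ON that by (intro sum.cong refl) (simp add: orthonormal_on_def)
      also have "\<dots> = L2_inner_S2 h (Y i)" using that by (simp add: if_distrib cong: if_cong)
      finally show ?thesis by simp
    qed
    have "L2_inner_S2 g g = 0"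
    proof (rule ccontr)
      assume "L2_inner_S2 g g \<noteq> 0"
      then have pos: "L2_inner_S2 g g > 0" using L2_inner_nonneg[of g] by simp
      define b where "b = 1 / sqrt (L2_inner_S2 g g)"
      have bb: "b * b * L2_inner_S2 g g = 1"
        using pos by (simp add: b_def)
      define Y' where "Y' = Y(d := (\<lambda>x. b * g x))"
      have sc: "L2_inner_S2 (\<lambda>x. b * g x) (\<lambda>x. b * g x) = 1"
        using L2_inner_scale[of b g b g] bb by simp
      have or: "L2_inner_S2 (\<lambda>x. b * g x) (Y i) = 0" "L2_inner_S2 (Y i) (\<lambda>x. b * g x) = 0" if "i < d" for i
        using L2_inner_scale[of b g 1 "Y i"] gY[OF that] by (simp_all add: L2_inner_commute)
      have "harm n (Y' i)" if "i < Suc d" for i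
        using Y that g by (auto simp: Y'_def less_Suc_eq intro: harm_scale)
      moreover have "orthonormal_on {..<Suc d} Y'"
        unfolding orthonormal_on_def
      proof (intro conjI ballI)
        show "square_integrable (Y' k)" if "k \<in> {..<Suc d}" for k using calculation that by (intro sq) auto
        show "L2_inner_S2 (Y' k) (Y' l) = (if k = l then 1 else 0)" if "k \<in> {..<Suc d}" "l \<in> {..<Suc d}" for k l
          using that ON sc or by (auto simp: Y'_def less_Suc_eq orthonormal_on_def)
      qed
      ultimately have "Q (Suc d)" by (auto simp: Q_def)
      then show False using dmax[of "Suc d"] by simp
    qed
    from harm_L2_eq_0[OF g this] have "g x = 0" for x by (rule fun_cong)
    then show ?thesis by (auto simp: g_def)
  qed
  then show ?thesis using bound[OF d] Y ON unfolding harm_basis_def by blast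
qed

definition hdim :: "nat \<Rightarrow> nat" where
  "hdim n = (SOME d. \<exists>Y. harm_basis n d Y)"

definition sphharm :: "nat \<Rightarrow> nat \<Rightarrow> real^3 \<Rightarrow> real" where
  "sphharm n = (SOME Y. harm_basis n (hdim n) Y)"

lemma sphharm:
  shows hdim_le: "hdim n \<le> 2 * n + 1"
    and harm_sphharm: "i < hdim n \<Longrightarrow> harm n (sphharm n i)"
    and orthonormal_sphharm: "orthonormal_on {..<hdim n} (sphharm n)"
    and sphharm_expansion: "harm n h \<Longrightarrow> h = (\<lambda>x. \<Sum>i<hdim n. L2_inner_S2 h (sphharm n i) * sphharm n i x)"
proof -
  have "\<exists>Y. harm_basis n (hdim n) Y"
    unfolding hdim_def by (rule someI_ex[OF harm_basis_exists])
  then have "harm_basis n (hdim n) (sphharm n)"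
    unfolding sphharm_def by (rule someI_ex)
  then show "hdim n \<le> 2 * n + 1" "i < hdim n \<Longrightarrow> harm n (sphharm n i)" "orthonormal_on {..<hdim n} (sphharm n)"
    "harm n h \<Longrightarrow> h = (\<lambda>x. \<Sum>i<hdim n. L2_inner_S2 h (sphharm n i) * sphharm n i x)"
    unfolding harm_basis_def by blast+
qed

lemma sum_Lop_Lop_harm:
  "harm n f \<Longrightarrow> Lop 1 (Lop 1 f) x + Lop 2 (Lop 2 f) x + Lop 3 (Lop 3 f) x = - (real n * (real n + 1)) * f x"
  using sum_Lop_Lop[of f n x] by (simp add: harm_def)

lemma dird_cross:
  assumes "poly3 K"
  shows "dird (a \<times> x) K x = a$1 * Lop 1 K x + a$2 * Lop 2 K x + a$3 * Lop 3 K x"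
  unfolding poly3_dird_linear[OF assms, of "a \<times> x"] Lop_eq[OF assms]
  by (simp add: cross_components algebra_simps)

lemma constant_along_rotation:
  assumes K: "poly3 K" "\<And>i x. Lop i K x = 0" and a: "norm a = 1"
  shows "K (rotation_about a t s) = K s"
proof -
  have "((\<lambda>t. K (rotation_about a t s)) has_real_derivative 0) (at t)" for t
  proof -
    have "((\<lambda>t. K (rotation_about a t s)) has_derivative (\<lambda>h. dird (h *\<^sub>R (a \<times> rotation_about a t s)) K (rotation_about a t s))) (at t)"
      by (rule has_derivative_compose[OF _ poly3_has_derivative[OF K(1)]])
         (use rotation_about_derivative[OF a] in \<open>simp add: has_vector_derivative_def\<close>)
    moreover have "dird (h *\<^sub>R (a \<times> rotation_about a t s)) K (rotation_about a t s) = 0" for h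
      using dird_cross[OF K(1), of "h *\<^sub>R a" "rotation_about a t s"] K(2) by (simp add: cross_mult_left)
    ultimately show ?thesis by (simp add: has_field_derivative_def lambda_zero)
  qed
  then have "K (rotation_about a t s) = K (rotation_about a 0 s)" by (intro DERIV_isconst_all) blast
  then show ?thesis by (simp add: rotation_about_def)
qed

text \<open>Two points that are not antipodal are exchanged by the half-turn about their bisector; antipodal points
are compared with a third one.\<close>

lemma constant_if_Lop_0:
  assumes K: "poly3 K" "\<And>i x. Lop i K x = 0" and xy: "x \<in> S2" "y \<in> S2"
  shows "K x = K y"
proof -
  have *: "K x = K y" if xy: "x \<in> S2" "y \<in> S2" "x + y \<noteq> 0" for x y
  proof -
    define a where "a = (x + y) /\<^sub>R norm (x + y)"
    have a: "norm a = 1" using that by (simp add: a_def)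
    have q: "(norm (x + y))\<^sup>2 = 2 * ((x + y) \<bullet> x)"
      using xy by (simp add: power2_norm_eq_inner inner_add_left inner_add_right norm_eq_1 inner_commute)
    have "(2 * (a \<bullet> x)) *\<^sub>R a = (2 * ((x + y) \<bullet> x) / (norm (x + y))\<^sup>2) *\<^sub>R (x + y)"
      unfolding a_def by (simp add: power2_eq_square divide_inverse mult_ac)
    also have "\<dots> = x + y" unfolding q[symmetric] using that by simp
    finally have "rotation_about a pi x = y" by (simp add: rotation_about_def)
    then show ?thesis using constant_along_rotation[OF K a, of pi x] by simp
  qed
  show ?thesis
  proof (cases "x + y = 0")
    case False then show ?thesis using * xy by blast
  next
    case True
    \<comment> \<open>A point different from both \<open>x\<close> and \<open>- x\<close>.\<close>
  define p where "p = (if x = axis 1 1 \<or> x = - axis 1 1 then axis 2 1 else axis 1 (1::real) :: real^3)"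
    have p: "p \<in> S2" by (simp add: p_def)
    have ne: "axis 1 1 + axis 2 1 \<noteq> (0 :: real^3)" "- axis 1 1 + axis 2 1 \<noteq> (0 :: real^3)"
      by (auto simp: vec_eq_iff axis_def intro!: exI[of _ 1])
    have y: "y = - x" using True by (simp add: add_eq_0_iff)
    have "x + p \<noteq> 0" "p + y \<noteq> 0"
      using ne unfolding y p_def by (auto simp: add_eq_0_iff split: if_splits)
    then show ?thesis using *[OF xy(1) p] *[OF p xy(2)] by simp
  qed
qed

lemma Lop_sum:
  "(\<And>i. i \<in> I \<Longrightarrow> poly3 (f i)) \<Longrightarrow> Lop l (\<lambda>x. \<Sum>i\<in>I. f i x) x = (\<Sum>i\<in>I. Lop l (f i) x)"
  by (simp add: Lop_def)

lemma Lop_cmult: "poly3 f \<Longrightarrow> Lop l (\<lambda>x. c * f x) = (\<lambda>x. c * Lop l f x)"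
  by (simp add: Lop_def[abs_def])

text \<open>The addition theorem for harmonics and for their gradients. By integration by parts the matrix of \<open>L\<^sub>l\<close> in the
orthonormal basis is antisymmetric, so \<open>L\<^sub>l\<close> annihilates \<open>K = \<Sum> Y\<^sub>i\<^sup>2\<close>, and \<open>K\<close> is constant on the sphere; its
integral is the number of basis elements. Applying \<open>L\<^sub>l\<close> twice to \<open>K\<close> expresses \<open>\<Sum> (L\<^sub>l Y\<^sub>i)\<^sup>2\<close> by
\<open>\<Sum> Y\<^sub>i L\<^sub>l L\<^sub>l Y\<^sub>i\<close>.\<close>

lemma sum_sphharm_squares:
  assumes s: "s \<in> S2"
  shows "(\<Sum>i<hdim n. (sphharm n i s)\<^sup>2) = hdim n / (4 * pi)" (is ?A)
    and "(\<Sum>i<hdim n. (Lop 1 (sphharm n i) s)\<^sup>2 + (Lop 2 (sphharm n i) s)\<^sup>2 + (Lop 3 (sphharm n i) s)\<^sup>2)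
       = n * (n + 1) * (hdim n / (4 * pi))" (is ?B)
proof -
  define Y where "Y = sphharm n"
  define d where "d = hdim n"
  have hY: "harm n (Y i)" if "i < d" for i using that harm_sphharm by (simp add: Y_def d_def)
  then have pY: "poly3 (Y i)" if "i < d" for i using that harm_poly3 by blast
  define K where "K x = (\<Sum>i<d. Y i x * Y i x)" for x
  have pK: "poly3 K" unfolding K_def using pY by (intro poly3_sum poly3_simps) auto
  define a where "a l i k = L2_inner_S2 (Lop l (Y i)) (Y k)" for l i k
  have ex: "Lop l (Y i) x = (\<Sum>k<d. a l i k * Y k x)" if "i < d" for l i x
    unfolding a_def Y_def d_def
    by (rule fun_cong[OF sphharm_expansion[OF harm_Lop[OF hY[OF that], unfolded Y_def]]])
  have anti: "a l i k = - a l k i" if "i < d" "k < d" for l i k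
    using integral_Lop_by_parts[OF pY[OF that(1)] pY[OF that(2)], of l]
    by (simp add: a_def L2_inner_S2_def mult.commute)
  have LK: "Lop l K x = (\<Sum>i<d. 2 * (Y i x * Lop l (Y i) x))" for l x
  proof -
    have "Lop l K x = (\<Sum>i<d. Lop l (\<lambda>x. Y i x * Y i x) x)"
      unfolding K_def[abs_def] using pY by (intro Lop_sum) auto
    also have "\<dots> = (\<Sum>i<d. 2 * (Y i x * Lop l (Y i) x))"
      by (intro sum.cong refl) (simp add: Lop_mult[OF pY pY])
    finally show ?thesis .
  qed
  have LK0: "Lop l K x = 0" for l x
  proof -
    let ?S = "\<Sum>i<d. \<Sum>k<d. a l i k * (Y i x * Y k x)"
    have "?S = (\<Sum>k<d. \<Sum>i<d. a l i k * (Y i x * Y k x))" by (rule sum.swap)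
    also have "\<dots> = (\<Sum>k<d. \<Sum>i<d. - (a l k i * (Y k x * Y i x)))"
    proof (intro sum.cong refl)
      fix k i assume "k \<in> {..<d}" "i \<in> {..<d}"
      then have "a l i k = - a l k i" by (intro anti) auto
      then show "a l i k * (Y i x * Y k x) = - (a l k i * (Y k x * Y i x))" by (simp only: mult_minus_left mult.commute)
    qed
    also have "\<dots> = - ?S" by (simp add: sum_negf)
    finally have "?S = 0" by simp
    moreover have "Lop l K x = 2 * ?S"
    proof -
      have "2 * (Y i x * Lop l (Y i) x) = 2 * (\<Sum>k<d. a l i k * (Y i x * Y k x))" if "i < d" for i
        unfolding ex[OF that] sum_distrib_left by (intro sum.cong refl) (simp only: mult_ac)
      then show ?thesis unfolding LK sum_distrib_left[of 2 _ "{..<d}"] by (intro sum.cong refl) simp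
    qed
    ultimately show ?thesis by simp
  qed
  have Kc: "K x = K s" if "x \<in> S2" for x by (rule constant_if_Lop_0[OF pK LK0 that s])
  have "(\<integral>x. K x \<partial>dS) = (\<integral>x. K s \<partial>dS)"
    by (rule Bochner_Integration.integral_cong[OF refl]) (rule Kc, simp)
  also have "\<dots> = 4 * pi * K s" by (simp add: measure_S2)
  finally have "4 * pi * K s = (\<integral>x. K x \<partial>dS)" by simp
  also have "\<dots> = (\<Sum>i<d. L2_inner_S2 (Y i) (Y i))"
    unfolding K_def L2_inner_S2_def using pY
    by (subst Bochner_Integration.integral_sum) (auto intro!: poly3_integrable)
  also have "\<dots> = d" using orthonormal_sphharm[of n] by (simp add: orthonormal_on_def Y_def d_def)
  finally have Ks: "K s = d / (4 * pi)" by (simp add: field_simps)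
  then show ?A by (simp add: K_def Y_def d_def power2_eq_square)
  have LL: "(\<Sum>i<d. (Lop l (Y i) s)\<^sup>2 + Y i s * Lop l (Lop l (Y i)) s) = 0" for l
  proof -
    have z: "(\<lambda>x. \<Sum>i<d. 2 * (Y i x * Lop l (Y i) x)) = (\<lambda>x. 0)"
      by (rule ext) (simp only: LK[symmetric] LK0)
    have "Lop l (\<lambda>x. \<Sum>i<d. 2 * (Y i x * Lop l (Y i) x)) s = 0"
      unfolding z by (simp add: Lop_def)
    moreover have "Lop l (\<lambda>x. \<Sum>i<d. 2 * (Y i x * Lop l (Y i) x)) s
       = (\<Sum>i<d. 2 * (Y i s * Lop l (Lop l (Y i)) s + Lop l (Y i) s * Lop l (Y i) s))"
    proof -
      have "Lop l (\<lambda>x. \<Sum>i<d. 2 * (Y i x * Lop l (Y i) x)) s = (\<Sum>i<d. Lop l (\<lambda>x. 2 * (Y i x * Lop l (Y i) x)) s)"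
        using pY by (intro Lop_sum) auto
      also have "\<dots> = (\<Sum>i<d. 2 * (Y i s * Lop l (Lop l (Y i)) s + Lop l (Y i) s * Lop l (Y i) s))"
        by (intro sum.cong refl) (simp add: Lop_cmult Lop_mult pY)
      finally show ?thesis .
    qed
    ultimately have "2 * (\<Sum>i<d. (Lop l (Y i) s)\<^sup>2 + Y i s * Lop l (Lop l (Y i)) s) = 0"
      by (simp only: sum_distrib_left power2_eq_square add.commute)
    then show ?thesis by simp
  qed
  have "(\<Sum>i<d. (Lop 1 (Y i) s)\<^sup>2 + (Lop 2 (Y i) s)\<^sup>2 + (Lop 3 (Y i) s)\<^sup>2)
    = (\<Sum>i<d. - (Y i s * (Lop 1 (Lop 1 (Y i)) s + Lop 2 (Lop 2 (Y i)) s + Lop 3 (Lop 3 (Y i)) s)))"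
    using LL[of 1] LL[of 2] LL[of 3] unfolding sum.distrib distrib_left sum_negf by linarith
  also have "\<dots> = (\<Sum>i<d. n * (n + 1) * (Y i s * Y i s))"
    by (intro sum.cong refl) (simp add: sum_Lop_Lop_harm[OF hY], simp add: algebra_simps)
  also have "\<dots> = n * (n + 1) * K s" by (simp add: K_def sum_distrib_left)
  finally show ?B unfolding Ks by (simp add: Y_def d_def algebra_simps)
qed

section \<open>Divergence and rotation of Sobolev fields\<close>

lemma smooth_has_derivative:
  assumes "smooth \<phi>"
  shows "(\<phi> has_derivative frechet_derivative \<phi> (at x)) (at x)"
proof -
  have "C_k (Suc 0) \<phi>" using assms unfolding smooth_def by blast
  then have "\<phi> differentiable (at x)" by (simp add: differentiable_on_def)
  then show ?thesis by (simp add: frechet_derivative_works[symmetric])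
qed

lemma smooth_derivative_continuous:
  assumes "smooth \<phi>"
  shows "continuous_on S (\<lambda>x. frechet_derivative \<phi> (at x) v)"
proof -
  have "C_k (Suc 0) \<phi>" using assms unfolding smooth_def by blast
  then have "continuous_on UNIV (\<lambda>x. frechet_derivative \<phi> (at x) v)" by simp
  then show ?thesis by (rule continuous_on_subset) simp
qed

lemma smooth_continuous: "smooth \<phi> \<Longrightarrow> continuous_on S \<phi>"
  by (rule continuous_at_imp_continuous_on) (auto intro: has_derivative_continuous smooth_has_derivative)

lemma frechet_derivative_eqI:
  "(f has_derivative f') (at x) \<Longrightarrow> frechet_derivative f (at x) v = f' v"
  using frechet_derivative_at by fastforce

lemma frechet_derivative_add_fun:
  assumes "f differentiable (at x)" "g differentiable (at x)"
  shows "frechet_derivative (\<lambda>x. f x + g x) (at x) v = frechet_derivative f (at x) v + frechet_derivative g (at x) v"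
proof -
  have "((\<lambda>x. f x + g x) has_derivative (\<lambda>v. frechet_derivative f (at x) v + frechet_derivative g (at x) v)) (at x)"
    using assms by (intro has_derivative_add) (simp_all add: frechet_derivative_works[symmetric])
  then show ?thesis by (rule frechet_derivative_eqI)
qed

lemma C_k_add:
  "C_k k f \<Longrightarrow> C_k k g \<Longrightarrow> C_k k (\<lambda>x. f x + g x)"
proof (induction k arbitrary: f g)
  case 0
  then show ?case by (simp add: continuous_on_add)
next
  case (Suc k)
  have d: "f differentiable (at x)" "g differentiable (at x)" for x
    using Suc.prems by (simp_all add: differentiable_on_def)
  have "(\<lambda>x. f x + g x) differentiable_on UNIV" using d by (simp add: differentiable_on_def)
  moreover have "C_k k (\<lambda>x. frechet_derivative (\<lambda>x. f x + g x) (at x) v)" for v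
    unfolding frechet_derivative_add_fun[OF d] by (rule Suc.IH) (use Suc.prems in simp_all)
  ultimately show ?case by simp
qed

lemma C_k_bounded_linear:
  assumes B: "bounded_linear B"
  shows "C_k k f \<Longrightarrow> C_k k (\<lambda>x. B (f x))"
proof (induction k arbitrary: f)
  case 0
  then show ?case by (simp add: bounded_linear.continuous_on[OF B])
next
  case (Suc k)
  have d: "f differentiable (at x)" for x
    using Suc.prems by (simp add: differentiable_on_def)
  have D: "((\<lambda>x. B (f x)) has_derivative (\<lambda>v. B (frechet_derivative f (at x) v))) (at x)" for x
    using d by (intro bounded_linear.has_derivative[OF B]) (simp add: frechet_derivative_works[symmetric])
  have "(\<lambda>x. B (f x)) differentiable_on UNIV" using D by (auto simp: differentiable_on_def differentiable_def)
  moreover have "C_k k (\<lambda>x. frechet_derivative (\<lambda>x. B (f x)) (at x) v)" for v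
    unfolding frechet_derivative_eqI[OF D] by (rule Suc.IH) (use Suc.prems in simp)
  ultimately show ?case by simp
qed

lemma C_k_decrease: "C_k (Suc k) f \<Longrightarrow> C_k k f"
proof (induction k arbitrary: f)
  case 0
  then show ?case by (simp add: differentiable_imp_continuous_on)
next
  case (Suc k)
  have "f differentiable_on UNIV" using Suc.prems by simp
  moreover have "C_k k (\<lambda>x. frechet_derivative f (at x) v)" for v
    by (rule Suc.IH) (use Suc.prems in simp)
  ultimately show ?case by simp
qed

lemma bounded_bilinear_cross: "bounded_bilinear ((\<times>) :: real^3 \<Rightarrow> real^3 \<Rightarrow> real^3)"
  using bilinear_cross bilinear_conv_bounded_bilinear by blast

lemma cross_id_has_derivative:
  assumes "(f has_derivative f') (at x)"
  shows "((\<lambda>x. f x \<times> x) has_derivative (\<lambda>v. f x \<times> v + f' v \<times> x)) (at x)"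
  by (rule bounded_bilinear.FDERIV[OF bounded_bilinear_cross assms has_derivative_ident])

text \<open>The rotation by a right angle preserves smoothness: the derivative of \<open>f x \<times> x\<close> is built from \<open>f\<close> and its
derivative by operations of the same kind.\<close>

lemma C_k_cross_id: "C_k k f \<Longrightarrow> C_k k (\<lambda>x. f x \<times> x)"
proof (induction k arbitrary: f)
  case 0
  then show ?case by (simp add: continuous_on_cross continuous_on_id)
next
  case (Suc k)
  have d: "(f has_derivative frechet_derivative f (at x)) (at x)" for x
    using Suc.prems by (simp add: differentiable_on_def frechet_derivative_works[symmetric])
  note D = cross_id_has_derivative[OF d]
  have "(\<lambda>x. f x \<times> x) differentiable_on UNIV" using D by (auto simp: differentiable_on_def differentiable_def)
  moreover have eq: "frechet_derivative (\<lambda>x. f x \<times> x) (at x) v = f x \<times> v + frechet_derivative f (at x) v \<times> x" for x v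
    by (rule frechet_derivative_eqI[OF D])
  moreover have "C_k k (\<lambda>x. f x \<times> v + frechet_derivative f (at x) v \<times> x)" for v
  proof (rule C_k_add)
    show "C_k k (\<lambda>x. f x \<times> v)"
      by (rule C_k_bounded_linear[OF bounded_bilinear.bounded_linear_left[OF bounded_bilinear_cross] C_k_decrease[OF Suc.prems]])
    show "C_k k (\<lambda>x. frechet_derivative f (at x) v \<times> x)"
      by (rule Suc.IH) (use Suc.prems in simp)
  qed
  ultimately show ?case by (simp only: C_k.simps simp_thms)
qed

lemma smooth_tangent_field_perp:
  assumes "smooth_tangent_field \<phi>" shows "smooth_tangent_field (perp \<phi>)"
proof -
  have "C_k k (perp \<phi>)" for k
    unfolding perp_def[abs_def]
    by (rule C_k_cross_id) (use assms in \<open>simp add: smooth_tangent_field_def smooth_def\<close>)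
  then show ?thesis
    by (simp add: smooth_tangent_field_def smooth_def tangent_field_def perp_def dot_cross_self)
qed

lemma continuous_cov_deriv:
  assumes "smooth \<phi>" shows "continuous_on S (cov_deriv \<phi>)"
proof -
  have lin: "linear (frechet_derivative \<phi> (at x))" for x
    using smooth_has_derivative[OF assms] has_derivative_linear by blast
  have e: "cov_deriv \<phi> s = (\<chi> i j. tangent_proj s (tangent_proj s (axis j 1) $ 1 *\<^sub>R frechet_derivative \<phi> (at s) (axis 1 1)
      + tangent_proj s (axis j 1) $ 2 *\<^sub>R frechet_derivative \<phi> (at s) (axis 2 1)
      + tangent_proj s (axis j 1) $ 3 *\<^sub>R frechet_derivative \<phi> (at s) (axis 3 1)) $ i)" for s
    unfolding cov_deriv_def matrix_def linear_expand_3[OF lin, of s "tangent_proj s _"] ..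
  show ?thesis
    unfolding e[abs_def] tangent_proj_def
    by (intro continuous_on_vec_lambda continuous_intros smooth_derivative_continuous[OF assms])
qed

lemma continuous_square_integrable:
  fixes f :: "real^3 \<Rightarrow> 'a::euclidean_space"
  assumes "continuous_on S2 f" shows "square_integrable f"
  unfolding square_integrable_def
  using assms by (auto intro!: continuous_on_S2_measurable continuous_on_S2_integrable continuous_intros)

lemma L2_norm_nonneg: "0 \<le> L2_norm_S2 f"
  by (simp add: L2_norm_eq_sqrt L2_inner_nonneg)

lemma L2_inner_limit:
  fixes f :: "real^3 \<Rightarrow> 'a::euclidean_space"
  assumes f: "square_integrable f" and fn: "\<And>n. square_integrable (F n)" and g: "square_integrable g"
    and lim: "(\<lambda>n. L2_norm_S2 (\<lambda>s. F n s - f s)) \<longlonglongrightarrow> 0"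
  shows "(\<lambda>n. L2_inner_S2 (F n) g) \<longlonglongrightarrow> L2_inner_S2 f g"
proof -
  have "\<bar>L2_inner_S2 (F n) g - L2_inner_S2 f g\<bar> \<le> L2_norm_S2 (\<lambda>s. F n s - f s) * L2_norm_S2 g" for n
  proof -
    have "L2_inner_S2 (F n) g - L2_inner_S2 f g = L2_inner_S2 (\<lambda>s. F n s - f s) g"
      unfolding L2_inner_S2_def
      by (subst Bochner_Integration.integral_diff[symmetric])
         (simp_all add: square_integrable_inner f fn g inner_diff_left)
    moreover have "(L2_inner_S2 (\<lambda>s. F n s - f s) g)\<^sup>2 \<le> (L2_norm_S2 (\<lambda>s. F n s - f s) * L2_norm_S2 g)\<^sup>2"
      using L2_Cauchy_Schwarz[OF square_integrable_diff[OF fn f] g, of n] by (simp add: power_mult_distrib L2_norm_sq)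
    ultimately have "\<bar>L2_inner_S2 (F n) g - L2_inner_S2 f g\<bar>\<^sup>2 \<le> (L2_norm_S2 (\<lambda>s. F n s - f s) * L2_norm_S2 g)\<^sup>2"
      by (simp only: power2_abs)
    then show ?thesis by (rule power2_le_imp_le) (simp add: L2_norm_nonneg)
  qed
  moreover have "(\<lambda>n. L2_norm_S2 (\<lambda>s. F n s - f s) * L2_norm_S2 g) \<longlonglongrightarrow> 0"
    using tendsto_mult_left_zero[OF lim] .
  ultimately have "(\<lambda>n. L2_inner_S2 (F n) g - L2_inner_S2 f g) \<longlonglongrightarrow> 0"
    by (rule_tac Lim_null_comparison[where g="\<lambda>n. L2_norm_S2 (\<lambda>s. F n s - f s) * L2_norm_S2 g"]) auto
  then show ?thesis by (simp add: LIM_zero_iff)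
qed

text \<open>Lagrange's identity gives \<open>s \<times> (a \<times> b) = 0\<close>, so \<open>a \<times> b\<close> is normal.\<close>

lemma cross_tangent_vectors:
  assumes "norm s = 1" "a \<bullet> s = 0" "b \<bullet> s = 0"
  shows "tangent_proj s (a \<times> b) = 0"
proof -
  have z: "s \<times> (a \<times> b) = 0" unfolding Lagrange using assms by (simp add: inner_commute)
  have "(a \<times> b) \<times> s = - (s \<times> (a \<times> b))" by (rule cross_skew)
  then have z': "(a \<times> b) \<times> s = 0" unfolding z by simp
  have "(s \<bullet> s) *\<^sub>R (a \<times> b) - (s \<bullet> (a \<times> b)) *\<^sub>R s = 0"
    unfolding Lagrange[symmetric] z' by simp
  moreover have "s \<bullet> s = 1" using assms(1) by (simp add: norm_eq_1)
  ultimately show ?thesis by (simp add: tangent_proj_def inner_commute)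
qed

text \<open>Composition of an endomorphism of the tangent space at \<open>s\<close> with the rotation \<open>v \<mapsto> v \<times> s\<close>.\<close>

definition rotate_columns :: "real^3 \<Rightarrow> real^3^3 \<Rightarrow> real^3^3" where
  "rotate_columns s A = (\<chi> i j. (column j A \<times> s) $ i)"

text \<open>The rotation by a right angle is parallel: the derivative of the factor \<open>s\<close> contributes a cross product of
tangent vectors, which is normal and is projected away.\<close>

lemma cov_deriv_perp:
  assumes \<phi>: "smooth_tangent_field \<phi>" and s: "s \<in> S2"
  shows "cov_deriv (perp \<phi>) s = rotate_columns s (cov_deriv \<phi> s)"
proof -
  have ns: "norm s = 1" using s by simp
  have t: "\<phi> s \<bullet> s = 0" using \<phi> s by (auto simp: smooth_tangent_field_def tangent_field_def)
  let ?F = "frechet_derivative \<phi> (at s)"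
  have D: "frechet_derivative (perp \<phi>) (at s) v = \<phi> s \<times> v + ?F v \<times> s" for v
    unfolding perp_def[abs_def]
    by (rule frechet_derivative_eqI, rule cross_id_has_derivative, rule smooth_has_derivative)
       (use \<phi> in \<open>simp add: smooth_tangent_field_def\<close>)
  have tp: "tangent_proj s v \<bullet> s = 0" for v
    using ns by (simp add: tangent_proj_def inner_diff_left norm_eq_1)
  have add: "tangent_proj s (v + w) = tangent_proj s v + tangent_proj s w" for v w
    by (simp add: tangent_proj_def inner_add_left algebra_simps)
  have cr: "tangent_proj s (v \<times> s) = tangent_proj s v \<times> s" for v
    by (simp add: tangent_proj_def dot_cross_self Cross3.left_diff_distrib cross_mult_left)
  have "tangent_proj s (frechet_derivative (perp \<phi>) (at s) (tangent_proj s w)) = tangent_proj s (?F (tangent_proj s w)) \<times> s" for w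
    unfolding D add cr using cross_tangent_vectors[OF ns t tp] by simp
  then show ?thesis
    by (simp add: cov_deriv_def rotate_columns_def matrix_def column_def vec_eq_iff)
qed

lemma norm_sq_columns: "(norm (A :: real^3^3))\<^sup>2 = (\<Sum>j\<in>UNIV. (norm (column j A))\<^sup>2)"
proof -
  have "(norm A)\<^sup>2 = (\<Sum>i\<in>UNIV. \<Sum>j\<in>UNIV. A$i$j * A$i$j)"
    by (simp add: power2_norm_eq_inner inner_vec_def)
  also have "\<dots> = (\<Sum>j\<in>UNIV. \<Sum>i\<in>UNIV. A$i$j * A$i$j)" by (rule sum.swap)
  also have "\<dots> = (\<Sum>j\<in>UNIV. (norm (column j A))\<^sup>2)"
    by (simp add: power2_norm_eq_inner inner_vec_def column_def)
  finally show ?thesis .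
qed

lemma norm_cross_le: "norm (a \<times> b) \<le> norm a * norm b"
proof (rule power2_le_imp_le)
  show "(norm (a \<times> b))\<^sup>2 \<le> (norm a * norm b)\<^sup>2"
    using norm_cross_dot[of a b] zero_le_power2[of "a \<bullet> b"] by linarith
qed simp

lemma norm_rotate_columns:
  assumes "norm s = 1" shows "norm (rotate_columns s A) \<le> norm A"
proof (rule power2_le_imp_le)
  have c: "column j (rotate_columns s A) = column j A \<times> s" for j
    by (simp add: rotate_columns_def column_def vec_eq_iff)
  show "(norm (rotate_columns s A))\<^sup>2 \<le> (norm A)\<^sup>2"
    unfolding norm_sq_columns c
    by (intro sum_mono power_mono) (use norm_cross_le[of _ s] assms in auto)
qed simp

lemma rotate_columns_diff: "rotate_columns s (A - B) = rotate_columns s A - rotate_columns s B"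
  by (simp add: rotate_columns_def column_def vec_eq_iff forall_3 cross_components algebra_simps)

lemma square_integrable_dominated:
  fixes f :: "real^3 \<Rightarrow> 'a::euclidean_space" and g :: "real^3 \<Rightarrow> 'b::euclidean_space"
  assumes g: "square_integrable g" and f: "f \<in> borel_measurable dS"
    and le: "\<And>s. s \<in> S2 \<Longrightarrow> norm (f s) \<le> norm (g s)"
  shows "square_integrable f" "L2_norm_S2 f \<le> L2_norm_S2 g"
proof -
  have ig: "integrable dS (\<lambda>s. (norm (g s))\<^sup>2)" using g by (simp add: square_integrable_def)
  have "integrable dS (\<lambda>s. (norm (f s))\<^sup>2)"
    by (rule Bochner_Integration.integrable_bound[OF ig])
       (use f in \<open>auto intro!: AE_I2 power_mono le\<close>)
  then show sf: "square_integrable f" using f by (simp add: square_integrable_def)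
  show "L2_norm_S2 f \<le> L2_norm_S2 g"
    unfolding L2_norm_S2_def
    by (intro real_sqrt_le_mono integral_mono)
       (use sf ig in \<open>auto simp: square_integrable_def intro!: power_mono le\<close>)
qed

lemma perp_measurable:
  assumes "u \<in> borel_measurable dS"
  shows "perp u \<in> borel_measurable dS"
proof -
  have id: "(\<lambda>s. s) \<in> borel_measurable dS" by (intro continuous_on_S2_measurable continuous_intros)
  show ?thesis unfolding perp_def[abs_def]
    by (rule borel_measurable_continuous_Pair[OF assms id])
       (intro continuous_on_cross continuous_intros)
qed

lemma norm_perp_le: "s \<in> S2 \<Longrightarrow> norm (perp u s) \<le> norm (u s)"
  using norm_cross_le[of "u s" s] by (simp add: perp_def)

text \<open>Rotating the approximating smooth fields and their covariant derivatives does not increase any \<open>L\<^sup>2\<close> distance.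
This puts \<open>perp u\<close> into the Sobolev space, so that the rotation of \<open>u\<close> is the divergence of a Sobolev field.\<close>

lemma has_cov_deriv_perp:
  assumes "has_cov_deriv u T"
  shows "has_cov_deriv (perp u) (\<lambda>s. rotate_columns s (T s))"
proof -
  from assms obtain \<phi> where u: "square_integrable u" "tangent_field u" and T: "square_integrable T"
    and \<phi>: "\<And>n::nat. smooth_tangent_field (\<phi> n)"
    and l1: "(\<lambda>n. L2_norm_S2 (\<lambda>s. \<phi> n s - u s)) \<longlonglongrightarrow> 0"
    and l2: "(\<lambda>n. L2_norm_S2 (\<lambda>s. cov_deriv (\<phi> n) s - T s)) \<longlonglongrightarrow> 0"
    by (auto simp: has_cov_deriv_def)
  have sm: "smooth (\<phi> n)" for n using \<phi> by (simp add: smooth_tangent_field_def)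
  have id: "(\<lambda>s. s) \<in> borel_measurable dS" by (intro continuous_on_S2_measurable continuous_intros)
  have rc: "(\<lambda>s. rotate_columns s (A s)) \<in> borel_measurable dS" if "A \<in> borel_measurable dS" for A
    unfolding rotate_columns_def column_def
    by (rule borel_measurable_continuous_Pair[OF id that])
       (intro continuous_on_vec_lambda continuous_intros continuous_on_cross)
  have d1: "square_integrable (\<lambda>s. \<phi> n s - u s)" for n
    by (intro square_integrable_diff continuous_square_integrable smooth_continuous sm u)
  have d2: "square_integrable (\<lambda>s. cov_deriv (\<phi> n) s - T s)" for n
    by (intro square_integrable_diff continuous_square_integrable continuous_cov_deriv sm T)
  have "(\<lambda>n. L2_norm_S2 (\<lambda>s. perp (\<phi> n) s - perp u s)) \<longlonglongrightarrow> 0"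
  proof (rule Lim_null_comparison[OF _ l1], rule always_eventually, rule allI)
    fix n
    have e: "(\<lambda>s. perp (\<phi> n) s - perp u s) = perp (\<lambda>s. \<phi> n s - u s)"
      by (simp add: perp_def[abs_def] Cross3.left_diff_distrib)
    show "norm (L2_norm_S2 (\<lambda>s. perp (\<phi> n) s - perp u s)) \<le> L2_norm_S2 (\<lambda>s. \<phi> n s - u s)"
    proof -
      have "L2_norm_S2 (perp (\<lambda>s. \<phi> n s - u s)) \<le> L2_norm_S2 (\<lambda>s. \<phi> n s - u s)"
        by (rule square_integrable_dominated(2)[OF d1 perp_measurable[OF square_integrable_measurable[OF d1]] norm_perp_le])
      then show ?thesis unfolding e by (simp add: L2_norm_nonneg)
    qed
  qed
  moreover have "(\<lambda>n. L2_norm_S2 (\<lambda>s. cov_deriv (perp (\<phi> n)) s - rotate_columns s (T s))) \<longlonglongrightarrow> 0"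
  proof (rule Lim_null_comparison[OF _ l2], rule always_eventually, rule allI)
    fix n
    have e: "L2_norm_S2 (\<lambda>s. cov_deriv (perp (\<phi> n)) s - rotate_columns s (T s))
        = L2_norm_S2 (\<lambda>s. rotate_columns s (cov_deriv (\<phi> n) s - T s))"
      unfolding L2_norm_S2_def
      by (intro arg_cong[where f=sqrt] Bochner_Integration.integral_cong refl)
         (simp add: cov_deriv_perp[OF \<phi>] rotate_columns_diff)
    have "L2_norm_S2 (\<lambda>s. rotate_columns s (cov_deriv (\<phi> n) s - T s)) \<le> L2_norm_S2 (\<lambda>s. cov_deriv (\<phi> n) s - T s)"
      by (rule square_integrable_dominated(2)[OF d2 rc[OF square_integrable_measurable[OF d2]]])
         (simp add: norm_rotate_columns)
    then show "norm (L2_norm_S2 (\<lambda>s. cov_deriv (perp (\<phi> n)) s - rotate_columns s (T s))) \<le> L2_norm_S2 (\<lambda>s. cov_deriv (\<phi> n) s - T s)"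
      unfolding e by (simp add: L2_norm_nonneg)
  qed
  moreover have "square_integrable (perp u)"
    by (rule square_integrable_dominated(1)[OF u(1) perp_measurable[OF square_integrable_measurable[OF u(1)]] norm_perp_le])
  moreover have "square_integrable (\<lambda>s. rotate_columns s (T s))"
    by (rule square_integrable_dominated(1)[OF T rc[OF square_integrable_measurable[OF T]]])
       (simp add: norm_rotate_columns)
  moreover have "tangent_field (perp u)" by (simp add: tangent_field_def perp_def dot_cross_self)
  ultimately show ?thesis
    using smooth_tangent_field_perp[OF \<phi>] unfolding has_cov_deriv_def
    by (intro conjI exI[of _ "\<lambda>n. perp (\<phi> n)"]) auto
qed

lemma perp_in_H1: "u \<in> H1_TS2 \<Longrightarrow> perp u \<in> H1_TS2"
  using has_cov_deriv_perp by (auto simp: H1_TS2_def)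

text \<open>The product rule turns \<open>Y div \<phi> + \<phi> \<bullet> \<nabla>Y\<close> into a sum of derivatives along the rotations about the axes, each of
mean value zero.\<close>

lemma smooth_integration_by_parts:
  assumes \<phi>: "smooth_tangent_field \<phi>" and Y: "poly3 Y"
  shows "(\<integral>s. trace (cov_deriv \<phi> s) * Y s \<partial>dS) = - (\<integral>s. \<phi> s \<bullet> gradient Y s \<partial>dS)"
proof -
  let ?F = "\<lambda>x. frechet_derivative \<phi> (at x)"
  have sm: "smooth \<phi>" using \<phi> by (simp add: smooth_tangent_field_def)
  note dF = smooth_has_derivative[OF sm]
  define g' where "g' i x v = Y x * (v \<times> \<phi> x + x \<times> ?F x v) $ i + dird v Y x * (x \<times> \<phi> x) $ i" for i :: 3 and x v
  have dg: "((\<lambda>x. Y x * (x \<times> \<phi> x) $ i) has_derivative g' i x) (at x)" for i x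
  proof -
    have "((\<lambda>x. x \<times> \<phi> x) has_derivative (\<lambda>v. x \<times> ?F x v + v \<times> \<phi> x)) (at x)"
      by (rule bounded_bilinear.FDERIV[OF bounded_bilinear_cross has_derivative_ident dF])
    then have "((\<lambda>x. (x \<times> \<phi> x) $ i) has_derivative (\<lambda>v. (x \<times> ?F x v + v \<times> \<phi> x) $ i)) (at x)"
      by (rule bounded_linear.has_derivative[OF bounded_linear_vec_nth])
    from has_derivative_mult[OF poly3_has_derivative[OF Y] this]
    show ?thesis unfolding g'_def[abs_def] by (simp add: add.commute)
  qed
  have cg: "continuous_on S (\<lambda>x. g' i x v)" for S i v
    unfolding g'_def
    by (intro continuous_intros continuous_on_cross poly3_continuous[OF Y] poly3_continuous[OF poly3_dird[OF Y]]
        smooth_continuous[OF sm] smooth_derivative_continuous[OF sm])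
  have lin: "linear (g' i x)" for i x using dg has_derivative_linear by blast
  have z: "(\<integral>s. g' i s (axis i 1 \<times> s) \<partial>dS) = 0" for i
    by (rule integral_rotation_derivative[OF dg cg]) simp
  have int: "integrable dS (\<lambda>s. g' i s (axis i 1 \<times> s))" for i
    unfolding linear_expand_3[OF lin, of i _ "axis i 1 \<times> _"]
    by (intro continuous_on_S2_integrable continuous_intros cg continuous_on_cross)
  have "0 = (\<Sum>i\<in>UNIV. (\<integral>s. g' i s (axis i 1 \<times> s) \<partial>dS))" by (simp add: z)
  also have "\<dots> = (\<integral>s. (\<Sum>i\<in>UNIV. g' i s (axis i 1 \<times> s)) \<partial>dS)"
    by (rule Bochner_Integration.integral_sum[symmetric]) (rule int)
  also have "\<dots> = (\<integral>s. trace (cov_deriv \<phi> s) * Y s + \<phi> s \<bullet> gradient Y s \<partial>dS)"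
  proof (rule Bochner_Integration.integral_cong[OF refl])
    fix s assume "s \<in> space dS"
    then have s: "s \<in> S2" by simp
    have t: "\<phi> s \<bullet> s = 0" using \<phi> s by (auto simp: smooth_tangent_field_def tangent_field_def)
    have "(\<Sum>i\<in>UNIV. g' i s (axis i 1 \<times> s)) = Y s * trace (cov_deriv \<phi> s) + (\<Sum>i\<in>UNIV. dird (axis i 1 \<times> s) Y s * (s \<times> \<phi> s) $ i)"
      unfolding g'_def sum.distrib trace_cov_deriv[OF dF s t] sum_distrib_left ..
    also have "(\<Sum>i\<in>UNIV. dird (axis i 1 \<times> s) Y s * (s \<times> \<phi> s) $ i) = (s \<times> gradient Y s) \<bullet> (s \<times> \<phi> s)"
      by (simp add: sum_3 inner_vec_def poly3_dird_linear[OF Y, of "_ \<times> _"] cross_components axis1_nth gradient_def)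
         (simp add: mult.commute)
    also have "\<dots> = \<phi> s \<bullet> gradient Y s"
      using s t by (simp add: dot_cross norm_eq_1 inner_commute)
    finally show "(\<Sum>i\<in>UNIV. g' i s (axis i 1 \<times> s)) = trace (cov_deriv \<phi> s) * Y s + \<phi> s \<bullet> gradient Y s"
      by (simp add: mult.commute)
  qed
  also have "\<dots> = (\<integral>s. trace (cov_deriv \<phi> s) * Y s \<partial>dS) + (\<integral>s. \<phi> s \<bullet> gradient Y s \<partial>dS)"
  proof (rule Bochner_Integration.integral_add)
    show "integrable dS (\<lambda>s. trace (cov_deriv \<phi> s) * Y s)"
      unfolding trace_def
      by (intro continuous_on_S2_integrable continuous_intros poly3_continuous Y continuous_cov_deriv sm)
    show "integrable dS (\<lambda>s. \<phi> s \<bullet> gradient Y s)"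
      unfolding gradient_def
      by (intro continuous_on_S2_integrable continuous_intros continuous_on_vec_lambda poly3_continuous[OF poly3_dird[OF Y]] smooth_continuous sm)
  qed
  finally show ?thesis by simp
qed

lemma gradient_square_integrable:
  assumes "poly3 Y" shows "square_integrable (gradient Y)"
  unfolding gradient_def[abs_def]
  by (intro continuous_square_integrable continuous_on_vec_lambda poly3_continuous[OF poly3_dird[OF assms]])

lemma trace_eq_inner: "trace (A :: real^3^3) = A \<bullet> mat 1"
  by (simp add: trace_def inner_vec_def mat_def if_distrib cong: if_cong)

text \<open>Both sides pass to the limit along the smooth approximations. The argument applies to whichever covariant
derivative the choice operator picks.\<close>

lemma H1_integration_by_parts:
  assumes u: "u \<in> H1_TS2" and Y: "poly3 Y"
  shows "L2_inner_S2 (div_S2 u) Y = - L2_inner_S2 u (gradient Y)"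
    and div_square_integrable: "square_integrable (div_S2 u)"
proof -
  define T where "T = H1_cov_deriv u"
  have "has_cov_deriv u T" using u unfolding T_def H1_cov_deriv_def H1_TS2_def mem_Collect_eq by (rule someI_ex)
  then obtain \<phi> where u: "square_integrable u" and T: "square_integrable T"
    and \<phi>: "\<And>n::nat. smooth_tangent_field (\<phi> n)"
    and l1: "(\<lambda>n. L2_norm_S2 (\<lambda>s. \<phi> n s - u s)) \<longlonglongrightarrow> 0"
    and l2: "(\<lambda>n. L2_norm_S2 (\<lambda>s. cov_deriv (\<phi> n) s - T s)) \<longlonglongrightarrow> 0"
    by (auto simp: has_cov_deriv_def)
  have sm: "smooth (\<phi> n)" for n using \<phi> by (simp add: smooth_tangent_field_def)
  \<comment> \<open>The trace is the inner product with the identity matrix, so the divergence is an \<open>L\<^sup>2\<close> inner product of matrix fields.\<close>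
  let ?I = "\<lambda>s. Y s *\<^sub>R (mat 1 :: real^3^3)"
  have I: "square_integrable ?I"
    by (intro continuous_square_integrable continuous_intros poly3_continuous Y)
  have tr: "L2_inner_S2 A ?I = (\<integral>s. trace (A s) * Y s \<partial>dS)" for A
    by (simp add: L2_inner_S2_def trace_eq_inner mult.commute)
  have "(\<lambda>n. L2_inner_S2 (cov_deriv (\<phi> n)) ?I) \<longlonglongrightarrow> L2_inner_S2 T ?I"
    by (rule L2_inner_limit[OF T _ I l2]) (intro continuous_square_integrable continuous_cov_deriv sm)
  moreover have "(\<lambda>n. - L2_inner_S2 (\<phi> n) (gradient Y)) \<longlonglongrightarrow> - L2_inner_S2 u (gradient Y)"
    by (intro tendsto_minus L2_inner_limit[OF u _ gradient_square_integrable[OF Y] l1])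
       (intro continuous_square_integrable smooth_continuous sm)
  moreover have "L2_inner_S2 (cov_deriv (\<phi> n)) ?I = - L2_inner_S2 (\<phi> n) (gradient Y)" for n
    unfolding tr using smooth_integration_by_parts[OF \<phi> Y] by (simp add: L2_inner_S2_def)
  ultimately have "L2_inner_S2 T ?I = - L2_inner_S2 u (gradient Y)"
    using LIMSEQ_unique by simp
  then show "L2_inner_S2 (div_S2 u) Y = - L2_inner_S2 u (gradient Y)"
    unfolding tr by (simp add: L2_inner_S2_def div_S2_def[abs_def] T_def)
  have m: "(\<lambda>s. trace (T s)) \<in> borel_measurable dS"
    unfolding trace_eq_inner using square_integrable_measurable[OF T] by simp
  have "square_integrable (\<lambda>s. trace (T s))"
  proof (rule square_integrable_dominated(1)[OF square_integrable_scale[OF T] m])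
    fix s
    have "norm (trace (T s)) \<le> norm (T s) * norm (mat 1 :: real^3^3)"
      unfolding trace_eq_inner by (simp add: Cauchy_Schwarz_ineq2)
    then show "norm (trace (T s)) \<le> norm (norm (mat 1 :: real^3^3) *\<^sub>R T s)" by (simp add: mult.commute)
  qed
  then show "square_integrable (div_S2 u)" by (simp add: div_S2_def[abs_def] T_def)
qed

lemma H1_rot_by_parts:
  assumes u: "u \<in> H1_TS2" and Y: "poly3 Y"
  shows "L2_inner_S2 (rot_S2 u) Y = - L2_inner_S2 u (\<lambda>s. s \<times> gradient Y s)"
    and rot_square_integrable: "square_integrable (rot_S2 u)"
proof -
  have "L2_inner_S2 (rot_S2 u) Y = - L2_inner_S2 (perp u) (gradient Y)"
    unfolding rot_S2_def by (rule H1_integration_by_parts(1)[OF perp_in_H1[OF u] Y])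
  also have "L2_inner_S2 (perp u) (gradient Y) = L2_inner_S2 u (\<lambda>s. s \<times> gradient Y s)"
    unfolding L2_inner_S2_def perp_def
    by (intro Bochner_Integration.integral_cong refl) (simp add: cross_triple inner_commute cross3_simps)
  finally show "L2_inner_S2 (rot_S2 u) Y = - L2_inner_S2 u (\<lambda>s. s \<times> gradient Y s)" .
  show "square_integrable (rot_S2 u)"
    unfolding rot_S2_def by (rule div_square_integrable[OF perp_in_H1[OF u] Y])
qed

section \<open>Vector spherical harmonics\<close>

text \<open>The \<open>i\<close>-th component of \<open>curl_field Y\<close> is \<open>L\<^sub>i Y\<close>, which makes this field the easier of the
two. On the sphere, \<open>grad_field Y\<close> is the tangential gradient of \<open>Y\<close>.\<close>

definition curl_field :: "(real^3 \<Rightarrow> real) \<Rightarrow> real^3 \<Rightarrow> real^3" where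
  "curl_field Y s = s \<times> gradient Y s"

definition grad_field :: "(real^3 \<Rightarrow> real) \<Rightarrow> real^3 \<Rightarrow> real^3" where
  "grad_field Y s = curl_field Y s \<times> s"

lemma curl_field_nth: "poly3 Y \<Longrightarrow> curl_field Y s $ i = Lop i Y s"
  using exhaust_3[of i] by (auto simp: curl_field_def gradient_def cross_components Lop_eq mult.commute)

lemma inner_curl_field:
  "poly3 Y \<Longrightarrow> poly3 Z \<Longrightarrow> curl_field Y s \<bullet> curl_field Z s = (\<Sum>i\<in>UNIV. Lop i Y s * Lop i Z s)"
  by (simp add: inner_vec_def curl_field_nth)

lemma curl_field_tangent: "curl_field Y s \<bullet> s = 0"
  by (simp add: curl_field_def dot_cross_self inner_commute)

lemma inner_cross_cross_tangent:
  assumes "s \<in> S2" "a \<bullet> s = 0" shows "(a \<times> s) \<bullet> (b \<times> s) = a \<bullet> b"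
  using assms by (simp add: dot_cross norm_eq_1)

lemma inner_grad_field: "s \<in> S2 \<Longrightarrow> grad_field Y s \<bullet> grad_field Z s = curl_field Y s \<bullet> curl_field Z s"
  by (simp add: grad_field_def inner_cross_cross_tangent curl_field_tangent)

lemma grad_field_eq: "s \<in> S2 \<Longrightarrow> grad_field Y s = tangent_proj s (gradient Y s)"
proof -
  assume s: "s \<in> S2"
  have "grad_field Y s = - (s \<times> (s \<times> gradient Y s))"
    unfolding grad_field_def curl_field_def by (rule cross_skew)
  then show ?thesis using s by (simp add: Lagrange tangent_proj_def norm_eq_1 inner_commute)
qed

lemma inner_tangent_grad_field:
  "s \<in> S2 \<Longrightarrow> a \<bullet> s = 0 \<Longrightarrow> a \<bullet> grad_field Y s = a \<bullet> gradient Y s"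
  by (simp add: grad_field_eq tangent_proj_def inner_diff_right)

lemma continuous_gradient: "poly3 Y \<Longrightarrow> continuous_on S (gradient Y)"
  unfolding gradient_def[abs_def]
  by (intro continuous_on_vec_lambda poly3_continuous poly3_dird)

lemma continuous_curl_field: "poly3 Y \<Longrightarrow> continuous_on S (curl_field Y)"
  unfolding curl_field_def[abs_def] by (intro continuous_on_cross continuous_on_id continuous_gradient)

lemma continuous_grad_field: "poly3 Y \<Longrightarrow> continuous_on S (grad_field Y)"
  unfolding grad_field_def[abs_def] by (intro continuous_on_cross continuous_on_id continuous_curl_field)

lemma L2_inner_cong:
  "(\<And>s. s \<in> S2 \<Longrightarrow> f s \<bullet> g s = f' s \<bullet> g' s) \<Longrightarrow> L2_inner_S2 f g = L2_inner_S2 f' g'"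
  unfolding L2_inner_S2_def by (intro Bochner_Integration.integral_cong) auto

lemma L2_inner_curl_field:
  assumes Y: "harm n Y" and Z: "poly3 Z"
  shows "L2_inner_S2 (curl_field Y) (curl_field Z) = n * (n + 1) * L2_inner_S2 Y Z"
proof -
  have pY: "poly3 Y" using Y by (rule harm_poly3)
  have "L2_inner_S2 (curl_field Y) (curl_field Z) = (\<Sum>i\<in>UNIV. \<integral>s. Lop i Y s * Lop i Z s \<partial>dS)"
    unfolding L2_inner_S2_def inner_curl_field[OF pY Z]
    by (rule Bochner_Integration.integral_sum) (intro poly3_integrable poly3_simps poly3_Lop pY Z)
  also have "\<dots> = (\<Sum>i\<in>UNIV. - (\<integral>s. Lop i (Lop i Y) s * Z s \<partial>dS))"
    by (intro sum.cong refl integral_Lop_by_parts poly3_Lop pY Z)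
  also have "\<dots> = - (\<integral>s. (\<Sum>i\<in>UNIV. Lop i (Lop i Y) s * Z s) \<partial>dS)"
    by (subst Bochner_Integration.integral_sum) (auto simp: sum_negf pY Z intro!: poly3_integrable)
  also have "\<dots> = - (\<integral>s. - (n * (n + 1)) * (Y s * Z s) \<partial>dS)"
  proof (intro arg_cong[where f=uminus] Bochner_Integration.integral_cong refl)
    fix s
    have "(\<Sum>i\<in>UNIV. Lop i (Lop i Y) s * Z s) = (Lop 1 (Lop 1 Y) s + Lop 2 (Lop 2 Y) s + Lop 3 (Lop 3 Y) s) * Z s"
      by (simp add: sum_3 algebra_simps)
    then show "(\<Sum>i\<in>UNIV. Lop i (Lop i Y) s * Z s) = - (n * (n + 1)) * (Y s * Z s)"
      unfolding sum_Lop_Lop_harm[OF Y] by (simp add: algebra_simps)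
  qed
  also have "\<dots> = real n * (real n + 1) * L2_inner_S2 Y Z"
    unfolding L2_inner_S2_def by (subst integral_mult_right_zero) (simp add: algebra_simps)
  finally show ?thesis .
qed

lemma L2_inner_grad_field:
  "L2_inner_S2 (grad_field Y) (grad_field Z) = L2_inner_S2 (curl_field Y) (curl_field Z)"
  by (rule L2_inner_cong) (rule inner_grad_field)

lemma sum_Lop_pd_eq_0:
  assumes "poly3 Z" shows "(\<Sum>i\<in>UNIV. Lop i (pd i Z) s) = 0"
  using dird_commute[OF assms, of "axis 2 1" "axis 1 1"] dird_commute[OF assms, of "axis 3 1" "axis 1 1"]
    dird_commute[OF assms, of "axis 3 1" "axis 2 1"]
  by (simp add: sum_3 Lop_eq assms)

text \<open>After integration by parts the operator \<open>\<Sum> L\<^sub>i \<partial>\<^sub>i = (x \<times> \<nabla>) \<bullet> \<nabla> = 0\<close> appears.\<close>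

lemma L2_inner_curl_grad:
  assumes Y: "poly3 Y" and Z: "poly3 Z"
  shows "L2_inner_S2 (curl_field Y) (grad_field Z) = 0"
proof -
  have "L2_inner_S2 (curl_field Y) (grad_field Z) = L2_inner_S2 (curl_field Y) (gradient Z)"
    by (rule L2_inner_cong) (simp add: inner_tangent_grad_field curl_field_tangent)
  also have "\<dots> = (\<integral>s. (\<Sum>i\<in>UNIV. pd i Z s * Lop i Y s) \<partial>dS)"
    by (simp add: L2_inner_S2_def inner_vec_def curl_field_nth[OF Y] gradient_def mult.commute)
  also have "\<dots> = (\<Sum>i\<in>UNIV. \<integral>s. pd i Z s * Lop i Y s \<partial>dS)"
    by (rule Bochner_Integration.integral_sum) (intro poly3_integrable poly3_simps poly3_Lop poly3_dird Y Z)
  also have "\<dots> = (\<Sum>i\<in>UNIV. - (\<integral>s. Lop i (pd i Z) s * Y s \<partial>dS))"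
    by (intro sum.cong refl integral_Lop_by_parts poly3_dird Y Z)
  also have "\<dots> = - (\<integral>s. (\<Sum>i\<in>UNIV. Lop i (pd i Z) s * Y s) \<partial>dS)"
    by (subst Bochner_Integration.integral_sum) (auto simp: sum_negf Y Z intro!: poly3_integrable)
  also have "\<dots> = 0"
    unfolding sum_distrib_right[symmetric] sum_Lop_pd_eq_0[OF Z] by simp
  finally show ?thesis .
qed

text \<open>For different degrees, the inner product of the curl fields is a multiple of that of the harmonics in two
ways, with two different eigenvalues as factors.\<close>

lemma L2_inner_sphharm:
  assumes "i < hdim n" "j < hdim m"
  shows "L2_inner_S2 (sphharm n i) (sphharm m j) = (if n = m \<and> i = j then 1 else 0)"
proof (cases "n = m")
  case True
  then show ?thesis using assms orthonormal_sphharm[of n] by (simp add: orthonormal_on_def)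
next
  case False
  have h: "harm n (sphharm n i)" "harm m (sphharm m j)" using assms harm_sphharm by auto
  let ?x = "L2_inner_S2 (sphharm n i) (sphharm m j)"
  have "real n * (real n + 1) * ?x = L2_inner_S2 (curl_field (sphharm n i)) (curl_field (sphharm m j))"
    using L2_inner_curl_field[OF h(1) harm_poly3[OF h(2)]] by simp
  also have "\<dots> = real m * (real m + 1) * ?x"
    using L2_inner_curl_field[OF h(2) harm_poly3[OF h(1)]] by (simp add: L2_inner_commute)
  finally have "(real n * (real n + 1) - real m * (real m + 1)) * ?x = 0" by (simp add: left_diff_distrib)
  moreover have "real n * (real n + 1) - real m * (real m + 1) = (real n - real m) * (real n + real m + 1)"
    by (simp add: algebra_simps)
  ultimately show ?thesis using False by auto
qed

text \<open>A mode \<open>(n, i, b)\<close> comes from the \<open>i\<close>-th basis harmonic of degree \<open>n\<close>; it is of curl type if \<open>b\<close> holds and of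
gradient type otherwise.\<close>

definition vharm :: "nat \<times> nat \<times> bool \<Rightarrow> real^3 \<Rightarrow> real^3" where
  "vharm k s = (case k of (n, i, b) \<Rightarrow>
     (1 / sqrt (real n * (real n + 1))) *\<^sub>R (if b then curl_field (sphharm n i) s else grad_field (sphharm n i) s))"

definition level :: "nat \<times> nat \<times> bool \<Rightarrow> real" where
  "level k = (case k of (n, i, b) \<Rightarrow> real n * (real n + 1))"

text \<open>Degree 0 is left out because constants have no gradient.\<close>

definition modes :: "bool set \<Rightarrow> nat \<Rightarrow> (nat \<times> nat \<times> bool) set" where
  "modes B m = (SIGMA n:{1..m}. (SIGMA i:{..<hdim n}. B))"

lemma finite_modes [simp]: "finite (modes B m)"
  unfolding modes_def by (intro finite_SigmaI finite_atLeastAtMost finite_lessThan) (rule finite)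

lemma level_pos: "k \<in> modes B m \<Longrightarrow> level k > 0"
  by (auto simp: modes_def level_def)

lemma L2_inner_vharm_right:
  "L2_inner_S2 f (vharm (n, i, b)) = (1 / sqrt (real n * (real n + 1))) *
     L2_inner_S2 f (if b then curl_field (sphharm n i) else grad_field (sphharm n i))"
  by (simp add: L2_inner_S2_def vharm_def)

lemma L2_inner_vharm_left:
  "L2_inner_S2 (vharm (n, i, b)) f = (1 / sqrt (real n * (real n + 1))) *
     L2_inner_S2 (if b then curl_field (sphharm n i) else grad_field (sphharm n i)) f"
  by (simp add: L2_inner_S2_def vharm_def)

lemma orthonormal_vharm: "orthonormal_on (modes B m) vharm"
  unfolding orthonormal_on_def
proof (intro conjI ballI)
  fix k assume "k \<in> modes B m"
  then obtain n i b where k: "k = (n, i, b)" and i: "i < hdim n" by (auto simp: modes_def)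
  have p: "poly3 (sphharm n i)" using harm_sphharm[OF i] by (rule harm_poly3)
  have "vharm k = (\<lambda>s. (1 / sqrt (real n * (real n + 1))) *\<^sub>R (if b then curl_field (sphharm n i) else grad_field (sphharm n i)) s)"
    by (simp add: vharm_def[abs_def] k)
  then show "square_integrable (vharm k)"
    using continuous_square_integrable[OF continuous_curl_field[OF p]] continuous_square_integrable[OF continuous_grad_field[OF p]]
    by (cases b) (simp_all add: square_integrable_scale)
next
  fix k l assume "k \<in> modes B m" "l \<in> modes B m"
  then obtain n i b n' i' b' where k: "k = (n, i, b)" and i: "i < hdim n" "n > 0"
    and l: "l = (n', i', b')" and i': "i' < hdim n'" "n' > 0" by (auto simp: modes_def)
  have h: "harm n (sphharm n i)" using harm_sphharm[OF i(1)] .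
  have p: "poly3 (sphharm n i)" "poly3 (sphharm n' i')" using harm_sphharm i i' harm_poly3 by blast+
  let ?C = "L2_inner_S2 (curl_field (sphharm n i)) (curl_field (sphharm n' i'))"
  have C: "?C = (if n = n' \<and> i = i' then real n * (real n + 1) else 0)"
    using L2_inner_curl_field[OF h p(2)] L2_inner_sphharm[OF i(1) i'(1)] by simp
  have "L2_inner_S2 (vharm k) (vharm l) = (1 / sqrt (real n * (real n + 1))) * ((1 / sqrt (real n' * (real n' + 1))) *
      L2_inner_S2 (if b then curl_field (sphharm n i) else grad_field (sphharm n i)) (if b' then curl_field (sphharm n' i') else grad_field (sphharm n' i')))"
    unfolding k l L2_inner_vharm_left L2_inner_vharm_right by (rule mult.left_commute)
  also have "L2_inner_S2 (if b then curl_field (sphharm n i) else grad_field (sphharm n i)) (if b' then curl_field (sphharm n' i') else grad_field (sphharm n' i'))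
     = (if b = b' then ?C else 0)"
    using L2_inner_curl_grad[OF p] L2_inner_curl_grad[OF p(2) p(1)]
    by (simp add: L2_inner_grad_field L2_inner_commute)
  finally show "L2_inner_S2 (vharm k) (vharm l) = (if k = l then 1 else 0)"
    using i unfolding C k l by auto
qed

lemma norm_sq_vharm:
  assumes "s \<in> S2" "i < hdim n"
  shows "(norm (vharm (n, i, b) s))\<^sup>2 = ((Lop 1 (sphharm n i) s)\<^sup>2 + (Lop 2 (sphharm n i) s)\<^sup>2 + (Lop 3 (sphharm n i) s)\<^sup>2) / (real n * (real n + 1))"
proof -
  have p: "poly3 (sphharm n i)" using harm_sphharm[OF assms(2)] by (rule harm_poly3)
  have "(norm (if b then curl_field (sphharm n i) s else grad_field (sphharm n i) s))\<^sup>2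
     = (Lop 1 (sphharm n i) s)\<^sup>2 + (Lop 2 (sphharm n i) s)\<^sup>2 + (Lop 3 (sphharm n i) s)\<^sup>2"
    using assms p by (simp add: power2_norm_eq_inner inner_grad_field inner_curl_field sum_3) (simp add: power2_eq_square)
  then show ?thesis
    by (simp add: vharm_def power_mult_distrib power_divide)
qed

lemma sum_modes:
  "(\<Sum>k\<in>modes B m. f k) = (\<Sum>b\<in>B. \<Sum>n=1..m. \<Sum>i<hdim n. f (n, i, b))"
proof -
  have fB: "finite B" by (rule finite)
  have "(\<Sum>k\<in>modes B m. f k) = (\<Sum>(n, p)\<in>(SIGMA n:{1..m}. SIGMA i:{..<hdim n}. B). f (n, p))"
    by (simp add: modes_def split_def)
  also have "\<dots> = (\<Sum>n=1..m. \<Sum>p\<in>(SIGMA i:{..<hdim n}. B). f (n, p))"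
    by (rule sum.Sigma[symmetric]) (auto simp: fB)
  also have "\<dots> = (\<Sum>n=1..m. \<Sum>i<hdim n. \<Sum>b\<in>B. f (n, i, b))"
  proof (rule sum.cong[OF refl])
    fix n
    have "(\<Sum>p\<in>(SIGMA i:{..<hdim n}. B). f (n, p)) = (\<Sum>(i, b)\<in>(SIGMA i:{..<hdim n}. B). f (n, i, b))"
      by (simp add: split_def)
    also have "\<dots> = (\<Sum>i<hdim n. \<Sum>b\<in>B. f (n, i, b))"
      by (rule sum.Sigma[symmetric]) (auto simp: fB)
    finally show "(\<Sum>p\<in>(SIGMA i:{..<hdim n}. B). f (n, p)) = (\<Sum>i<hdim n. \<Sum>b\<in>B. f (n, i, b))" .
  qed
  also have "\<dots> = (\<Sum>n=1..m. \<Sum>b\<in>B. \<Sum>i<hdim n. f (n, i, b))"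
    by (intro sum.cong refl sum.swap)
  also have "\<dots> = (\<Sum>b\<in>B. \<Sum>n=1..m. \<Sum>i<hdim n. f (n, i, b))"
    by (rule sum.swap)
  finally show ?thesis .
qed

section \<open>Completeness of the vector spherical harmonics\<close>

text \<open>Only the values on the sphere matter, and the combination has to be finite.\<close>

definition vspan :: "(real^3 \<Rightarrow> real^3) \<Rightarrow> bool" where
  "vspan g \<longleftrightarrow> (\<exists>m c. \<forall>s\<in>S2. g s = (\<Sum>k\<in>modes UNIV m. c k *\<^sub>R vharm k s))"

lemma modes_mono: "m \<le> m' \<Longrightarrow> modes B m \<subseteq> modes B m'"
  by (auto simp: modes_def)

lemma vspan_eventually:
  assumes "vspan g"
  shows "\<exists>m. \<forall>m'\<ge>m. \<exists>c. \<forall>s\<in>S2. g s = (\<Sum>k\<in>modes UNIV m'. c k *\<^sub>R vharm k s)"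
proof -
  obtain m c where c: "\<And>s. s \<in> S2 \<Longrightarrow> g s = (\<Sum>k\<in>modes UNIV m. c k *\<^sub>R vharm k s)"
    using assms by (auto simp: vspan_def)
  have "\<exists>c. \<forall>s\<in>S2. g s = (\<Sum>k\<in>modes UNIV m'. c k *\<^sub>R vharm k s)" if m': "m' \<ge> m" for m'
  proof (intro exI ballI)
    fix s assume s: "s \<in> S2"
    have "(\<Sum>k\<in>modes UNIV m'. (if k \<in> modes UNIV m then c k else 0) *\<^sub>R vharm k s)
        = (\<Sum>k\<in>modes UNIV m. (if k \<in> modes UNIV m then c k else 0) *\<^sub>R vharm k s)"
      by (rule sum.mono_neutral_right[OF finite_modes modes_mono[OF m']]) simp
    also have "\<dots> = (\<Sum>k\<in>modes UNIV m. c k *\<^sub>R vharm k s)" by (rule sum.cong) auto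
    finally show "g s = (\<Sum>k\<in>modes UNIV m'. (if k \<in> modes UNIV m then c k else 0) *\<^sub>R vharm k s)"
      using c[OF s] by simp
  qed
  then show ?thesis by blast
qed

lemma vspan_add:
  assumes "vspan f" "vspan g" shows "vspan (\<lambda>s. f s + g s)"
proof -
  obtain m n where m: "\<forall>m'\<ge>m. \<exists>c. \<forall>s\<in>S2. f s = (\<Sum>k\<in>modes UNIV m'. c k *\<^sub>R vharm k s)"
    and n: "\<forall>m'\<ge>n. \<exists>c. \<forall>s\<in>S2. g s = (\<Sum>k\<in>modes UNIV m'. c k *\<^sub>R vharm k s)"
    using vspan_eventually[OF assms(1)] vspan_eventually[OF assms(2)] by blast
  obtain c where c: "\<forall>s\<in>S2. f s = (\<Sum>k\<in>modes UNIV (max m n). c k *\<^sub>R vharm k s)" using m[rule_format, of "max m n"] by auto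
  obtain d where d: "\<forall>s\<in>S2. g s = (\<Sum>k\<in>modes UNIV (max m n). d k *\<^sub>R vharm k s)" using n[rule_format, of "max m n"] by auto
  have "\<forall>s\<in>S2. f s + g s = (\<Sum>k\<in>modes UNIV (max m n). (c k + d k) *\<^sub>R vharm k s)"
    using c d by (simp add: scaleR_add_left sum.distrib)
  then show ?thesis unfolding vspan_def by (intro exI[of _ "max m n"] exI[of _ "\<lambda>k. c k + d k"])
qed

lemma vspan_scale:
  assumes "vspan f" shows "vspan (\<lambda>s. a *\<^sub>R f s)"
proof -
  obtain m c where c: "\<forall>s\<in>S2. f s = (\<Sum>k\<in>modes UNIV m. c k *\<^sub>R vharm k s)"
    using assms by (auto simp: vspan_def)
  have "\<forall>s\<in>S2. a *\<^sub>R f s = (\<Sum>k\<in>modes UNIV m. (a * c k) *\<^sub>R vharm k s)"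
    using c by (simp add: scaleR_sum_right)
  then show ?thesis unfolding vspan_def by (intro exI[of _ m] exI[of _ "\<lambda>k. a * c k"])
qed

lemma vspan_cong: "vspan f \<Longrightarrow> (\<And>s. s \<in> S2 \<Longrightarrow> g s = f s) \<Longrightarrow> vspan g"
  unfolding vspan_def by simp

lemma vspan_0: "vspan (\<lambda>s. 0)"
  unfolding vspan_def by (intro exI[of _ 0] exI[of _ "\<lambda>_. 0"]) simp

lemma vspan_sum:
  "(\<And>i. i \<in> I \<Longrightarrow> vspan (f i)) \<Longrightarrow> vspan (\<lambda>s. \<Sum>i\<in>I. f i s)"
proof (induction I rule: infinite_finite_induct)
  case (insert i I)
  have "vspan (\<lambda>s. f i s + (\<Sum>i\<in>I. f i s))"
    by (rule vspan_add) (use insert in auto)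
  then show ?case using insert by simp
qed (simp_all add: vspan_0)

lemma vspan_vharm:
  assumes "k \<in> modes UNIV m" shows "vspan (vharm k)"
proof -
  have "(\<Sum>l\<in>modes UNIV m. (if l = k then 1 else 0) *\<^sub>R vharm l s) = vharm k s" for s
  proof -
    have "(\<Sum>l\<in>modes UNIV m. (if l = k then 1 else 0) *\<^sub>R vharm l s) = (\<Sum>l\<in>modes UNIV m. if l = k then vharm l s else 0)"
      by (rule sum.cong) auto
    then show ?thesis using assms by simp
  qed
  then show ?thesis unfolding vspan_def by (intro exI[of _ m] exI[of _ "\<lambda>l. if l = k then 1 else 0"]) simp
qed

lemma curl_field_sum:
  assumes "\<And>i. i \<in> I \<Longrightarrow> poly3 (Y i)"
  shows "curl_field (\<lambda>x. \<Sum>i\<in>I. c i * Y i x) s = (\<Sum>i\<in>I. c i *\<^sub>R curl_field (Y i) s)"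
  unfolding vec_eq_iff
proof
  fix j
  have "curl_field (\<lambda>x. \<Sum>i\<in>I. c i * Y i x) s $ j = Lop j (\<lambda>x. \<Sum>i\<in>I. c i * Y i x) s"
    using assms by (intro curl_field_nth) auto
  also have "\<dots> = (\<Sum>i\<in>I. Lop j (\<lambda>x. c i * Y i x) s)"
    using assms by (intro Lop_sum) auto
  also have "\<dots> = (\<Sum>i\<in>I. c i * Lop j (Y i) s)"
    by (rule sum.cong) (simp_all add: Lop_cmult assms)
  also have "\<dots> = (\<Sum>i\<in>I. c i *\<^sub>R curl_field (Y i) s) $ j"
    by (simp add: curl_field_nth assms)
  finally show "curl_field (\<lambda>x. \<Sum>i\<in>I. c i * Y i x) s $ j = (\<Sum>i\<in>I. c i *\<^sub>R curl_field (Y i) s) $ j" .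
qed

lemma grad_field_sum:
  assumes "\<And>i. i \<in> I \<Longrightarrow> poly3 (Y i)"
  shows "grad_field (\<lambda>x. \<Sum>i\<in>I. c i * Y i x) s = (\<Sum>i\<in>I. c i *\<^sub>R grad_field (Y i) s)"
proof -
  have "grad_field (\<lambda>x. \<Sum>i\<in>I. c i * Y i x) s = (\<Sum>i\<in>I. c i *\<^sub>R curl_field (Y i) s) \<times> s"
    unfolding grad_field_def using assms by (simp add: curl_field_sum)
  then show ?thesis
    by (simp add: bounded_bilinear.sum_left[OF bounded_bilinear_cross] cross_mult_left grad_field_def)
qed

lemma vspan_curl_grad_field:
  assumes h: "harm n h"
  shows "vspan (curl_field h)" and "vspan (grad_field h)"
proof -
  have "vspan (curl_field h) \<and> vspan (grad_field h)"
  proof (cases "n = 0")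
    case True
    then have "pd i h = (\<lambda>x. 0)" for i using h by (simp add: harm_def homog_0_dird)
    then have "gradient h s = 0" for s by (simp add: gradient_def vec_eq_iff)
    then have "curl_field h = (\<lambda>s. 0)" "grad_field h = (\<lambda>s. 0)"
      by (simp_all add: fun_eq_iff curl_field_def grad_field_def)
    then show ?thesis by (simp add: vspan_0)
  next
    case False
    define c where "c i = L2_inner_S2 h (sphharm n i)" for i
    have hc: "h = (\<lambda>x. \<Sum>i<hdim n. c i * sphharm n i x)"
      unfolding c_def by (rule sphharm_expansion[OF h])
    have p: "poly3 (sphharm n i)" if "i \<in> {..<hdim n}" for i
      using harm_sphharm harm_poly3 that by auto
    define r where "r = sqrt (real n * (real n + 1))"
    have r: "r > 0" using False by (simp add: r_def)
    have v: "curl_field (sphharm n i) s = r *\<^sub>R vharm (n, i, True) s" "grad_field (sphharm n i) s = r *\<^sub>R vharm (n, i, False) s" for i s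
      using r by (simp_all add: vharm_def r_def[symmetric])
    have k: "vspan (vharm (n, i, b))" if "i \<in> {..<hdim n}" for i b
      using that False by (intro vspan_vharm[of _ n]) (auto simp: modes_def)
    have "curl_field h = (\<lambda>s. \<Sum>i<hdim n. c i *\<^sub>R (r *\<^sub>R vharm (n, i, True) s))"
      by (subst hc) (simp only: fun_eq_iff curl_field_sum[OF p] v simp_thms)
    moreover have "grad_field h = (\<lambda>s. \<Sum>i<hdim n. c i *\<^sub>R (r *\<^sub>R vharm (n, i, False) s))"
      by (subst hc) (simp only: fun_eq_iff grad_field_sum[OF p] v simp_thms)
    ultimately show ?thesis
      by (simp only:) (intro conjI vspan_sum vspan_scale k)
  qed
  then show "vspan (curl_field h)" "vspan (grad_field h)" by auto
qed

text \<open>Functions that agree on the sphere with a finite sum of harmonics.\<close>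

inductive hspan :: "(real^3 \<Rightarrow> real) \<Rightarrow> bool" where
  hspan_harm: "harm n h \<Longrightarrow> (\<And>s. s \<in> S2 \<Longrightarrow> f s = h s) \<Longrightarrow> hspan f"
| hspan_add: "hspan f \<Longrightarrow> hspan g \<Longrightarrow> hspan (\<lambda>x. f x + g x)"

text \<open>In the case of a sum, the difference between \<open>g\<close> and the first summand agrees with the second one on the
sphere.\<close>

lemma hspan_cong: "hspan f \<Longrightarrow> (\<And>s. s \<in> S2 \<Longrightarrow> g s = f s) \<Longrightarrow> hspan g"
proof (induction arbitrary: g rule: hspan.induct)
  case (hspan_harm n h f)
  then show ?case by (intro hspan.hspan_harm[of n h]) auto
next
  case (hspan_add f1 f2)
  have "hspan (\<lambda>x. g x - f1 x)" by (rule hspan_add.IH(2)) (use hspan_add.prems in auto)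
  from hspan.hspan_add[OF hspan_add.hyps(1) this] show ?case by simp
qed

lemma hspan_scale: "hspan f \<Longrightarrow> hspan (\<lambda>x. c * f x)"
proof (induction rule: hspan.induct)
  case (hspan_harm n h f)
  show ?case by (rule hspan.hspan_harm[OF harm_scale[OF hspan_harm(1)]]) (use hspan_harm(2) in auto)
next
  case (hspan_add f g)
  then show ?case using hspan.hspan_add[of "\<lambda>x. c * f x" "\<lambda>x. c * g x"] by (simp add: distrib_left)
qed

lemma hspan_coord: "hspan f \<Longrightarrow> hspan (\<lambda>x. x$i * f x)"
proof (induction rule: hspan.induct)
  case (hspan_harm n h f)
  have "hspan (\<lambda>x. pd i h x / (2 * n + 1))"
  proof (cases n)
    case 0
    then have "pd i h = (\<lambda>x. 0)" using hspan_harm by (simp add: harm_def homog_0_dird)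
    then show ?thesis by (intro hspan.hspan_harm[OF harm_0[of 0]]) simp
  next
    case (Suc m)
    then have "harm m (pd i h)" using hspan_harm by (intro harm_dird) simp
    from harm_scale[OF this, of "1 / (2 * n + 1)"] show ?thesis
      by (intro hspan.hspan_harm) auto
  qed
  moreover have "hspan (\<lambda>x. x$i * h x - rsq x * (pd i h x / (2 * n + 1)))"
    by (rule hspan.hspan_harm[OF harm_coord[OF hspan_harm(1)]]) simp
  ultimately have "hspan (\<lambda>x. (x$i * h x - rsq x * (pd i h x / (2 * n + 1))) + pd i h x / (2 * n + 1))"
    by (intro hspan.hspan_add)
  then show ?case by (rule hspan_cong) (use hspan_harm(2) rsq_S2 in simp)
next
  case (hspan_add f g)
  then show ?case using hspan.hspan_add[of "\<lambda>x. x$i * f x" "\<lambda>x. x$i * g x"] by (simp add: distrib_left)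
qed

lemma hspan_poly3_mult: "poly3 p \<Longrightarrow> hspan f \<Longrightarrow> hspan (\<lambda>x. p x * f x)"
proof (induction arbitrary: f rule: real_polynomial_function.induct)
  case (linear p)
  have lin: "linear p" using linear(1) by (rule bounded_linear.linear)
  have *: "hspan (\<lambda>x. (p (axis 1 1) * (x$1 * f x) + p (axis 2 1) * (x$2 * f x)) + p (axis 3 1) * (x$3 * f x))"
    by (intro hspan.hspan_add hspan_scale hspan_coord linear(2))
  have px: "p x = x$1 * p (axis 1 1) + x$2 * p (axis 2 1) + x$3 * p (axis 3 1)" for x
    using linear_expand_3[OF lin, of x] by (simp only: real_scaleR_def)
  have "p x * f x = p (axis 1 1) * (x$1 * f x) + p (axis 2 1) * (x$2 * f x) + p (axis 3 1) * (x$3 * f x)" for x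
    by (subst px) (simp add: algebra_simps)
  then show ?case by (rule hspan_cong[OF *])
next
  case (const c)
  then show ?case by (rule hspan_scale)
next
  case (add p q)
  have "hspan (\<lambda>x. p x * f x + q x * f x)"
    by (rule hspan.hspan_add[OF add.IH(1)[OF add.prems] add.IH(2)[OF add.prems]])
  then show ?case by (simp only: distrib_right)
next
  case (mult p q)
  show ?case using mult.IH(1)[OF mult.IH(2)[OF mult.prems]] by (simp only: mult.assoc)
qed

lemma hspan_poly3:
  assumes "poly3 p" shows "hspan p"
proof -
  have "harm 0 (\<lambda>x. 1)" by (simp add: harm_def homog_def lap_def)
  then have "hspan (\<lambda>x. 1)" by (rule hspan.hspan_harm) simp
  from hspan_poly3_mult[OF assms this] show ?thesis by simp
qed

text \<open>The three components of the next lemma for the first axis, as identities between the numbers \<open>h\<^sub>i\<close>, \<open>h\<^sub>i\<^sub>j\<close> that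
stand for the first and second derivatives. Apart from \<open>|s| = 1\<close> only the Laplace equation and Euler's identities enter, for
\<open>h\<close> in degree \<open>n\<close> and for its derivatives in degree \<open>n - 1\<close>. The other axes follow by cyclic permutation.\<close>

lemma second_derivative_identity:
  fixes s1 s2 s3 h h1 h2 h3 h11 h12 h13 h22 h23 h33 n :: real
  assumes r: "s1 * s1 + s2 * s2 + s3 * s3 = 1"
    and e: "s1 * h1 + s2 * h2 + s3 * h3 = n * h"
    and e1: "s1 * h11 + s2 * h12 + s3 * h13 = (n - 1) * h1"
    and e2: "s1 * h12 + s2 * h22 + s3 * h23 = (n - 1) * h2"
    and e3: "s1 * h13 + s2 * h23 + s3 * h33 = (n - 1) * h3"
    and l: "h11 + h22 + h33 = 0"
  shows "n * n * (h - h * s1 * s1) = n * s1 * (h1 - n * h * s1) - (h11 - (n - 1) * h1 * s1)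
      - (s2 * (- h2 + s2 * h33 - s3 * h23) - s3 * (h3 + s2 * h23 - s3 * h22))" (is ?C1)
    and "n * n * (0 - h * s1 * s2) = n * s1 * (h2 - n * h * s2) - (h12 - (n - 1) * h1 * s2)
      - (s3 * (s2 * h13 - s3 * h12) - s1 * (- h2 + s2 * h33 - s3 * h23))" (is ?C2)
    and "n * n * (0 - h * s1 * s3) = n * s1 * (h3 - n * h * s3) - (h13 - (n - 1) * h1 * s3)
      - (s1 * (h3 + s2 * h23 - s3 * h22) - s2 * (s2 * h13 - s3 * h12))" (is ?C3)
proof -
  define E1 E2 E3 E R where "E1 = (n - 1) * h1 - (s1 * h11 + s2 * h12 + s3 * h13)"
    and "E2 = (n - 1) * h2 - (s1 * h12 + s2 * h22 + s3 * h23)"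
    and "E3 = (n - 1) * h3 - (s1 * h13 + s2 * h23 + s3 * h33)"
    and "E = s1 * h1 + s2 * h2 + s3 * h3 - n * h"
    and "R = s1 * s1 + s2 * s2 + s3 * s3 - 1"
  define L where "L = h11 + h22 + h33"
  have z: "E1 = 0" "E2 = 0" "E3 = 0" "E = 0" "R = 0" "L = 0"
    using assms by (simp_all add: E1_def E2_def E3_def E_def R_def L_def)
  have "n * s1 * (h2 - n * h * s2) - (h12 - (n - 1) * h1 * s2)
      - (s3 * (s2 * h13 - s3 * h12) - s1 * (- h2 + s2 * h33 - s3 * h23)) - n * n * (0 - h * s1 * s2)
    = s1 * E2 + s2 * E1 + h12 * R + s1 * s2 * L"
    unfolding E1_def E2_def R_def L_def by (simp add: algebra_simps)
  then show ?C2
    unfolding z by simp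
  have "n * s1 * (h3 - n * h * s3) - (h13 - (n - 1) * h1 * s3)
      - (s1 * (h3 + s2 * h23 - s3 * h22) - s2 * (s2 * h13 - s3 * h12)) - n * n * (0 - h * s1 * s3)
    = s1 * E3 + s3 * E1 + h13 * R + s1 * s3 * L"
    unfolding E1_def E3_def R_def L_def by (simp add: algebra_simps)
  then show ?C3
    unfolding z by simp
  have "n * s1 * (h1 - n * h * s1) - (h11 - (n - 1) * h1 * s1)
      - (s2 * (- h2 + s2 * h33 - s3 * h23) - s3 * (h3 + s2 * h23 - s3 * h22)) - n * n * (h - h * s1 * s1)
    = n * E + s1 * E1 - s2 * E2 - s3 * E3 + h11 * R - (s2 * s2 + s3 * s3) * L"
    unfolding E1_def E2_def E3_def E_def R_def L_def by (simp add: algebra_simps)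
  then show ?C1
    unfolding z by simp
qed

lemma gradient_components: "gradient f s $ i = pd i f s"
  by (simp add: gradient_def)

text \<open>Together with \<open>grad_field_coord_harm\<close>, which eliminates the term with \<open>s\<^sub>i \<nabla>h\<close>, this expresses the tangential
part of \<open>h e\<^sub>i\<close> by gradient and curl fields of harmonics. It mirrors the splitting of the vector fields with harmonic components of
degree \<open>n\<close> into harmonics of degrees \<open>n + 1\<close>, \<open>n\<close> and \<open>n - 1\<close>.\<close>

lemma tangent_proj_axis_harm:
  assumes h: "harm n h" and s: "s \<in> S2"
  shows "(real n * real n) *\<^sub>R tangent_proj s (h s *\<^sub>R axis i 1)
    = (real n * s$i) *\<^sub>R tangent_proj s (gradient h s) - grad_field (pd i h) s - curl_field (Lop i h) s"
proof -
  have p: "poly3 h" "homog n h" and l: "lap h x = 0" for x using h by (simp_all add: harm_def)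
  note c = dird_commute[OF p(1), of "axis 2 1" "axis 1 1"] dird_commute[OF p(1), of "axis 3 1" "axis 1 1"]
    dird_commute[OF p(1), of "axis 3 1" "axis 2 1"]
  have r: "s$1 * s$1 + s$2 * s$2 + s$3 * s$3 = 1" using s by (rule rsq_S2)
  have e: "x$1 * pd 1 h x + x$2 * pd 2 h x + x$3 * pd 3 h x = real n * h x" for x
    by (rule euler_homog[OF p])
  have "pd i (\<lambda>x. x$1 * pd 1 h x + x$2 * pd 2 h x + x$3 * pd 3 h x) s = n * pd i h s" for i
    unfolding e using p by simp
  from this[of 1] this[of 2] this[of 3]
  have e1: "s$1 * pd 1 (pd 1 h) s + s$2 * pd 1 (pd 2 h) s + s$3 * pd 1 (pd 3 h) s = (real n - 1) * pd 1 h s"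
    and e2: "s$1 * pd 1 (pd 2 h) s + s$2 * pd 2 (pd 2 h) s + s$3 * pd 2 (pd 3 h) s = (real n - 1) * pd 2 h s"
    and e3: "s$1 * pd 1 (pd 3 h) s + s$2 * pd 2 (pd 3 h) s + s$3 * pd 3 (pd 3 h) s = (real n - 1) * pd 3 h s"
    using p by (simp_all add: axis1_nth c algebra_simps)
  have l': "pd 1 (pd 1 h) s + pd 2 (pd 2 h) s + pd 3 (pd 3 h) s = 0" using l[of s] by (simp add: lap_def)
  note id1 = second_derivative_identity[OF r e e1 e2 e3 l']
  have id2: "s$2 * s$2 + s$3 * s$3 + s$1 * s$1 = 1" "s$2 * pd 2 h s + s$3 * pd 3 h s + s$1 * pd 1 h s = real n * h s"
    "s$2 * pd 2 (pd 2 h) s + s$3 * pd 2 (pd 3 h) s + s$1 * pd 1 (pd 2 h) s = (real n - 1) * pd 2 h s"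
    "s$2 * pd 2 (pd 3 h) s + s$3 * pd 3 (pd 3 h) s + s$1 * pd 1 (pd 3 h) s = (real n - 1) * pd 3 h s"
    "s$2 * pd 1 (pd 2 h) s + s$3 * pd 1 (pd 3 h) s + s$1 * pd 1 (pd 1 h) s = (real n - 1) * pd 1 h s"
    "pd 2 (pd 2 h) s + pd 3 (pd 3 h) s + pd 1 (pd 1 h) s = 0"
    using r e[of s] e1 e2 e3 l' by linarith+
  note id2 = second_derivative_identity[OF id2]
  have id3: "s$3 * s$3 + s$1 * s$1 + s$2 * s$2 = 1" "s$3 * pd 3 h s + s$1 * pd 1 h s + s$2 * pd 2 h s = real n * h s"
    "s$3 * pd 3 (pd 3 h) s + s$1 * pd 1 (pd 3 h) s + s$2 * pd 2 (pd 3 h) s = (real n - 1) * pd 3 h s"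
    "s$3 * pd 1 (pd 3 h) s + s$1 * pd 1 (pd 1 h) s + s$2 * pd 1 (pd 2 h) s = (real n - 1) * pd 1 h s"
    "s$3 * pd 2 (pd 3 h) s + s$1 * pd 1 (pd 2 h) s + s$2 * pd 2 (pd 2 h) s = (real n - 1) * pd 2 h s"
    "pd 3 (pd 3 h) s + pd 1 (pd 1 h) s + pd 2 (pd 2 h) s = 0"
    using r e[of s] e1 e2 e3 l' by linarith+
  note id3 = second_derivative_identity[OF id3]
  have tp: "tangent_proj s v $ j = v$j - (v \<bullet> s) * s$j" for v j by (simp add: tangent_proj_def)
  have gs: "gradient h s \<bullet> s = real n * h s"
    using e[of s] by (simp add: inner_vec_def sum_3 gradient_components mult.commute)
  have gs': "gradient (pd 1 h) s \<bullet> s = (real n - 1) * pd 1 h s" "gradient (pd 2 h) s \<bullet> s = (real n - 1) * pd 2 h s"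
    "gradient (pd 3 h) s \<bullet> s = (real n - 1) * pd 3 h s"
    using e1 e2 e3 by (simp_all only: inner_vec_def sum_3 gradient_components c inner_real_def mult.commute)
  have as: "(h s *\<^sub>R axis i 1) \<bullet> s = h s * s$i" for i by (simp add: inner_axis')
  have L: "pd 1 (Lop 1 h) s = s$2 * pd 1 (pd 3 h) s - s$3 * pd 1 (pd 2 h) s"
    "pd 2 (Lop 1 h) s = pd 3 h s + s$2 * pd 2 (pd 3 h) s - s$3 * pd 2 (pd 2 h) s"
    "pd 3 (Lop 1 h) s = - pd 2 h s + s$2 * pd 3 (pd 3 h) s - s$3 * pd 2 (pd 3 h) s"
    "pd 2 (Lop 2 h) s = s$3 * pd 1 (pd 2 h) s - s$1 * pd 2 (pd 3 h) s"
    "pd 3 (Lop 2 h) s = pd 1 h s + s$3 * pd 1 (pd 3 h) s - s$1 * pd 3 (pd 3 h) s"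
    "pd 1 (Lop 2 h) s = - pd 3 h s + s$3 * pd 1 (pd 1 h) s - s$1 * pd 1 (pd 3 h) s"
    "pd 3 (Lop 3 h) s = s$1 * pd 2 (pd 3 h) s - s$2 * pd 1 (pd 3 h) s"
    "pd 1 (Lop 3 h) s = pd 2 h s + s$1 * pd 1 (pd 2 h) s - s$2 * pd 1 (pd 1 h) s"
    "pd 2 (Lop 3 h) s = - pd 1 h s + s$1 * pd 2 (pd 2 h) s - s$2 * pd 1 (pd 2 h) s"
    using p by (simp_all add: Lop_eq axis1_nth c)
  note unf = vec_eq_iff forall_3 grad_field_eq[OF s] curl_field_def vector_minus_component vector_scaleR_component
    tp gs gs' as cross_components gradient_components L c real_scaleR_def axis1_nth
  have "(real n * real n) *\<^sub>R tangent_proj s (h s *\<^sub>R axis 1 1)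
    = (real n * s$1) *\<^sub>R tangent_proj s (gradient h s) - grad_field (pd 1 h) s - curl_field (Lop 1 h) s"
    unfolding unf using id1 by (simp add: mult_ac)
  moreover have "(real n * real n) *\<^sub>R tangent_proj s (h s *\<^sub>R axis 2 1)
    = (real n * s$2) *\<^sub>R tangent_proj s (gradient h s) - grad_field (pd 2 h) s - curl_field (Lop 2 h) s"
    unfolding unf using id2 by (simp add: mult_ac)
  moreover have "(real n * real n) *\<^sub>R tangent_proj s (h s *\<^sub>R axis 3 1)
    = (real n * s$3) *\<^sub>R tangent_proj s (gradient h s) - grad_field (pd 3 h) s - curl_field (Lop 3 h) s"
    unfolding unf using id3 by (simp add: mult_ac)
  ultimately show ?thesis using exhaust_3[of i] by blast
qed

lemma grad_field_coord_harm:
  assumes h: "harm n h" and s: "s \<in> S2"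
  shows "grad_field (\<lambda>x. x$i * h x - rsq x * (pd i h x / (2 * n + 1))) s
    = tangent_proj s (h s *\<^sub>R axis i 1) + s$i *\<^sub>R tangent_proj s (gradient h s) - (1 / (2 * real n + 1)) *\<^sub>R grad_field (pd i h) s"
proof -
  have p: "poly3 h" "poly3 (pd i h)" using harm_poly3[OF h] by auto
  let ?q = "pd i h s / (2 * real n + 1)"
  have r: "s$1 * s$1 + s$2 * s$2 + s$3 * s$3 = 1" using s by (rule rsq_S2)
  have "gradient (\<lambda>x. x$i * h x - rsq x * (pd i h x / (2 * n + 1))) s
    = h s *\<^sub>R axis i 1 + s$i *\<^sub>R gradient h s - (1 / (2 * real n + 1)) *\<^sub>R gradient (pd i h) s - (2 * ?q) *\<^sub>R s"
    unfolding vec_eq_iff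
  proof
    fix j :: 3
    have "pd j (\<lambda>x. x$i * h x - rsq x * (pd i h x / (2 * n + 1))) s
      = (axis j 1 $ i * h s + s$i * pd j h s) - (rsq s * (pd j (pd i h) s / (2 * real n + 1))
         + 2 * (axis j 1 $ 1 * s$1 + axis j 1 $ 2 * s$2 + axis j 1 $ 3 * s$3) * ?q)"
      using p by (simp add: add_ac) (simp add: algebra_simps add_divide_distrib)
    also have "axis j 1 $ 1 * s$1 + axis j 1 $ 2 * s$2 + axis j 1 $ 3 * s$3 = s$j"
      using exhaust_3[of j] by (auto simp: axis1_nth)
    also have "axis j 1 $ i = axis i (1::real) $ j" by (simp add: axis1_nth)
    finally show "gradient (\<lambda>x. x$i * h x - rsq x * (pd i h x / (2 * n + 1))) s $ j
      = (h s *\<^sub>R axis i 1 + s$i *\<^sub>R gradient h s - (1 / (2 * real n + 1)) *\<^sub>R gradient (pd i h) s - (2 * ?q) *\<^sub>R s) $ j"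
      using r by (simp add: gradient_components mult.commute)
  qed
  moreover have "tangent_proj s (a - b) = tangent_proj s a - tangent_proj s b" "tangent_proj s (a + b) = tangent_proj s a + tangent_proj s b" "tangent_proj s (c *\<^sub>R a) = c *\<^sub>R tangent_proj s a" for a b c
    by (simp_all add: tangent_proj_def inner_diff_left inner_add_left algebra_simps)
  moreover have "tangent_proj s s = 0" using s by (simp add: tangent_proj_def norm_eq_1)
  ultimately show ?thesis
    using s by (simp add: grad_field_eq)
qed

lemma tangent_proj_add: "tangent_proj s (a + b) = tangent_proj s a + tangent_proj s b"
  by (simp add: tangent_proj_def inner_add_left algebra_simps)

lemma tangent_proj_diff: "tangent_proj s (a - b) = tangent_proj s a - tangent_proj s b"
  by (simp add: tangent_proj_def inner_diff_left algebra_simps)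

text \<open>In degree \<open>n \<ge> 1\<close> the identities \<open>tangent_proj_axis_harm\<close> and \<open>grad_field_coord_harm\<close> combine to
\<open>(n\<^sup>2 + n) P(h e\<^sub>i) = n \<nabla>w + (n / (2 n + 1) - 1) \<nabla>(\<partial>\<^sub>i h) - s \<times> \<nabla>(L\<^sub>i h)\<close>, where \<open>w\<close> is the harmonic part of
\<open>x\<^sub>i h\<close> and \<open>P\<close> and the outer \<open>\<nabla>\<close> denote the tangential projection and gradient.\<close>

lemma vspan_tangent_proj_harm:
  assumes h: "harm n h" shows "vspan (\<lambda>s. tangent_proj s (h s *\<^sub>R axis i 1))"
proof (cases n)
  case 0
  then have c: "h = (\<lambda>x. h 0)" using h by (intro homog_0_const) (simp add: harm_def)
  have "harm 1 (\<lambda>x. x$i)" by (simp add: harm_def homog_def lap_def)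
  then have "vspan (grad_field (\<lambda>x. h 0 * x$i))" by (intro vspan_curl_grad_field(2) harm_scale)
  moreover have "gradient (\<lambda>x. h 0 * x$i) s = h s *\<^sub>R axis i 1" for s
    unfolding vec_eq_iff by (subst c) (auto simp: gradient_components axis1_nth)
  ultimately show ?thesis by (elim vspan_cong) (simp add: grad_field_eq)
next
  case (Suc m)
  define w where "w x = x$i * h x - rsq x * (pd i h x / (2 * n + 1))" for x
  define N where "N = real n"
  have N: "N > 0" using Suc by (simp add: N_def)
  have hp: "harm m (pd i h)" using h Suc by (intro harm_dird) simp
  have v: "vspan (\<lambda>s. (1 / (N * N + N)) *\<^sub>R (N *\<^sub>R grad_field w s + ((N / (2 * N + 1) - 1) *\<^sub>R grad_field (pd i h) s + (- 1) *\<^sub>R curl_field (Lop i h) s)))"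
    unfolding w_def
    by (intro vspan_scale vspan_add vspan_curl_grad_field(2)[OF harm_coord[OF h]] vspan_curl_grad_field(2)[OF hp]
        vspan_curl_grad_field(1)[OF harm_Lop[OF h]])
  show ?thesis
  proof (rule vspan_cong[OF v])
    fix s assume s: "s \<in> S2"
    let ?P = "tangent_proj s (h s *\<^sub>R axis i 1)" and ?E = "grad_field (pd i h) s" and ?X = "tangent_proj s (gradient h s)"
    have A: "(N * N) *\<^sub>R ?P = (N * s$i) *\<^sub>R ?X - ?E - curl_field (Lop i h) s"
      using tangent_proj_axis_harm[OF h s, of i] by (simp add: N_def)
    have B: "grad_field w s = ?P + s$i *\<^sub>R ?X - (1 / (2 * N + 1)) *\<^sub>R ?E"
      unfolding w_def N_def by (rule grad_field_coord_harm[OF h s])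
    have "N *\<^sub>R grad_field w s + ((N / (2 * N + 1) - 1) *\<^sub>R ?E + (- 1) *\<^sub>R curl_field (Lop i h) s)
        = N *\<^sub>R ?P + ((N * s$i) *\<^sub>R ?X - ?E - curl_field (Lop i h) s)"
      unfolding B by (simp add: scaleR_add_right scaleR_diff_right scaleR_diff_left)
    also have "\<dots> = (N * N + N) *\<^sub>R ?P" unfolding A[symmetric] by (simp add: scaleR_add_left)
    finally show "?P = (1 / (N * N + N)) *\<^sub>R (N *\<^sub>R grad_field w s + ((N / (2 * N + 1) - 1) *\<^sub>R ?E + (- 1) *\<^sub>R curl_field (Lop i h) s))"
      using N by (simp add: add_pos_pos less_imp_neq[OF add_pos_pos, symmetric])
  qed
qed

lemma vspan_tangent_proj_hspan:
  "hspan f \<Longrightarrow> vspan (\<lambda>s. tangent_proj s (f s *\<^sub>R axis i 1))"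
proof (induction rule: hspan.induct)
  case (hspan_harm n h f)
  show ?case by (rule vspan_cong[OF vspan_tangent_proj_harm[OF hspan_harm(1), of i]]) (simp add: hspan_harm(2))
next
  case (hspan_add f g)
  show ?case using vspan_add[OF hspan_add.IH] by (simp add: scaleR_add_left tangent_proj_add)
qed

lemma vspan_tangent_proj_polynomial:
  assumes "polynomial_function p"
  shows "vspan (\<lambda>s. tangent_proj s (p s))"
proof -
  have c: "hspan (\<lambda>s. p s $ i)" for i
    using assms bounded_linear_vec_nth[of i] unfolding polynomial_function_def o_def by (intro hspan_poly3) blast
  have "vspan (\<lambda>s. (tangent_proj s (p s $ 1 *\<^sub>R axis 1 1) + tangent_proj s (p s $ 2 *\<^sub>R axis 2 1)) + tangent_proj s (p s $ 3 *\<^sub>R axis 3 1))"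
    by (intro vspan_add vspan_tangent_proj_hspan c)
  moreover have "p s = p s $ 1 *\<^sub>R axis 1 1 + p s $ 2 *\<^sub>R axis 2 1 + p s $ 3 *\<^sub>R axis 3 1" for s
    by (simp add: vec_eq_iff forall_3 axis_def)
  ultimately show ?thesis
    unfolding tangent_proj_add[symmetric] by simp
qed

lemma continuous_tangent_proj:
  "continuous_on S p \<Longrightarrow> continuous_on S (\<lambda>s. tangent_proj s (p s))"
  unfolding tangent_proj_def by (intro continuous_intros)

lemma norm_tangent_proj_le:
  assumes "s \<in> S2" shows "norm (tangent_proj s v) \<le> norm v"
proof (rule power2_le_imp_le)
  have "(norm (tangent_proj s v))\<^sup>2 = (norm v)\<^sup>2 - (v \<bullet> s)\<^sup>2"
  proof -
    have "s \<bullet> s = 1" using assms by (simp add: norm_eq_1)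
    then show ?thesis
      unfolding power2_norm_eq_inner tangent_proj_def
      by (simp add: inner_diff_left inner_diff_right inner_commute power2_eq_square)
  qed
  then show "(norm (tangent_proj s v))\<^sup>2 \<le> (norm v)\<^sup>2" by simp
qed simp

lemma L2_norm_bound:
  fixes f :: "real^3 \<Rightarrow> real^3"
  assumes f: "continuous_on S2 f" and le: "\<And>s. s \<in> S2 \<Longrightarrow> norm (f s) \<le> d" and d: "d \<ge> 0"
  shows "L2_norm_S2 f \<le> d * sqrt (4 * pi)"
proof -
  have "(\<integral>s. (norm (f s))\<^sup>2 \<partial>dS) \<le> (\<integral>s. d\<^sup>2 \<partial>dS)"
    using continuous_square_integrable[OF f]
    by (intro integral_mono) (auto simp: square_integrable_def intro!: power_mono le)
  also have "\<dots> = 4 * pi * d\<^sup>2" by (simp add: measure_S2)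
  finally have "L2_norm_S2 f \<le> sqrt (4 * pi * d\<^sup>2)" by (simp add: L2_norm_S2_def)
  then show ?thesis using d by (simp add: real_sqrt_mult mult.commute)
qed

text \<open>By definition \<open>u\<close> is an \<open>L\<^sup>2\<close> limit of smooth tangent fields. These are uniform limits of polynomial fields
(Stone--Weierstrass), and projecting the polynomial field to the tangent spaces brings it no farther from a tangent field.\<close>

lemma vspan_dense_in_H1:
  assumes u: "u \<in> H1_TS2" and e: "0 < e"
  shows "\<exists>g. vspan g \<and> square_integrable g \<and> L2_norm_S2 (\<lambda>s. u s - g s) < e"
proof -
  from u obtain \<phi> where sq: "square_integrable u" and \<phi>: "\<And>n::nat. smooth_tangent_field (\<phi> n)"
    and l: "(\<lambda>n. L2_norm_S2 (\<lambda>s. \<phi> n s - u s)) \<longlonglongrightarrow> 0"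
    by (auto simp: H1_TS2_def has_cov_deriv_def)
  obtain n where n: "L2_norm_S2 (\<lambda>s. \<phi> n s - u s) < e / 2"
    using order_tendstoD(2)[OF l, of "e / 2"] e by (auto simp: eventually_sequentially)
  have sm: "smooth (\<phi> n)" using \<phi> by (simp add: smooth_tangent_field_def)
  \<comment> \<open>A uniform error of \<open>d\<close> is an \<open>L\<^sup>2\<close> error of at most \<open>e / 4\<close>, because the sphere has area \<open>4 \<pi>\<close>.\<close>
  define d where "d = e / (4 * sqrt (4 * pi))"
  have d: "d > 0" using e by (simp add: d_def)
  obtain p where p: "polynomial_function p" "\<And>s. s \<in> S2 \<Longrightarrow> norm (\<phi> n s - p s) < d"
    using Stone_Weierstrass_polynomial_function[OF compact_sphere smooth_continuous[OF sm] d, of 0 1] by blast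
  let ?g = "\<lambda>s. tangent_proj s (p s)"
  have cg: "continuous_on S2 ?g"
    by (intro continuous_tangent_proj continuous_on_polymonial_function p)
  have le: "norm (\<phi> n s - ?g s) \<le> d" if s: "s \<in> S2" for s
  proof -
    have "\<phi> n s \<bullet> s = 0" using \<phi> s by (auto simp: smooth_tangent_field_def tangent_field_def)
    then have "\<phi> n s - ?g s = tangent_proj s (\<phi> n s - p s)"
      by (simp add: tangent_proj_diff) (simp add: tangent_proj_def)
    then show ?thesis using norm_tangent_proj_le[OF s, of "\<phi> n s - p s"] p(2)[OF s] by simp
  qed
  have "L2_norm_S2 (\<lambda>s. \<phi> n s - ?g s) \<le> d * sqrt (4 * pi)"
    by (rule L2_norm_bound) (use le d in \<open>auto intro!: continuous_intros cg smooth_continuous[OF sm]\<close>)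
  also have "\<dots> = e / 4" by (simp add: d_def)
  finally have 1: "L2_norm_S2 (\<lambda>s. \<phi> n s - ?g s) \<le> e / 4" .
  have sg: "square_integrable ?g" "square_integrable (\<phi> n)"
    by (rule continuous_square_integrable[OF cg], rule continuous_square_integrable[OF smooth_continuous[OF sm]])
  have "L2_norm_S2 (\<lambda>s. u s - ?g s) = L2_norm_S2 (\<lambda>s. (\<phi> n s - ?g s) - (\<phi> n s - u s))" by simp
  also have "\<dots> \<le> L2_norm_S2 (\<lambda>s. \<phi> n s - ?g s) + L2_norm_S2 (\<lambda>s. \<phi> n s - u s)"
    by (intro L2_norm_triangle square_integrable_diff sg sq)
  finally have "L2_norm_S2 (\<lambda>s. u s - ?g s) < e" using 1 n e by linarith
  then show ?thesis using vspan_tangent_proj_polynomial[OF p(1)] sg(1) by blast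
qed

lemma H1_square_integrable: "u \<in> H1_TS2 \<Longrightarrow> square_integrable u"
  by (auto simp: H1_TS2_def has_cov_deriv_def)

text \<open>The partial sums increase, and by the best approximation property the defect is at most the squared
distance to any element of the span.\<close>

lemma parseval_H1:
  assumes u: "u \<in> H1_TS2"
  shows "(\<lambda>m. \<Sum>k\<in>modes UNIV m. (L2_inner_S2 u (vharm k))\<^sup>2) \<longlonglongrightarrow> L2_inner_S2 u u"
proof (rule LIMSEQ_I)
  fix r :: real assume r: "0 < r"
  have sq: "square_integrable u" using u by (rule H1_square_integrable)
  obtain g where g: "vspan g" "L2_norm_S2 (\<lambda>s. u s - g s) < sqrt r"
    using vspan_dense_in_H1[OF u, of "sqrt r"] r by auto
  obtain m0 where m0: "\<forall>m\<ge>m0. \<exists>c. \<forall>s\<in>S2. g s = (\<Sum>k\<in>modes UNIV m. c k *\<^sub>R vharm k s)"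
    using vspan_eventually[OF g(1)] by blast
  show "\<exists>no. \<forall>m\<ge>no. norm ((\<Sum>k\<in>modes UNIV m. (L2_inner_S2 u (vharm k))\<^sup>2) - L2_inner_S2 u u) < r"
  proof (intro exI[of _ m0] allI impI)
    fix m assume "m \<ge> m0"
    then obtain c where c: "\<And>s. s \<in> S2 \<Longrightarrow> g s = (\<Sum>k\<in>modes UNIV m. c k *\<^sub>R vharm k s)" using m0 by blast
    let ?b = "\<Sum>k\<in>modes UNIV m. (L2_inner_S2 u (vharm k))\<^sup>2"
    have "L2_inner_S2 u u - ?b \<le> L2_inner_S2 (\<lambda>s. u s - (\<Sum>k\<in>modes UNIV m. c k *\<^sub>R vharm k s)) (\<lambda>s. u s - (\<Sum>k\<in>modes UNIV m. c k *\<^sub>R vharm k s))"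
      by (rule best_approximation[OF finite_modes orthonormal_vharm sq])
    also have "\<dots> = L2_inner_S2 (\<lambda>s. u s - g s) (\<lambda>s. u s - g s)"
      by (rule L2_inner_cong) (simp add: c)
    also have "\<dots> = (L2_norm_S2 (\<lambda>s. u s - g s))\<^sup>2" by (simp add: L2_norm_sq)
    also have "\<dots> < (sqrt r)\<^sup>2" by (rule power_strict_mono[OF g(2)]) (simp_all add: L2_norm_nonneg)
    finally have "L2_inner_S2 u u - ?b < r" using r by simp
    moreover have "?b \<le> L2_inner_S2 u u" by (rule bessel_inequality[OF finite_modes orthonormal_vharm sq])
    ultimately show "norm (?b - L2_inner_S2 u u) < r" by simp
  qed
qed

section \<open>A sum over the spectrum\<close>

lemma arctan_lower: "0 \<le> z \<Longrightarrow> z / (1 + z\<^sup>2) \<le> arctan z" for z :: real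
proof (cases "z = 0")
  case False
  assume "0 \<le> z"
  with False have z: "0 < z" by simp
  obtain x where x: "0 < x" "x < z" "arctan z - arctan 0 = (z - 0) * inverse (1 + x\<^sup>2)"
    using MVT2[of 0 z arctan "\<lambda>x. inverse (1 + x\<^sup>2)"] z DERIV_arctan by auto
  have "z / (1 + z\<^sup>2) \<le> z / (1 + x\<^sup>2)"
    using x z by (intro divide_left_mono add_left_mono power_mono) (auto intro!: mult_pos_pos add_pos_nonneg)
  then show ?thesis using x(3) by (simp add: divide_inverse)
qed simp

lemma arctan_upper:
  fixes y :: real
  assumes "0 \<le> y" shows "y / (1 + y\<^sup>2) + arctan y \<le> pi / 2"
proof (cases "y = 0")
  case False
  with assms have y: "0 < y" by simp
  have "(1 / y) / (1 + (1 / y)\<^sup>2) = y / (1 + y\<^sup>2)"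
    using y by (simp add: power2_eq_square divide_simps)
  moreover have "arctan (1 / y) = pi / 2 - arctan y"
    using arctan_inverse[of y] y by (simp add: sgn_if inverse_eq_divide)
  moreover have "(1 / y) / (1 + (1 / y)\<^sup>2) \<le> arctan (1 / y)"
    using y by (intro arctan_lower) simp
  ultimately show ?thesis by linarith
qed simp

text \<open>With \<open>w = (t\<^sup>2 - 1/4) / a\<close> and \<open>e = 1 / a\<close>, the first term is the derivative of the summand of \<open>degree_sum_bound\<close> with
respect to \<open>t\<close>. It decreases at first and increases later; the decreasing function
\<open>17 / 3 / (1 + w\<^sup>2)\<^sup>4\<close> absorbs all of its decrease from \<open>t = 1\<close> on, that is, for \<open>w \<ge> 3 e / 4\<close>.\<close>

lemma concave_part_dominates:
  fixes e :: real
  assumes e: "0 < e" and w: "3 * e / 4 \<le> v" "v \<le> w"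
  shows "(2 - 14 * v\<^sup>2 - 4 * e * v) / (1 + v\<^sup>2) ^ 3 - 17 / 3 / (1 + v\<^sup>2) ^ 4
       \<le> (2 - 14 * w\<^sup>2 - 4 * e * w) / (1 + w\<^sup>2) ^ 3 - 17 / 3 / (1 + w\<^sup>2) ^ 4"
    (is "?F v \<le> ?F w")
proof (rule DERIV_nonneg_imp_nondecreasing[OF w(2)])
  fix x assume x: "v \<le> x" "x \<le> w"
  have x0: "3 * e / 4 \<le> x" "0 < x" using x w e by auto
  define p where "p = 1 + x\<^sup>2"
  have p: "p > 0" by (simp add: p_def add_pos_nonneg)
  have D1: "((\<lambda>x. (1 + x\<^sup>2) ^ k) has_real_derivative k * p ^ (k - 1) * (2 * x)) (at x)" for k
    unfolding p_def by (auto intro!: derivative_eq_intros)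
  have D0: "((\<lambda>x. 2 - 14 * x\<^sup>2 - 4 * e * x) has_real_derivative - 28 * x - 4 * e) (at x)"
    by (auto intro!: derivative_eq_intros)
  let ?N = "2 - 14 * x\<^sup>2 - 4 * e * x"
  have DF: "(?F has_real_derivative
      ((- 28 * x - 4 * e) * p ^ 3 - ?N * (3 * p ^ 2 * (2 * x))) / (p ^ 3 * p ^ 3)
      - (0 * p ^ 4 - 17 / 3 * (4 * p ^ 3 * (2 * x))) / (p ^ 4 * p ^ 4)) (at x)"
  proof (rule DERIV_diff)
    show "((\<lambda>x. (2 - 14 * x\<^sup>2 - 4 * e * x) / (1 + x\<^sup>2) ^ 3) has_real_derivative
      ((- 28 * x - 4 * e) * p ^ 3 - ?N * (3 * p ^ 2 * (2 * x))) / (p ^ 3 * p ^ 3)) (at x)"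
      using DERIV_divide[OF D0 D1[of 3]] p by (simp add: p_def)
    show "((\<lambda>x. 17 / 3 / (1 + x\<^sup>2) ^ 4) has_real_derivative
      (0 * p ^ 4 - 17 / 3 * (4 * p ^ 3 * (2 * x))) / (p ^ 4 * p ^ 4)) (at x)"
      using DERIV_divide[OF DERIV_const D1[of 4], of "17/3"] p by (simp add: p_def)
  qed
  have eq: "((- 28 * x - 4 * e) * p ^ 3 - ?N * (3 * p ^ 2 * (2 * x))) / (p ^ 3 * p ^ 3)
      - (0 * p ^ 4 - 17 / 3 * (4 * p ^ 3 * (2 * x))) / (p ^ 4 * p ^ 4)
    = (((- 28 * x - 4 * e) * p - ?N * (6 * x)) * p + 136 / 3 * x) / p ^ 5"
    using p by (simp add: divide_simps) (simp add: algebra_simps power_numeral_reduce)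
  have "((- 28 * x - 4 * e) * p - ?N * (6 * x)) * p + 136 / 3 * x
      = x * (56 * x ^ 4 + 16 * x ^ 2) + 4 * e * (5 * x ^ 4 + 4 * x ^ 2) + (16 / 3 * x - 4 * e)"
    unfolding p_def by (simp add: power2_eq_square power4_eq_xxxx algebra_simps)
  also have "\<dots> \<ge> 0" using x0 e by (intro add_nonneg_nonneg mult_nonneg_nonneg) auto
  finally have "0 \<le> (((- 28 * x - 4 * e) * p - ?N * (6 * x)) * p + 136 / 3 * x) / p ^ 5" using p by simp
  then show "\<exists>y. (?F has_real_derivative y) (at x) \<and> 0 \<le> y"
    using DF unfolding eq by blast
qed

text \<open>In the variable \<open>t = n + 1/2\<close> one has \<open>n (n + 1) = t\<^sup>2 - 1/4\<close>, and the sum is a midpoint sum for the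
integral of \<open>p(t) = 2 t / (1 + ((t\<^sup>2 - 1/4) / a)\<^sup>2)\<^sup>2\<close> over \<open>t \<ge> 1\<close>. If the derivative \<open>q\<close> of \<open>p\<close> is the sum of an
increasing function and a decreasing function \<open>Q\<close>, then each midpoint exceeds the integral over its interval by at most an
eighth of the decrease of \<open>Q\<close> there, so the total error is at most \<open>Q(1) / 8\<close>. This is at most the missing integral over
\<open>1/2 \<le> t \<le> 1\<close>, and the integral over all \<open>t \<ge> 1/2\<close> equals \<open>\<pi> a / 4\<close>.\<close>

lemma degree_sum_bound:
  fixes a :: real
  assumes a: "0 < a"
  shows "(\<Sum>n=1..m. (2 * real n + 1) / (1 + (real n * (real n + 1) / a)\<^sup>2)\<^sup>2) \<le> pi * a / 4"
proof -
  define e where "e = 1 / a"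
  have e: "e > 0" using a by (simp add: e_def)
  define w where "w t = (t\<^sup>2 - 1/4) * e" for t
  define p where "p t = 2 * t / (1 + (w t)\<^sup>2)\<^sup>2" for t
  define q where "q t = (2 - 14 * (w t)\<^sup>2 - 4 * e * w t) / (1 + (w t)\<^sup>2) ^ 3" for t
  define Q where "Q t = 17 / 3 / (1 + (w t)\<^sup>2) ^ 4" for t
  \<comment> \<open>An antiderivative of \<open>p\<close> that vanishes at \<open>t = 1/2\<close> and tends to \<open>\<pi> a / 4\<close>.\<close>
  define H where "H t = a / 2 * (w t / (1 + (w t)\<^sup>2) + arctan (w t))" for t
  have pos: "1 + x\<^sup>2 > 0" for x :: real by (simp add: add_pos_nonneg)
  have Dw: "(w has_real_derivative 2 * t * e) (at t)" for t
    unfolding w_def by (auto intro!: derivative_eq_intros)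
  have Dw2: "((\<lambda>t. 1 + (w t)\<^sup>2) has_real_derivative 2 * w t * (2 * t * e)) (at t)" for t
    by (auto intro!: derivative_eq_intros Dw)
  have DH: "(H has_real_derivative p t) (at t)" for t
  proof -
    have "(H has_real_derivative a / 2 * (((2 * t * e) * (1 + (w t)\<^sup>2) - w t * (2 * w t * (2 * t * e))) / ((1 + (w t)\<^sup>2) * (1 + (w t)\<^sup>2))
        + inverse (1 + (w t)\<^sup>2) * (2 * t * e))) (at t)"
      unfolding H_def
      by (intro DERIV_cmult DERIV_add DERIV_divide Dw Dw2 DERIV_chain2[OF DERIV_arctan]) (use pos[of "w t"] in auto)
    moreover have "a / 2 * (((2 * t * e) * (1 + (w t)\<^sup>2) - w t * (2 * w t * (2 * t * e))) / ((1 + (w t)\<^sup>2) * (1 + (w t)\<^sup>2))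
        + inverse (1 + (w t)\<^sup>2) * (2 * t * e)) = p t"
    proof -
      define r where "r = 1 + (w t)\<^sup>2"
      have r: "r > 0" "(w t)\<^sup>2 = r - 1" using pos by (simp_all add: r_def)
      have "a / 2 * (((2 * t * e) * r - w t * (2 * w t * (2 * t * e))) / (r * r) + inverse r * (2 * t * e))
         = (a * e) * t * ((r - 2 * (w t)\<^sup>2 + r) / (r * r))"
        using r(1) by (simp add: divide_simps power2_eq_square) (simp add: algebra_simps)
      also have "\<dots> = 2 * t / r\<^sup>2"
        unfolding r(2) using a r(1) by (simp add: e_def power2_eq_square)
      finally show ?thesis by (simp add: p_def r_def)
    qed
    ultimately show ?thesis by simp
  qed
  have Dp: "(p has_real_derivative q t) (at t)" for t
  proof -
    define r where "r = 1 + (w t)\<^sup>2"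
    have r: "r > 0" using pos by (simp add: r_def)
    have "((\<lambda>t. (1 + (w t)\<^sup>2)\<^sup>2) has_real_derivative 2 * (1 + (w t)\<^sup>2) * (2 * w t * (2 * t * e))) (at t)"
      by (rule DERIV_cong[OF DERIV_power[OF Dw2]]) (simp add: mult_ac)
    then have "(p has_real_derivative (2 * r\<^sup>2 - 2 * t * (2 * r * (2 * w t * (2 * t * e)))) / (r\<^sup>2 * r\<^sup>2)) (at t)"
      unfolding p_def r_def
      by (intro DERIV_divide) (use pos[of "w t"] in \<open>auto intro!: derivative_eq_intros\<close>)
    moreover have "(2 * r\<^sup>2 - 2 * t * (2 * r * (2 * w t * (2 * t * e)))) / (r\<^sup>2 * r\<^sup>2) = q t"
    proof -
      have "(2 * r\<^sup>2 - 2 * t * (2 * r * (2 * w t * (2 * t * e)))) / (r\<^sup>2 * r\<^sup>2)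
        = (2 * r - 16 * w t * (t\<^sup>2 * e)) / r ^ 3"
        using r by (simp add: divide_simps power2_eq_square power3_eq_cube) (simp add: algebra_simps)
      also have "t\<^sup>2 * e = w t + e / 4" by (simp add: w_def algebra_simps)
      also have "(2 * r - 16 * w t * (w t + e / 4)) / r ^ 3 = q t"
        unfolding q_def r_def by (simp add: power2_eq_square algebra_simps)
      finally show ?thesis .
    qed
    ultimately show ?thesis by simp
  qed
  have w_mono: "w s \<le> w t" if "0 \<le> s" "s \<le> t" for s t
    unfolding w_def using that e by (intro mult_right_mono diff_right_mono power_mono) auto
  have w1: "w 1 = 3 * e / 4" by (simp add: w_def)
  have qQ: "q s - q t \<le> Q s - Q t" if "1 \<le> s" "s \<le> t" for s t
    using concave_part_dominates[OF e, of "w s" "w t"] w_mono[of 1 s] w_mono[of s t] that w1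
    unfolding q_def Q_def by simp
  have Q_anti: "Q t \<le> Q s" if "1 \<le> s" "s \<le> t" for s t
  proof -
    have "0 \<le> w s" using w_mono[of 1 s] that w1 e by simp
    then have "(w s)\<^sup>2 \<le> (w t)\<^sup>2" using w_mono[of s t] that by (intro power_mono) auto
    then show ?thesis unfolding Q_def
      by (intro divide_left_mono power_mono) (auto intro!: mult_pos_pos zero_less_power pos)
  qed
  have step: "p t \<le> H (t + 1/2) - H (t - 1/2) + (Q (t - 1/2) - Q (t + 1/2)) / 8" if t: "3/2 \<le> t" for t
  proof -
    define D where "D = Q (t - 1/2) - Q (t + 1/2)"
    \<comment> \<open>The error of the midpoint rule on \<open>[t - s, t + s]\<close>, corrected by the decrease of \<open>Q\<close>; its derivative compares \<open>q\<close> on the two sides of \<open>t\<close>.\<close>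
    define f where "f s = H (t + s) - H (t - s) - 2 * s * p t + s\<^sup>2 / 2 * D" for s
    have "f 0 \<le> f (1/2)"
    proof (rule DERIV_nonneg_imp_nondecreasing[where f=f])
      show "(0::real) \<le> 1/2" by simp
      fix s :: real assume s: "0 \<le> s" "s \<le> 1/2"
      have "((\<lambda>s. H (t + s)) has_real_derivative p (t + s) * 1) (at s)"
        by (rule DERIV_chain2[OF DH]) (auto intro!: derivative_eq_intros)
      moreover have "((\<lambda>s. H (t - s)) has_real_derivative p (t - s) * (- 1)) (at s)"
        by (rule DERIV_chain2[OF DH]) (auto intro!: derivative_eq_intros)
      ultimately have "(f has_real_derivative (p (t + s) * 1 - p (t - s) * (- 1) - 2 * p t + s * D)) (at s)"
        unfolding f_def by (intro DERIV_add DERIV_diff) (auto intro!: derivative_eq_intros)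
      moreover have "0 \<le> p (t + s) * 1 - p (t - s) * (- 1) - 2 * p t + s * D"
      proof (cases "s = 0")
        case False
        then have s0: "0 < s" using s by simp
        obtain x where x: "t - s < x" "x < t" "p t - p (t - s) = (t - (t - s)) * q x"
          using MVT2[of "t - s" t p q] s0 Dp by auto
        obtain y where y: "t < y" "y < t + s" "p (t + s) - p t = (t + s - t) * q y"
          using MVT2[of t "t + s" p q] s0 Dp by auto
        have "q x - q y \<le> Q x - Q y" using qQ[of x y] x y t s by simp
        also have "\<dots> \<le> D" unfolding D_def using Q_anti[of "t - 1/2" x] Q_anti[of y "t + 1/2"] x y t s by simp
        finally have "s * (q x - q y) \<le> s * D" using s0 by simp
        then show ?thesis using x(3) y(3) by (simp add: right_diff_distrib)
      qed simp
      ultimately show "\<exists>y. (f has_real_derivative y) (at s) \<and> 0 \<le> y" by blast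
    qed
    then show ?thesis by (simp add: f_def D_def power2_eq_square)
  qed
  have summand: "(2 * real n + 1) / (1 + (real n * (real n + 1) / a)\<^sup>2)\<^sup>2 = p (real n + 1/2)" for n
  proof -
    have "w (real n + 1/2) = real n * (real n + 1) / a"
      by (simp add: w_def e_def power2_eq_square algebra_simps add_divide_distrib)
    then show ?thesis by (simp add: p_def)
  qed
  have "(\<Sum>n=1..m. (2 * real n + 1) / (1 + (real n * (real n + 1) / a)\<^sup>2)\<^sup>2)
     \<le> H (real m + 1) - H 1 + (Q 1 - Q (real m + 1)) / 8"
  proof (induction m)
    case (Suc m)
    have "p (real (Suc m) + 1/2) \<le> H (real (Suc m) + 1) - H (real m + 1) + (Q (real m + 1) - Q (real (Suc m) + 1)) / 8"
      using step[of "real (Suc m) + 1/2"] by (simp add: add_ac)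
    then show ?case using Suc unfolding summand by (simp add: diff_divide_distrib)
  qed simp
  also have "\<dots> \<le> pi * a / 4"
  proof -
    have "w (real m + 1) \<ge> 0" using w_mono[of 1 "real m + 1"] w1 e by simp
    then have "H (real m + 1) \<le> a / 2 * (pi / 2)"
      unfolding H_def using a by (intro mult_left_mono arctan_upper) auto
    moreover have "Q (real m + 1) \<ge> 0" unfolding Q_def by (simp add: add_pos_nonneg)
    moreover have "Q 1 / 8 \<le> H 1"
    proof -
      define z where "z = w 1"
      have z: "z > 0" "a * z = 3/4" using e w1 a by (simp_all add: z_def e_def)
      have "H 1 \<ge> a / 2 * (z / (1 + z\<^sup>2) + z / (1 + z\<^sup>2))"
        unfolding H_def z_def[symmetric] using a z by (intro mult_left_mono add_left_mono arctan_lower) auto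
      also have "a / 2 * (z / (1 + z\<^sup>2) + z / (1 + z\<^sup>2)) = (a * z) / (1 + z\<^sup>2)"
        by (simp add: field_simps)
      finally have "H 1 \<ge> 3 / 4 / (1 + z\<^sup>2)" unfolding z(2) by simp
      moreover have "Q 1 / 8 \<le> 3 / 4 / (1 + z\<^sup>2)"
      proof -
        have "(1 + z\<^sup>2) ^ 1 \<le> (1 + z\<^sup>2) ^ 4" by (rule power_increasing) auto
        then have "17 / 24 / (1 + z\<^sup>2) ^ 4 \<le> 17 / 24 / (1 + z\<^sup>2)"
          by (intro divide_left_mono) (auto intro!: mult_pos_pos zero_less_power pos)
        also have "\<dots> \<le> 3 / 4 / (1 + z\<^sup>2)" using pos[of z] by (intro divide_right_mono) auto
        finally show ?thesis by (simp add: Q_def z_def)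
      qed
      ultimately show ?thesis by linarith
    qed
    ultimately show ?thesis by (simp add: diff_divide_distrib mult.commute)
  qed
  finally show ?thesis .
qed

section \<open>Rumin's smoothing argument\<close>

text \<open>The frequency scale \<open>\<pi> / 4\<close> is chosen to make \<open>cutoff_integral\<close> true. Among all profiles with that
normalisation, the shape \<open>f(x) = 1 / (1 + x\<^sup>2)\<close> minimises \<open>\<integral> (1 - f(1 / t))\<^sup>2 dt\<close>, which controls the remainder kernel.\<close>

definition cutoff :: "real \<Rightarrow> real \<Rightarrow> real" where
  "cutoff l t = 1 / (1 + (pi * t / (4 * l))\<^sup>2)"

lemma cutoff_continuous: "continuous_on UNIV (\<lambda>t. (cutoff l t)\<^sup>2)"
proof -
  have "1 + x\<^sup>2 \<noteq> 0" for x :: real by (smt (verit) zero_le_power2)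
  moreover have "cutoff l t = 1 / (1 + (pi / (4 * l) * t)\<^sup>2)" for t by (simp add: cutoff_def)
  ultimately show ?thesis by (simp only:) (intro continuous_intros; simp)
qed

lemma cutoff_integral:
  assumes l: "l > 0"
  shows "(\<integral>\<^sup>+t. ennreal ((cutoff l t)\<^sup>2) * indicator {0..} t \<partial>lborel) = ennreal l"
proof -
  define c where "c = pi / (4 * l)"
  have c: "c > 0" using l by (simp add: c_def)
  \<comment> \<open>An antiderivative of the squared cutoff.\<close>
  define G where "G t = (t / (1 + (c * t)\<^sup>2) + arctan (c * t) / c) / 2" for t
  have ne: "1 + (c * t)\<^sup>2 \<noteq> 0" for t by (smt (verit) zero_le_power2)
  have "(\<integral>\<^sup>+t. ennreal ((cutoff l t)\<^sup>2) * indicator {0..} t \<partial>lborel) = ennreal (l - G 0)"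
  proof (rule nn_integral_FTC_atLeast)
    show "(\<lambda>t. (cutoff l t)\<^sup>2) \<in> borel_measurable borel"
      by (rule borel_measurable_continuous_onI[OF cutoff_continuous])
    fix t :: real assume "0 \<le> t"
    show "0 \<le> (cutoff l t)\<^sup>2" by simp
    have eq: "cutoff l t = 1 / (1 + (c * t)\<^sup>2)"
      by (simp add: cutoff_def c_def)
    have "((\<lambda>t. t / (1 + (c * t)\<^sup>2)) has_real_derivative ((1 * (1 + (c * t)\<^sup>2) - t * (2 * (c * t) * c)) / ((1 + (c * t)\<^sup>2) * (1 + (c * t)\<^sup>2)))) (at t)"
      by (rule DERIV_divide) (auto intro!: derivative_eq_intros simp: ne)
    moreover have "((\<lambda>t. arctan (c * t) / c) has_real_derivative ((c / (1 + (c * t)\<^sup>2)) / c)) (at t)"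
    proof (rule DERIV_cdivide)
      have "((\<lambda>t. arctan (c * t)) has_real_derivative inverse (1 + (c * t)\<^sup>2) * c) (at t)"
        by (rule DERIV_chain2[OF DERIV_arctan]) (auto intro!: derivative_eq_intros)
      then show "((\<lambda>t. arctan (c * t)) has_real_derivative c / (1 + (c * t)\<^sup>2)) (at t)"
        by (simp add: divide_inverse mult.commute)
    qed
    ultimately have "(G has_real_derivative (((1 * (1 + (c * t)\<^sup>2) - t * (2 * (c * t) * c)) / ((1 + (c * t)\<^sup>2) * (1 + (c * t)\<^sup>2))
             + (c / (1 + (c * t)\<^sup>2)) / c) / 2)) (at t)"
      unfolding G_def by (rule DERIV_cdivide[OF DERIV_add])
    moreover have "((1 * (1 + (c * t)\<^sup>2) - t * (2 * (c * t) * c)) / ((1 + (c * t)\<^sup>2) * (1 + (c * t)\<^sup>2))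
             + (c / (1 + (c * t)\<^sup>2)) / c) / 2 = (cutoff l t)\<^sup>2"
      unfolding eq using c ne by (simp add: power2_eq_square divide_simps)
    ultimately show "(G has_real_derivative (cutoff l t)\<^sup>2) (at t)" by simp
  next
    have "((\<lambda>t. t / (1 + (c * t)\<^sup>2)) \<longlongrightarrow> 0) at_top"
    proof (rule tendsto_sandwich[of "\<lambda>_. 0"])
      show "\<forall>\<^sub>F t in at_top. t / (1 + (c * t)\<^sup>2) \<le> (1 / c\<^sup>2) * inverse t"
        using eventually_gt_at_top[of 0]
      proof eventually_elim
        case (elim t)
        have "t / (1 + (c * t)\<^sup>2) \<le> t / (c * t)\<^sup>2"
          using elim c by (intro divide_left_mono) (auto intro!: mult_pos_pos add_pos_nonneg)
        also have "\<dots> = (1 / c\<^sup>2) * inverse t" using elim c by (simp add: power2_eq_square field_simps)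
        finally show ?case .
      qed
      show "\<forall>\<^sub>F t in at_top. 0 \<le> t / (1 + (c * t)\<^sup>2)"
        using eventually_gt_at_top[of 0] by eventually_elim auto
      show "((\<lambda>t. (1 / c\<^sup>2) * inverse t) \<longlongrightarrow> 0) at_top"
        by (rule tendsto_mult_right_zero, rule tendsto_inverse_0_at_top, rule filterlim_ident)
    qed simp
    moreover have "((\<lambda>t. arctan (c * t) / c) \<longlongrightarrow> (pi / 2) / c) at_top"
      using c by (intro tendsto_divide tendsto_const filterlim_compose[OF tendsto_arctan_at_top]
          filterlim_tendsto_pos_mult_at_top[OF tendsto_const _ filterlim_ident]) auto
    ultimately have "(G \<longlongrightarrow> (0 + (pi / 2) / c) / 2) at_top"
      unfolding G_def by (intro tendsto_divide[OF tendsto_add tendsto_const]) simp_all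
    moreover have "(0 + (pi / 2) / c) / 2 = l" using l by (simp add: c_def)
    ultimately show "(G \<longlongrightarrow> l) at_top" by simp
  qed
  then show ?thesis by (simp add: G_def)
qed

text \<open>The integrand vanishes beyond \<open>t = r / A\<close>. At \<open>0\<close> the square root is not differentiable, hence the use of the
fundamental theorem with derivatives in the interior only.\<close>

lemma layer_integral:
  assumes A: "A > 0" and r: "r \<ge> 0"
  shows "(\<integral>\<^sup>+t. ennreal ((max 0 (sqrt r - sqrt (A * t)))\<^sup>2) * indicator {0..} t \<partial>lborel) = ennreal (r\<^sup>2 / (6 * A))"
proof -
  define F where "F t = r * t - 4 / 3 * sqrt (r * A) * (t * sqrt t) + A * t\<^sup>2 / 2" for t
  have I: "((\<lambda>t. (max 0 (sqrt r - sqrt (A * t)))\<^sup>2) has_integral (F (r / A) - F 0)) {0..r/A}"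
  proof (rule fundamental_theorem_of_calculus_interior)
    show "0 \<le> r / A" using A r by simp
    show "continuous_on {0..r/A} F" unfolding F_def by (intro continuous_intros) auto
    fix t assume t: "t \<in> {0<..<r/A}"
    then have "A * t \<le> r" "t > 0" using A by (auto simp: field_simps)
    then have "sqrt (A * t) \<le> sqrt r" by simp
    then have "(max 0 (sqrt r - sqrt (A * t)))\<^sup>2 = (sqrt r - sqrt (A * t))\<^sup>2" by simp
    also have "\<dots> = r - 2 * sqrt (r * A) * sqrt t + A * t"
      using A r \<open>t > 0\<close> by (simp add: power2_diff real_sqrt_mult algebra_simps)
    finally have eq: "(max 0 (sqrt r - sqrt (A * t)))\<^sup>2 = r - 2 * sqrt (r * A) * sqrt t + A * t" .
    have "t / sqrt t = sqrt t" using \<open>t > 0\<close> by (simp add: real_div_sqrt)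
    then have "(F has_real_derivative r - 2 * sqrt (r * A) * sqrt t + A * t) (at t)"
      unfolding F_def using \<open>t > 0\<close>
      by (auto intro!: derivative_eq_intros simp: field_simps)
    then show "(F has_vector_derivative (max 0 (sqrt r - sqrt (A * t)))\<^sup>2) (at t)"
      by (simp add: eq has_real_derivative_iff_has_vector_derivative)
  qed
  have val: "F (r / A) - F 0 = r\<^sup>2 / (6 * A)"
  proof -
    have "sqrt (r * A) * ((r / A) * sqrt (r / A)) = (r / A) * sqrt (r * A * (r / A))"
      by (simp add: real_sqrt_mult real_sqrt_divide)
    also have "\<dots> = (r / A) * r" using A r by (simp add: power2_eq_square[symmetric])
    finally have X: "sqrt (r * A) * ((r / A) * sqrt (r / A)) = (r / A) * r" .
    have "F (r / A) = r * (r / A) - 4 / 3 * ((r / A) * r) + A * (r / A)\<^sup>2 / 2"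
      unfolding F_def by (simp only: mult.assoc X)
    then show ?thesis using A unfolding F_def
      by (simp add: field_simps power2_eq_square)
  qed
  have "(\<integral>\<^sup>+t. ennreal ((max 0 (sqrt r - sqrt (A * t)))\<^sup>2) * indicator {0..} t \<partial>lborel)
      = (\<integral>\<^sup>+t. ennreal (indicator {0..r/A} t * (max 0 (sqrt r - sqrt (A * t)))\<^sup>2) \<partial>lborel)"
  proof (intro nn_integral_cong)
    fix t :: real
    show "ennreal ((max 0 (sqrt r - sqrt (A * t)))\<^sup>2) * indicator {0..} t = ennreal (indicator {0..r/A} t * (max 0 (sqrt r - sqrt (A * t)))\<^sup>2)"
    proof (cases "t \<le> r / A")
      case False
      then have "sqrt r \<le> sqrt (A * t)" using A by (simp add: field_simps)
      then show ?thesis by (simp add: max_def)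
    qed (auto simp: indicator_def)
  qed
  also have "\<dots> = ennreal (r\<^sup>2 / (6 * A))"
    using nn_integral_has_integral_lebesgue[OF _ I] by (simp add: val)
  finally show ?thesis .
qed

lemma norm_sq_Basis: "(norm x)\<^sup>2 = (\<Sum>b\<in>Basis. (x \<bullet> b)\<^sup>2)"
  unfolding power2_norm_eq_inner by (subst euclidean_inner) (simp add: power2_eq_square)

text \<open>At a fixed point \<open>s\<close>, each component of the left-hand fields is the inner product of \<open>u\<^sub>j\<close> with a fixed field, the
corresponding row of the smoothing kernel. Bessel's inequality for the family \<open>u\<^sub>j\<close> removes the dependence on \<open>j\<close>.\<close>

lemma smoothing_remainder_pointwise:
  fixes u e :: "_ \<Rightarrow> real^3 \<Rightarrow> real^3"
  assumes J: "finite J" "orthonormal_on J u" and K: "finite K" "orthonormal_on K e"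
  shows "(\<Sum>j\<in>J. (norm (\<Sum>k\<in>K. (a k * L2_inner_S2 (u j) (e k)) *\<^sub>R e k s))\<^sup>2)
     \<le> (\<Sum>k\<in>K. (a k)\<^sup>2 * (norm (e k s))\<^sup>2)"
proof -
  have sqe: "\<And>k. k \<in> K \<Longrightarrow> square_integrable (e k)" using K by (simp add: orthonormal_on_def)
  have squ: "\<And>j. j \<in> J \<Longrightarrow> square_integrable (u j)" using J by (simp add: orthonormal_on_def)
  have "(\<Sum>j\<in>J. (norm (\<Sum>k\<in>K. (a k * L2_inner_S2 (u j) (e k)) *\<^sub>R e k s))\<^sup>2)
      = (\<Sum>j\<in>J. \<Sum>b\<in>Basis. ((\<Sum>k\<in>K. (a k * L2_inner_S2 (u j) (e k)) *\<^sub>R e k s) \<bullet> b)\<^sup>2)"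
    by (simp only: norm_sq_Basis)
  also have "\<dots> = (\<Sum>b\<in>Basis. \<Sum>j\<in>J. ((\<Sum>k\<in>K. (a k * L2_inner_S2 (u j) (e k)) *\<^sub>R e k s) \<bullet> b)\<^sup>2)"
    by (rule sum.swap)
  also have "\<dots> \<le> (\<Sum>b\<in>Basis. \<Sum>k\<in>K. (a k * (e k s \<bullet> b))\<^sup>2)"
  proof (rule sum_mono)
    fix b :: "real^3"
    let ?X = "\<lambda>x. \<Sum>k\<in>K. (a k * (e k s \<bullet> b)) *\<^sub>R e k x"
    have sqX: "square_integrable ?X" by (intro square_integrable_sum square_integrable_scale sqe)
    have "(\<Sum>j\<in>J. ((\<Sum>k\<in>K. (a k * L2_inner_S2 (u j) (e k)) *\<^sub>R e k s) \<bullet> b)\<^sup>2)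
        = (\<Sum>j\<in>J. (L2_inner_S2 ?X (u j))\<^sup>2)"
    proof (intro sum.cong refl arg_cong[where f="\<lambda>x. x\<^sup>2"])
      fix j assume "j \<in> J"
      then have "L2_inner_S2 ?X (u j) = (\<Sum>k\<in>K. (a k * (e k s \<bullet> b)) * L2_inner_S2 (e k) (u j))"
        by (intro L2_inner_sum_left squ sqe)
      then show "(\<Sum>k\<in>K. (a k * L2_inner_S2 (u j) (e k)) *\<^sub>R e k s) \<bullet> b = L2_inner_S2 ?X (u j)"
        by (simp add: inner_sum_left L2_inner_commute[of "e _"] mult_ac)
    qed
    also have "\<dots> \<le> L2_inner_S2 ?X ?X" by (rule bessel_inequality[OF J sqX])
    also have "\<dots> = (\<Sum>k\<in>K. (a k * (e k s \<bullet> b))\<^sup>2)" by (rule L2_inner_orthonormal_sum[OF K])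
    finally show "(\<Sum>j\<in>J. ((\<Sum>k\<in>K. (a k * L2_inner_S2 (u j) (e k)) *\<^sub>R e k s) \<bullet> b)\<^sup>2) \<le> \<dots>" .
  qed
  also have "\<dots> = (\<Sum>k\<in>K. (a k)\<^sup>2 * (norm (e k s))\<^sup>2)"
    by (subst sum.swap) (simp only: norm_sq_Basis power_mult_distrib sum_distrib_left)
  finally show ?thesis .
qed


lemma rumin_pointwise:
  fixes u w :: "'j \<Rightarrow> 'a::real_normed_vector"
  assumes "(\<Sum>j\<in>J. (norm (w j))\<^sup>2) \<le> B"
  shows "(max 0 (sqrt (\<Sum>j\<in>J. (norm (u j))\<^sup>2) - sqrt B))\<^sup>2 \<le> (\<Sum>j\<in>J. (norm (u j - w j))\<^sup>2)"
proof -
  have "sqrt (\<Sum>j\<in>J. (norm (u j))\<^sup>2) = L2_set (\<lambda>j. norm (u j)) J"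
    by (simp add: L2_set_def)
  also have "\<dots> \<le> L2_set (\<lambda>j. norm (u j - w j) + norm (w j)) J"
    by (rule L2_set_mono) (auto intro: order_trans[OF _ norm_triangle_ineq])
  also have "\<dots> \<le> L2_set (\<lambda>j. norm (u j - w j)) J + L2_set (\<lambda>j. norm (w j)) J"
    by (rule L2_set_triangle_ineq)
  also have "\<dots> \<le> sqrt (\<Sum>j\<in>J. (norm (u j - w j))\<^sup>2) + sqrt B"
    using assms by (simp add: L2_set_def)
  finally have "max 0 (sqrt (\<Sum>j\<in>J. (norm (u j))\<^sup>2) - sqrt B) \<le> sqrt (\<Sum>j\<in>J. (norm (u j - w j))\<^sup>2)"
    by (simp add: sum_nonneg)
  then have "(max 0 (sqrt (\<Sum>j\<in>J. (norm (u j))\<^sup>2) - sqrt B))\<^sup>2 \<le> (sqrt (\<Sum>j\<in>J. (norm (u j - w j))\<^sup>2))\<^sup>2"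
    by (rule power_mono) simp
  then show ?thesis by (simp add: sum_nonneg)
qed

text \<open>The index sets \<open>K m\<close> truncate the orthonormal system, so that only finite sums occur; \<open>tau m\<close> measures what the
truncation loses. It enters the estimate with the factor \<open>T\<close> when the spectral parameter is integrated over
\<open>[0, T]\<close>, and therefore \<open>m\<close> goes to infinity before \<open>T\<close> does.\<close>

theorem rumin_bound:
  fixes u :: "'j \<Rightarrow> real^3 \<Rightarrow> real^3" and e :: "'k \<Rightarrow> real^3 \<Rightarrow> real^3"
  assumes J: "finite J" "orthonormal_on J u"
    and K: "\<And>m. finite (K m)" "\<And>m. orthonormal_on (K m) e"
    and lam: "\<And>m k. k \<in> K m \<Longrightarrow> lam k > 0"
    and A: "A > 0"
    and kernel: "\<And>m t s. 0 \<le> t \<Longrightarrow> s \<in> S2 \<Longrightarrow>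
       (\<Sum>k\<in>K m. (1 - cutoff (lam k) t)\<^sup>2 * (norm (e k s))\<^sup>2) \<le> A * t"
    and energy: "\<And>m. (\<Sum>j\<in>J. \<Sum>k\<in>K m. lam k * (L2_inner_S2 (u j) (e k))\<^sup>2) \<le> D"
    and parseval: "\<And>j. j \<in> J \<Longrightarrow> (\<lambda>m. \<Sum>k\<in>K m. (L2_inner_S2 (u j) (e k))\<^sup>2) \<longlonglongrightarrow> 1"
  shows "(\<integral>\<^sup>+s. ennreal ((\<Sum>j\<in>J. (norm (u j s))\<^sup>2)\<^sup>2) \<partial>dS) \<le> ennreal (6 * A * D)"
proof -
  define c where "c j k = L2_inner_S2 (u j) (e k)" for j k
  define r where "r s = (\<Sum>j\<in>J. (norm (u j s))\<^sup>2)" for s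
  define h where "h t s = (max 0 (sqrt (r s) - sqrt (A * t)))\<^sup>2" for t s
  define tau where "tau m = (\<Sum>j\<in>J. 1 - (\<Sum>k\<in>K m. (c j k)\<^sup>2))" for m
  have squ: "\<And>j. j \<in> J \<Longrightarrow> square_integrable (u j)" using J by (simp add: orthonormal_on_def)
  have sqe: "\<And>m k. k \<in> K m \<Longrightarrow> square_integrable (e k)" using K(2) by (auto simp: orthonormal_on_def)
  have r0: "r s \<ge> 0" for s by (simp add: r_def sum_nonneg)
  have D0: "D \<ge> 0"
    by (rule order_trans[OF _ energy[of 0]]) (auto intro!: sum_nonneg mult_nonneg_nonneg less_imp_le[OF lam])
  have rm [measurable]: "r \<in> borel_measurable dS"
    unfolding r_def
    by (intro borel_measurable_sum borel_measurable_power measurable_compose[OF square_integrable_measurable[OF squ] borel_measurable_norm])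
  have uu: "L2_inner_S2 (u j) (u j) = 1" if "j \<in> J" for j using J that by (simp add: orthonormal_on_def)
  have tau0: "tau m \<ge> 0" for m
    unfolding tau_def c_def using bessel_inequality[OF K(1) K(2) squ] uu by (intro sum_nonneg) simp
  have slice: "(\<integral>\<^sup>+s. ennreal (h t s) \<partial>dS)
      \<le> ennreal ((\<Sum>j\<in>J. \<Sum>k\<in>K m. (c j k)\<^sup>2 * (cutoff (lam k) t)\<^sup>2) + tau m)" if t: "t \<ge> 0" for t m
  proof -
    define w where "w j s = (\<Sum>k\<in>K m. ((1 - cutoff (lam k) t) * c j k) *\<^sub>R e k s)" for j s
    have sqw: "square_integrable (\<lambda>s. u j s - w j s)" if "j \<in> J" for j
      unfolding w_def
      by (rule square_integrable_diff[OF squ[OF that]], rule square_integrable_sum, rule square_integrable_scale, rule sqe)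
    have int: "integrable dS (\<lambda>s. (norm (u j s - w j s))\<^sup>2)" if "j \<in> J" for j
      using sqw[OF that] by (simp add: square_integrable_def)
    have "(\<integral>\<^sup>+s. ennreal (h t s) \<partial>dS) \<le> (\<integral>\<^sup>+s. ennreal (\<Sum>j\<in>J. (norm (u j s - w j s))\<^sup>2) \<partial>dS)"
    proof (rule nn_integral_mono, rule ennreal_leI)
      fix s assume "s \<in> space dS"
      then have "s \<in> S2" by simp
      have "(\<Sum>j\<in>J. (norm (w j s))\<^sup>2) \<le> A * t"
        unfolding w_def c_def
        by (rule order_trans[OF smoothing_remainder_pointwise[OF J K(1) K(2)] kernel[OF t \<open>s \<in> S2\<close>]])
      then show "h t s \<le> (\<Sum>j\<in>J. (norm (u j s - w j s))\<^sup>2)"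
        unfolding h_def r_def by (rule rumin_pointwise)
    qed
    also have "\<dots> = ennreal (\<integral>s. (\<Sum>j\<in>J. (norm (u j s - w j s))\<^sup>2) \<partial>dS)"
      by (rule nn_integral_eq_integral) (auto intro!: int AE_I2 sum_nonneg)
    also have "(\<integral>s. (\<Sum>j\<in>J. (norm (u j s - w j s))\<^sup>2) \<partial>dS)
        = (\<Sum>j\<in>J. L2_inner_S2 (\<lambda>s. u j s - w j s) (\<lambda>s. u j s - w j s))"
      by (subst Bochner_Integration.integral_sum) (simp_all add: int L2_inner_S2_def power2_norm_eq_inner[symmetric])
    also have "\<dots> = (\<Sum>j\<in>J. (\<Sum>k\<in>K m. (c j k)\<^sup>2 * (cutoff (lam k) t)\<^sup>2) + (1 - (\<Sum>k\<in>K m. (c j k)\<^sup>2)))"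
    proof (rule sum.cong[OF refl])
      fix j assume j: "j \<in> J"
      have "(\<Sum>k\<in>K m. (c j k - (1 - cutoff (lam k) t) * c j k)\<^sup>2) = (\<Sum>k\<in>K m. (c j k)\<^sup>2 * (cutoff (lam k) t)\<^sup>2)"
        by (rule sum.cong[OF refl]) (simp add: algebra_simps power_mult_distrib)
      then show "L2_inner_S2 (\<lambda>s. u j s - w j s) (\<lambda>s. u j s - w j s)
          = (\<Sum>k\<in>K m. (c j k)\<^sup>2 * (cutoff (lam k) t)\<^sup>2) + (1 - (\<Sum>k\<in>K m. (c j k)\<^sup>2))"
        unfolding w_def using L2_inner_diff_orthonormal_sum[OF K(1)[of m] K(2)[of m] squ[OF j], of "\<lambda>k. (1 - cutoff (lam k) t) * c j k"]
        by (simp add: uu[OF j] c_def[symmetric])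
    qed
    also have "\<dots> = (\<Sum>j\<in>J. \<Sum>k\<in>K m. (c j k)\<^sup>2 * (cutoff (lam k) t)\<^sup>2) + tau m"
      by (simp add: sum.distrib tau_def)
    finally show ?thesis .
  qed
  define Fn where "Fn t = (\<integral>\<^sup>+s. ennreal (h t s) \<partial>dS)" for t
  have hm [measurable]: "(\<lambda>(t, s). ennreal (h t s)) \<in> borel_measurable (lborel \<Otimes>\<^sub>M dS)"
    unfolding h_def by measurable
  have Fm [measurable]: "Fn \<in> borel_measurable lborel"
    unfolding Fn_def by (rule surface.borel_measurable_nn_integral) (use hm in simp)
  have cm: "(\<lambda>t. (cutoff l t)\<^sup>2) \<in> borel_measurable borel" for l
    by (rule borel_measurable_continuous_onI[OF cutoff_continuous])
  have step: "(\<integral>\<^sup>+t. Fn t * indicator {0..T} t \<partial>lborel) \<le> ennreal (D + T * tau m)" if T: "T \<ge> 0" for T m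
  proof -
    have "(\<integral>\<^sup>+t. Fn t * indicator {0..T} t \<partial>lborel)
       \<le> (\<integral>\<^sup>+t. (\<Sum>j\<in>J. \<Sum>k\<in>K m. ennreal ((c j k)\<^sup>2) * (ennreal ((cutoff (lam k) t)\<^sup>2) * indicator {0..} t))
              + ennreal (tau m) * indicator {0..T} t \<partial>lborel)"
    proof (rule nn_integral_mono)
      fix t :: real
      show "Fn t * indicator {0..T} t \<le> (\<Sum>j\<in>J. \<Sum>k\<in>K m. ennreal ((c j k)\<^sup>2) * (ennreal ((cutoff (lam k) t)\<^sup>2) * indicator {0..} t))
              + ennreal (tau m) * indicator {0..T} t"
      proof (cases "t \<in> {0..T}")
        case True
        have "ennreal ((\<Sum>j\<in>J. \<Sum>k\<in>K m. (c j k)\<^sup>2 * (cutoff (lam k) t)\<^sup>2) + tau m)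
          = (\<Sum>j\<in>J. \<Sum>k\<in>K m. ennreal ((c j k)\<^sup>2) * ennreal ((cutoff (lam k) t)\<^sup>2)) + ennreal (tau m)"
          by (simp add: tau0 sum_nonneg ennreal_mult'[symmetric] sum_ennreal)
        then show ?thesis using slice[of t m] True by (simp add: Fn_def)
      qed simp
    qed
    also have "\<dots> = (\<Sum>j\<in>J. \<Sum>k\<in>K m. ennreal ((c j k)\<^sup>2) * (\<integral>\<^sup>+t. ennreal ((cutoff (lam k) t)\<^sup>2) * indicator {0..} t \<partial>lborel))
        + ennreal (tau m) * ennreal T"
      using T cm by (simp add: nn_integral_add nn_integral_sum nn_integral_cmult nn_integral_cmult_indicator)
    also have "\<dots> = (\<Sum>j\<in>J. \<Sum>k\<in>K m. ennreal ((c j k)\<^sup>2) * ennreal (lam k)) + ennreal (tau m) * ennreal T"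
      by (intro arg_cong2[where f="(+)"] sum.cong refl arg_cong2[where f="(*)"] cutoff_integral lam)
    also have "\<dots> = ennreal ((\<Sum>j\<in>J. \<Sum>k\<in>K m. lam k * (c j k)\<^sup>2) + T * tau m)"
    proof -
      have "(\<Sum>j\<in>J. \<Sum>k\<in>K m. ennreal ((c j k)\<^sup>2) * ennreal (lam k)) = (\<Sum>j\<in>J. \<Sum>k\<in>K m. ennreal (lam k * (c j k)\<^sup>2))"
        by (intro sum.cong refl) (simp add: ennreal_mult'[symmetric], simp add: mult.commute)
      also have "\<dots> = (\<Sum>j\<in>J. ennreal (\<Sum>k\<in>K m. lam k * (c j k)\<^sup>2))"
        by (intro sum.cong refl sum_ennreal) (auto intro!: mult_nonneg_nonneg less_imp_le[OF lam])
      also have "\<dots> = ennreal (\<Sum>j\<in>J. \<Sum>k\<in>K m. lam k * (c j k)\<^sup>2)"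
        by (intro sum_ennreal) (auto intro!: sum_nonneg mult_nonneg_nonneg less_imp_le[OF lam])
      finally have 1: "(\<Sum>j\<in>J. \<Sum>k\<in>K m. ennreal ((c j k)\<^sup>2) * ennreal (lam k)) = ennreal (\<Sum>j\<in>J. \<Sum>k\<in>K m. lam k * (c j k)\<^sup>2)" .
      have 2: "ennreal (tau m) * ennreal T = ennreal (T * tau m)"
        using T tau0[of m] by (simp add: ennreal_mult[symmetric] mult.commute)
      show ?thesis unfolding 1 2
        using T tau0[of m] by (intro ennreal_plus[symmetric] sum_nonneg mult_nonneg_nonneg) (auto intro!: less_imp_le[OF lam])
    qed
    also have "\<dots> \<le> ennreal (D + T * tau m)"
      using energy[of m] by (intro ennreal_leI) (simp add: c_def)
    finally show ?thesis .
  qed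
  have tau_lim: "tau \<longlonglongrightarrow> 0"
  proof -
    have "(\<lambda>m. \<Sum>j\<in>J. 1 - (\<Sum>k\<in>K m. (c j k)\<^sup>2)) \<longlonglongrightarrow> (\<Sum>j\<in>J. 1 - 1)"
      unfolding c_def by (intro tendsto_sum tendsto_diff tendsto_const parseval)
    then show ?thesis by (simp add: tau_def[abs_def])
  qed
  have bounded: "(\<integral>\<^sup>+t. Fn t * indicator {0..T} t \<partial>lborel) \<le> ennreal D" if T: "T \<ge> 0" for T
  proof -
    have "(\<lambda>m. ennreal (D + T * tau m)) \<longlonglongrightarrow> ennreal (D + T * 0)"
      by (intro tendsto_ennrealI tendsto_intros tau_lim)
    from LIMSEQ_le_const[OF this] step[OF T] show ?thesis by simp
  qed
  \<comment> \<open>The estimate holds on every bounded interval; monotone convergence extends it to the half-line.\<close>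
  have "(\<integral>\<^sup>+t. Fn t * indicator {0..} t \<partial>lborel) = (\<integral>\<^sup>+t. (SUP n::nat. Fn t * indicator {0..real n} t) \<partial>lborel)"
  proof (rule nn_integral_cong)
    fix t :: real
    obtain n :: nat where n: "t \<le> real n" using real_arch_simple by blast
    show "Fn t * indicator {0..} t = (SUP n::nat. Fn t * indicator {0..real n} t)"
    proof (rule antisym)
      have "Fn t * indicator {0..} t \<le> Fn t * indicator {0..real n} t" using n by (auto simp: indicator_def)
      also have "\<dots> \<le> (SUP n::nat. Fn t * indicator {0..real n} t)" by (rule SUP_upper) simp
      finally show "Fn t * indicator {0..} t \<le> (SUP n::nat. Fn t * indicator {0..real n} t)" .
      show "(SUP n::nat. Fn t * indicator {0..real n} t) \<le> Fn t * indicator {0..} t"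
        by (rule SUP_least) (auto simp: indicator_def)
    qed
  qed
  also have "\<dots> = (SUP n::nat. \<integral>\<^sup>+t. Fn t * indicator {0..real n} t \<partial>lborel)"
    by (rule nn_integral_monotone_convergence_SUP)
       (auto simp: incseq_def le_fun_def indicator_def intro!: measurable_If)
  also have "\<dots> \<le> ennreal D" by (rule SUP_least, rule bounded) simp
  finally have total: "(\<integral>\<^sup>+t. Fn t * indicator {0..} t \<partial>lborel) \<le> ennreal D" .
  have psf: "pair_sigma_finite lborel dS" by unfold_locales
  have "(\<integral>\<^sup>+t. Fn t * indicator {0..} t \<partial>lborel) = (\<integral>\<^sup>+t. (\<integral>\<^sup>+s. ennreal (h t s) * indicator {0..} t \<partial>dS) \<partial>lborel)"
    unfolding Fn_def by (intro nn_integral_cong nn_integral_multc[symmetric]) (simp add: h_def)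
  also have "\<dots> = (\<integral>\<^sup>+s. (\<integral>\<^sup>+t. ennreal (h t s) * indicator {0..} t \<partial>lborel) \<partial>dS)"
    by (rule pair_sigma_finite.Fubini'[OF psf, symmetric]) measurable
  also have "\<dots> = (\<integral>\<^sup>+s. ennreal ((r s)\<^sup>2 / (6 * A)) \<partial>dS)"
    unfolding h_def by (intro nn_integral_cong layer_integral A r0)
  finally have "(\<integral>\<^sup>+s. ennreal ((r s)\<^sup>2 / (6 * A)) \<partial>dS) \<le> ennreal D" using total by simp
  then have "ennreal (6 * A) * (\<integral>\<^sup>+s. ennreal ((r s)\<^sup>2 / (6 * A)) \<partial>dS) \<le> ennreal (6 * A) * ennreal D"
    by (rule mult_left_mono) simp
  also have "ennreal (6 * A) * (\<integral>\<^sup>+s. ennreal ((r s)\<^sup>2 / (6 * A)) \<partial>dS) = (\<integral>\<^sup>+s. ennreal ((r s)\<^sup>2) \<partial>dS)"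
    using A by (subst nn_integral_cmult[symmetric]) (auto simp: ennreal_mult[symmetric])
  also have "ennreal (6 * A) * ennreal D = ennreal (6 * A * D)" using A D0 by (simp add: ennreal_mult)
  finally show ?thesis by (simp add: r_def)
qed

section \<open>The Lieb--Thirring inequality\<close>

text \<open>By the addition theorem for gradients each degree contributes \<open>(1 - f)\<^sup>2 d / 4 \<pi>\<close> per type, where \<open>d\<close> is at most
\<open>2 n + 1\<close>. With \<open>a = \<pi> t / 4\<close> one has \<open>1 - f = 1 / (1 + (\<lambda> / a)\<^sup>2)\<close>, which leads to \<open>degree_sum_bound\<close>.\<close>

lemma kernel_bound:
  assumes t: "0 \<le> t" and s: "s \<in> S2"
  shows "(\<Sum>k\<in>modes B m. (1 - cutoff (level k) t)\<^sup>2 * (norm (vharm k s))\<^sup>2) \<le> card B * (pi / 64) * t"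
proof (cases "t = 0")
  case True
  then show ?thesis by (simp add: cutoff_def)
next
  case False
  define a where "a = pi * t / 4"
  have a: "a > 0" using t False by (simp add: a_def)
  have inner: "(\<Sum>i<hdim n. (1 - cutoff (level (n, i, b)) t)\<^sup>2 * (norm (vharm (n, i, b) s))\<^sup>2)
     \<le> (1 / (4 * pi)) * ((2 * real n + 1) / (1 + (real n * (real n + 1) / a)\<^sup>2)\<^sup>2)" if n: "n \<in> {1..m}" for n b
  proof -
    define l where "l = real n * (real n + 1)"
    have l: "l > 0" using n by (simp add: l_def)
    have cut: "1 - cutoff l t = 1 / (1 + (l / a)\<^sup>2)"
    proof -
      have q: "pi * t / (4 * l) = a / l" by (simp add: a_def)
      define X Y where "X = 1 + (l / a)\<^sup>2" and "Y = 1 + (a / l)\<^sup>2"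
      have nz: "X \<noteq> 0" "Y \<noteq> 0" unfolding X_def Y_def by (smt (verit) zero_le_power2)+
      have "(a / l)\<^sup>2 * X = Y"
        using l a by (simp add: X_def Y_def power_divide distrib_left)
      then have XY: "(Y - 1) * X = Y" by (simp add: Y_def)
      have "1 - 1 / Y = 1 / X" using XY nz by (simp add: field_simps)
      then have "1 - 1 / (1 + (a / l)\<^sup>2) = 1 / (1 + (l / a)\<^sup>2)" by (simp only: X_def Y_def)
      then show ?thesis by (simp add: cutoff_def q)
    qed
    have "(\<Sum>i<hdim n. (1 - cutoff (level (n, i, b)) t)\<^sup>2 * (norm (vharm (n, i, b) s))\<^sup>2)
      = (1 - cutoff l t)\<^sup>2 * ((\<Sum>i<hdim n. (Lop 1 (sphharm n i) s)\<^sup>2 + (Lop 2 (sphharm n i) s)\<^sup>2 + (Lop 3 (sphharm n i) s)\<^sup>2) / l)"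
      unfolding sum_divide_distrib sum_distrib_left
      by (rule sum.cong) (simp_all add: level_def l_def norm_sq_vharm[OF s])
    also have "\<dots> = (1 - cutoff l t)\<^sup>2 * (hdim n / (4 * pi))"
      using l n unfolding sum_sphharm_squares(2)[OF s] by (simp add: l_def)
    also have "\<dots> \<le> (1 - cutoff l t)\<^sup>2 * ((2 * real n + 1) / (4 * pi))"
    proof -
      have "real (hdim n) \<le> 2 * real n + 1" using hdim_le[of n] by linarith
      then show ?thesis by (intro mult_left_mono divide_right_mono) auto
    qed
    also have "\<dots> = (1 / (4 * pi)) * ((2 * real n + 1) / (1 + (l / a)\<^sup>2)\<^sup>2)"
      unfolding cut by (simp add: power_divide)
    finally show ?thesis by (simp add: l_def)
  qed
  have "(\<Sum>k\<in>modes B m. (1 - cutoff (level k) t)\<^sup>2 * (norm (vharm k s))\<^sup>2)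
     \<le> (\<Sum>b\<in>B. \<Sum>n=1..m. (1 / (4 * pi)) * ((2 * real n + 1) / (1 + (real n * (real n + 1) / a)\<^sup>2)\<^sup>2))"
    unfolding sum_modes by (intro sum_mono inner)
  also have "\<dots> = card B * ((1 / (4 * pi)) * (\<Sum>n=1..m. (2 * real n + 1) / (1 + (real n * (real n + 1) / a)\<^sup>2)\<^sup>2))"
    by (simp add: sum_distrib_left)
  also have "\<dots> \<le> card B * ((1 / (4 * pi)) * (pi * a / 4))"
    by (intro mult_left_mono degree_sum_bound a) auto
  also have "\<dots> = card B * (pi / 64) * t" by (simp add: a_def)
  finally show ?thesis .
qed

lemma orthonormal_sphharm_all:
  "orthonormal_on (SIGMA n:{1..m}. {..<hdim n}) (\<lambda>(n, i). sphharm n i)"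
  unfolding orthonormal_on_def
  by (auto simp: L2_inner_sphharm intro!: poly3_square_integrable harm_poly3 harm_sphharm)

text \<open>The factor \<open>level\<close> cancels the normalisation of the mode, and integration by parts moves the derivative from
the harmonic to \<open>u\<close>.\<close>

lemma level_coefficient:
  assumes u: "u \<in> H1_TS2" and n: "n > 0" and i: "i < hdim n"
  shows "level (n, i, True) * (L2_inner_S2 u (vharm (n, i, True)))\<^sup>2 = (L2_inner_S2 (rot_S2 u) (sphharm n i))\<^sup>2"
    and "level (n, i, False) * (L2_inner_S2 u (vharm (n, i, False)))\<^sup>2 = (L2_inner_S2 (div_S2 u) (sphharm n i))\<^sup>2"
proof -
  have p: "poly3 (sphharm n i)" using harm_sphharm[OF i] by (rule harm_poly3)
  have t: "u s \<bullet> s = 0" if "s \<in> S2" for s using u that by (auto simp: H1_TS2_def has_cov_deriv_def tangent_field_def)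
  have "L2_inner_S2 u (grad_field (sphharm n i)) = L2_inner_S2 u (gradient (sphharm n i))"
    by (rule L2_inner_cong) (simp add: inner_tangent_grad_field t)
  then have g: "L2_inner_S2 u (grad_field (sphharm n i)) = - L2_inner_S2 (div_S2 u) (sphharm n i)"
    using H1_integration_by_parts(1)[OF u p] by simp
  have c: "L2_inner_S2 u (curl_field (sphharm n i)) = - L2_inner_S2 (rot_S2 u) (sphharm n i)"
    using H1_rot_by_parts(1)[OF u p] by (simp add: curl_field_def[abs_def])
  have l: "real n * (real n + 1) > 0" using n by simp
  have sq: "real n * (real n + 1) * (1 / sqrt (real n * (real n + 1)) * x)\<^sup>2 = x\<^sup>2" for x
    using l n by (simp add: power_mult_distrib power_divide)
  show "level (n, i, True) * (L2_inner_S2 u (vharm (n, i, True)))\<^sup>2 = (L2_inner_S2 (rot_S2 u) (sphharm n i))\<^sup>2"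
    unfolding L2_inner_vharm_right level_def prod.case sq by (simp add: c)
  show "level (n, i, False) * (L2_inner_S2 u (vharm (n, i, False)))\<^sup>2 = (L2_inner_S2 (div_S2 u) (sphharm n i))\<^sup>2"
    unfolding L2_inner_vharm_right level_def prod.case sq by (simp add: g)
qed

definition mode_energy :: "bool \<Rightarrow> (real^3 \<Rightarrow> real^3) \<Rightarrow> real" where
  "mode_energy b u = (if b then (L2_norm_S2 (rot_S2 u))\<^sup>2 else (L2_norm_S2 (div_S2 u))\<^sup>2)"

lemma energy_bound:
  assumes u: "u \<in> H1_TS2"
  shows "(\<Sum>k\<in>modes B m. level k * (L2_inner_S2 u (vharm k))\<^sup>2) \<le> (\<Sum>b\<in>B. mode_energy b u)"
  unfolding sum_modes
proof (rule sum_mono)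
  fix b
  define f where "f = (if b then rot_S2 u else div_S2 u)"
  have one: "poly3 (\<lambda>x. 1)" by simp
  have f: "square_integrable f"
    unfolding f_def using rot_square_integrable[OF u one] div_square_integrable[OF u one] by simp
  have "(\<Sum>n=1..m. \<Sum>i<hdim n. level (n, i, b) * (L2_inner_S2 u (vharm (n, i, b)))\<^sup>2)
     = (\<Sum>n=1..m. \<Sum>i<hdim n. (L2_inner_S2 f (sphharm n i))\<^sup>2)"
    by (intro sum.cong refl) (cases b; simp add: f_def level_coefficient[OF u])
  also have "\<dots> = (\<Sum>(n, i)\<in>(SIGMA n:{1..m}. {..<hdim n}). (L2_inner_S2 f (sphharm n i))\<^sup>2)"
    by (rule sum.Sigma) auto
  also have "\<dots> = (\<Sum>k\<in>(SIGMA n:{1..m}. {..<hdim n}). (L2_inner_S2 f ((\<lambda>(n, i). sphharm n i) k))\<^sup>2)"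
    by (simp add: split_def)
  also have "\<dots> \<le> L2_inner_S2 f f"
    by (rule bessel_inequality[OF _ orthonormal_sphharm_all f]) auto
  also have "\<dots> = mode_energy b u" by (simp add: f_def mode_energy_def L2_norm_sq)
  finally show "(\<Sum>n=1..m. \<Sum>i<hdim n. level (n, i, b) * (L2_inner_S2 u (vharm (n, i, b)))\<^sup>2) \<le> mode_energy b u" .
qed

text \<open>If the energy of a type vanishes, so do all coefficients of that type. Hence Parseval's identity already
holds for the remaining types, and the kernel is only summed over these.\<close>

theorem lieb_thirring_on_modes:
  assumes u: "\<And>j. j \<in> {1..N} \<Longrightarrow> u j \<in> H1_TS2" and on: "L2_orthonormal N u" and B: "B \<noteq> {}"
    and vanish: "\<And>b j. b \<notin> B \<Longrightarrow> j \<in> {1..N} \<Longrightarrow> mode_energy b (u j) = 0"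
  shows "(\<integral>\<^sup>+s. ennreal ((rho N u s)\<^sup>2) \<partial>dS)
    \<le> ennreal (6 * (card B * (pi / 64)) * (\<Sum>j=1..N. \<Sum>b\<in>B. mode_energy b (u j)))"
  unfolding rho_def
proof (rule rumin_bound[where K="modes B" and e=vharm and lam=level])
  show J: "orthonormal_on {1..N} u"
    using on u H1_square_integrable by (auto simp: orthonormal_on_def L2_orthonormal_def)
  show "0 < card B * (pi / 64)" using B by (simp add: card_gt_0_iff)
  show "(\<Sum>j=1..N. \<Sum>k\<in>modes B m. level k * (L2_inner_S2 (u j) (vharm k))\<^sup>2) \<le> (\<Sum>j=1..N. \<Sum>b\<in>B. mode_energy b (u j))" for m
    by (intro sum_mono energy_bound u)
  show "(\<Sum>k\<in>modes B m. (1 - cutoff (level k) t)\<^sup>2 * (norm (vharm k s))\<^sup>2) \<le> card B * (pi / 64) * t"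
    if "0 \<le> t" "s \<in> S2" for m t s
    using that by (rule kernel_bound)
  fix j assume j: "j \<in> {1..N}"
  have "(\<Sum>k\<in>modes B m. (L2_inner_S2 (u j) (vharm k))\<^sup>2) = (\<Sum>k\<in>modes UNIV m. (L2_inner_S2 (u j) (vharm k))\<^sup>2)" for m
  proof (rule sum.mono_neutral_left[OF finite_modes])
    show "modes B m \<subseteq> modes UNIV m" by (auto simp: modes_def)
    show "\<forall>k\<in>modes UNIV m - modes B m. (L2_inner_S2 (u j) (vharm k))\<^sup>2 = 0"
    proof
      fix k assume "k \<in> modes UNIV m - modes B m"
      moreover obtain n i b where kk: "k = (n, i, b)" by (cases k)
      ultimately have b: "b \<notin> B" and n: "Suc 0 \<le> n" "n \<le> m" "i < hdim n"
        by (auto simp: modes_def)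
      have k: "(n, i, b) \<in> modes {b} m" using n by (auto simp: modes_def)
      have le: "(\<Sum>k\<in>modes {b} m. level k * (L2_inner_S2 (u j) (vharm k))\<^sup>2) \<le> 0"
        using energy_bound[OF u[OF j], where B="{b}" and m=m] vanish[OF b j] by simp
      have "level (n, i, b) * (L2_inner_S2 (u j) (vharm (n, i, b)))\<^sup>2 \<le> (\<Sum>k\<in>modes {b} m. level k * (L2_inner_S2 (u j) (vharm k))\<^sup>2)"
        by (rule member_le_sum[OF k]) (auto intro!: mult_nonneg_nonneg less_imp_le[OF level_pos])
      then have "level (n, i, b) * (L2_inner_S2 (u j) (vharm (n, i, b)))\<^sup>2 \<le> 0" using le by linarith
      then show "(L2_inner_S2 (u j) (vharm k))\<^sup>2 = 0"
        using level_pos[OF k] unfolding kk by (simp add: mult_le_0_iff)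
    qed
  qed
  moreover have "L2_inner_S2 (u j) (u j) = 1" using J j by (simp add: orthonormal_on_def)
  ultimately show "(\<lambda>m. \<Sum>k\<in>modes B m. (L2_inner_S2 (u j) (vharm k))\<^sup>2) \<longlonglongrightarrow> 1"
    using parseval_H1[OF u[OF j]] by simp
qed (auto intro: orthonormal_vharm level_pos)

lemma L2_norm_AE_0: "AE s in dS. f s = 0 \<Longrightarrow> L2_norm_S2 f = 0"
  for f :: "real^3 \<Rightarrow> real"
proof -
  assume "AE s in dS. f s = 0"
  then have "(\<integral>s. (norm (f s))\<^sup>2 \<partial>dS) = 0"
    by (intro integral_eq_zero_AE) auto
  then show ?thesis by (simp add: L2_norm_S2_def)
qed

theorem theorem2p2:
  fixes u :: "nat \<Rightarrow> real^3 \<Rightarrow> real^3" and N :: nat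
  assumes "\<forall>j\<in>{1..N}. u j \<in> H1_TS2"
    and "L2_orthonormal N u"
  shows "(\<integral>\<^sup>+s. ennreal ((rho N u s)\<^sup>2) \<partial>surface_measure)
         \<le> ennreal (3 * pi / 16 * (\<Sum>j=1..N. ((L2_norm_S2 (rot_S2 (u j)))\<^sup>2 + (L2_norm_S2 (div_S2 (u j)))\<^sup>2))) \<and>
     ((\<forall>j\<in>{1..N}. AE s in surface_measure. div_S2 (u j) s = 0) \<longrightarrow>
       (\<integral>\<^sup>+s. ennreal ((rho N u s)\<^sup>2) \<partial>surface_measure)
         \<le> ennreal (3 * pi / 32 * (\<Sum>j=1..N. (L2_norm_S2 (rot_S2 (u j)))\<^sup>2))) \<and>
     ((\<forall>j\<in>{1..N}. AE s in surface_measure. rot_S2 (u j) s = 0) \<longrightarrow>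
       (\<integral>\<^sup>+s. ennreal ((rho N u s)\<^sup>2) \<partial>surface_measure)
         \<le> ennreal (3 * pi / 32 * (\<Sum>j=1..N. (L2_norm_S2 (div_S2 (u j)))\<^sup>2)))"
proof -
  have u: "u j \<in> H1_TS2" if "j \<in> {1..N}" for j using assms(1) that by blast
  note bound = lieb_thirring_on_modes[of N u, OF u assms(2)]
  show ?thesis
  proof (intro conjI impI)
    show "(\<integral>\<^sup>+s. ennreal ((rho N u s)\<^sup>2) \<partial>surface_measure)
         \<le> ennreal (3 * pi / 16 * (\<Sum>j=1..N. ((L2_norm_S2 (rot_S2 (u j)))\<^sup>2 + (L2_norm_S2 (div_S2 (u j)))\<^sup>2)))"
      using bound[of UNIV] by (simp add: UNIV_bool mode_energy_def add.commute)
  next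
    assume "\<forall>j\<in>{1..N}. AE s in surface_measure. div_S2 (u j) s = 0"
    then have "mode_energy b (u j) = 0" if "b \<notin> {True}" "j \<in> {1..N}" for b j
      using that by (auto simp: mode_energy_def L2_norm_AE_0)
    from bound[of "{True}", OF _ _ this] show "(\<integral>\<^sup>+s. ennreal ((rho N u s)\<^sup>2) \<partial>surface_measure)
         \<le> ennreal (3 * pi / 32 * (\<Sum>j=1..N. (L2_norm_S2 (rot_S2 (u j)))\<^sup>2))"
      by (simp add: mode_energy_def)
  next
    assume "\<forall>j\<in>{1..N}. AE s in surface_measure. rot_S2 (u j) s = 0"
    then have "mode_energy b (u j) = 0" if "b \<notin> {False}" "j \<in> {1..N}" for b j
      using that by (auto simp: mode_energy_def L2_norm_AE_0)
    from bound[of "{False}", OF _ _ this] show "(\<integral>\<^sup>+s. ennreal ((rho N u s)\<^sup>2) \<partial>surface_measure)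
         \<le> ennreal (3 * pi / 32 * (\<Sum>j=1..N. (L2_norm_S2 (div_S2 (u j)))\<^sup>2))"
      by (simp add: mode_energy_def)
  qed
qed

end
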